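(* Let $N\ge5$, $d_1,\dots,d_N\ge2$, and let $\rho$ be any (normalized) mixed state on $H_1\otimes\cdots\otimes H_N$ with $\dim H_i=d_i$. Then $$C_N^2(\rho)\ \ge\ \frac{N}{2^{N-2}(d_1-1)(d_2-1)\cdots(d_N-1)}\sum_{\rho_{2\otimes\cdots\otimes2}}\ \sum_{i=1}^{N-1}\sum_{j=i+1}^{N}C_{ij}^2(\rho_{2\otimes2\otimes\cdots\otimes2}),$$ where the outer sum runs over all possible $2\otimes2\otimes\cdots\otimes2$ substates $\rho_{2\otimes\cdots\otimes2}$ of $\rho$.
   Context: Each $H_i\cong\mathbb{C}^{d_i}$ has a fixed computational basis. For a (not necessarily normalized) vector $|\varphi\rangle\in H_1\otimes\cdots\otimes H_N$ with $\sigma=|\varphi\rangle\langle\varphi|$, $C_N(|\varphi\rangle)=2^{1-N/2}\sqrt{(2^N-2)(\mathrm{tr}\,\sigma)^2-\sum_\alpha \mathrm{tr}(\sigma_\alpha^2)}$, where $\alpha$ runs over all $2^N-2$ nonempty proper subsets of $\{1,\dots,N\}$ and $\sigma_\alpha=\mathrm{tr}_{\bar\alpha}\sigma$; for mixed $\rho$, $C_N(\rho)=\min\sum_ip_iC_N(|\varphi_i\rangle)$ over all ensembles $\rho=\sum_ip_i|\varphi_i\rangle\langle\varphi_i|$. Substates: given subsets $S_i\subseteq\{1,\dots,d_i\}$ with $|S_i|=2$ and $G_i=\sum_{x\in S_i}|x\rangle\langle x|$, the $2\otimes\cdots\otimes2$ substate is the unnormalized $N$-qubit operator $(\otimes_iG_i)\rho(\otimes_iG_i)$.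 For an (unnormalized) $N$-qubit operator $\tau$, $C_{ij}(\tau)$ is the Wootters concurrence of the two-qubit reduced operator $\tau_{ij}$ (partial trace over all qubits except $i,j$): $C(\omega)=\max\{0,\lambda_1-\lambda_2-\lambda_3-\lambda_4\}$ where $\lambda_1\ge\dots\ge\lambda_4$ are the square roots of the eigenvalues of $\omega(\sigma_y\otimes\sigma_y)\omega^*(\sigma_y\otimes\sigma_y)$. *)

theory Defs
  imports "Jordan_Normal_Form.Char_Poly" "HOL-Library.Multiset"
begin

text \<open>Parties are indexed 0..N-1 (paper: 1..N); party i has local dimension d i,
  computational basis {0..<d i}. A basis configuration of the parties in a set A is
  a function x :: nat => nat with x i < d i for i in A and x i = 0 outside A.
  Operators / vectors are functions on configurations.\<close>

definition configs :: "(nat \<Rightarrow> nat) \<Rightarrow> nat set \<Rightarrow> (nat \<Rightarrow> nat) set" where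
  "configs d A = {x. (\<forall>i\<in>A. x i < d i) \<and> (\<forall>i. i \<notin> A \<longrightarrow> x i = 0)}"

definition merge :: "nat set \<Rightarrow> (nat \<Rightarrow> nat) \<Rightarrow> (nat \<Rightarrow> nat) \<Rightarrow> (nat \<Rightarrow> nat)" where
  "merge A x z = (\<lambda>i. if i \<in> A then x i else z i)"

type_synonym qop = "(nat \<Rightarrow> nat) \<Rightarrow> (nat \<Rightarrow> nat) \<Rightarrow> complex"

definition ptrace :: "(nat \<Rightarrow> nat) \<Rightarrow> nat set \<Rightarrow> nat set \<Rightarrow> qop \<Rightarrow> qop" where
  "ptrace d U A \<rho> = (\<lambda>x y. \<Sum>z\<in>configs d (U - A). \<rho> (merge A x z) (merge A y z))"

definition tr :: "(nat \<Rightarrow> nat) \<Rightarrow> nat set \<Rightarrow> qop \<Rightarrow> complex" where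
  "tr d A M = (\<Sum>x\<in>configs d A. M x x)"

definition trsq :: "(nat \<Rightarrow> nat) \<Rightarrow> nat set \<Rightarrow> qop \<Rightarrow> complex" where
  "trsq d A M = (\<Sum>x\<in>configs d A. \<Sum>y\<in>configs d A. M x y * M y x)"

definition proj :: "((nat \<Rightarrow> nat) \<Rightarrow> complex) \<Rightarrow> qop" where
  "proj \<phi> = (\<lambda>x y. \<phi> x * cnj (\<phi> y))"

definition CN_pure :: "nat \<Rightarrow> (nat \<Rightarrow> nat) \<Rightarrow> ((nat \<Rightarrow> nat) \<Rightarrow> complex) \<Rightarrow> real" where
  "CN_pure N d \<phi> =
     (let \<sigma> = proj \<phi>; U = {..<N} in
      2 powr (1 - real N / 2) *
      sqrt ((2 ^ N - 2) * (Re (tr d U \<sigma>))\<^sup>2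
            - (\<Sum>\<alpha>\<in>{\<alpha>. \<alpha> \<subseteq> U \<and> \<alpha> \<noteq> {} \<and> \<alpha> \<noteq> U}.
                  Re (trsq d \<alpha> (ptrace d U \<alpha> \<sigma>)))))"

definition normalized_vec :: "nat \<Rightarrow> (nat \<Rightarrow> nat) \<Rightarrow> ((nat \<Rightarrow> nat) \<Rightarrow> complex) \<Rightarrow> bool" where
  "normalized_vec N d \<phi> \<longleftrightarrow> (\<Sum>x\<in>configs d {..<N}. (cmod (\<phi> x))\<^sup>2) = 1"

definition CN_mixed :: "nat \<Rightarrow> (nat \<Rightarrow> nat) \<Rightarrow> qop \<Rightarrow> real" where
  "CN_mixed N d \<rho> = Inf {(\<Sum>k<n. p k * CN_pure N d (\<phi> k)) | (n::nat) p \<phi>.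
       (\<forall>k<n. p k \<ge> 0) \<and> (\<Sum>k<n. p k) = 1 \<and> (\<forall>k<n. normalized_vec N d (\<phi> k)) \<and>
       (\<forall>x\<in>configs d {..<N}. \<forall>y\<in>configs d {..<N}.
            \<rho> x y = (\<Sum>k<n. complex_of_real (p k) * proj (\<phi> k) x y))}"

definition density_op :: "nat \<Rightarrow> (nat \<Rightarrow> nat) \<Rightarrow> qop \<Rightarrow> bool" where
  "density_op N d \<rho> \<longleftrightarrow>
     (\<forall>v. let q = (\<Sum>x\<in>configs d {..<N}. \<Sum>y\<in>configs d {..<N}. cnj (v x) * \<rho> x y * v y)
          in Im q = 0 \<and> Re q \<ge> 0) \<and> tr d {..<N} \<rho> = 1"

text \<open>The 2 x ... x 2 substate (unnormalized N-qubit operator) for the choice of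
  two-element subsets S i of {0..<d i}: the smaller element of S i is identified
  with qubit value 0, the larger with 1 (the block of (G_1 x..x G_N) rho (G_1 x..x G_N)).\<close>
definition emb :: "nat \<Rightarrow> (nat \<Rightarrow> nat set) \<Rightarrow> (nat \<Rightarrow> nat) \<Rightarrow> (nat \<Rightarrow> nat)" where
  "emb N S x = (\<lambda>i. if i < N then sorted_list_of_set (S i) ! x i else 0)"

definition substate :: "nat \<Rightarrow> (nat \<Rightarrow> nat set) \<Rightarrow> qop \<Rightarrow> qop" where
  "substate N S \<rho> = (\<lambda>x y. \<rho> (emb N S x) (emb N S y))"

definition substate_choices :: "nat \<Rightarrow> (nat \<Rightarrow> nat) \<Rightarrow> (nat \<Rightarrow> nat set) set" where
  "substate_choices N d = PiE {..<N} (\<lambda>i. {T. T \<subseteq> {..<d i} \<and> card T = 2})"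

definition two_qubit_red :: "nat \<Rightarrow> qop \<Rightarrow> nat \<Rightarrow> nat \<Rightarrow> complex mat" where
  "two_qubit_red N \<tau> i j =
     (let red = ptrace (\<lambda>_. 2) {..<N} {i, j} \<tau>;
          cf = (\<lambda>q :: nat. (\<lambda>k. if k = i then q div 2 else if k = j then q mod 2 else 0))
      in mat 4 4 (\<lambda>(p, q). red (cf p) (cf q)))"

definition sigma_yy :: "complex mat" where
  "sigma_yy = mat 4 4 (\<lambda>(p, q). if (p, q) = (0, 3) \<or> (p, q) = (3, 0) then -1
                               else if (p, q) = (1, 2) \<or> (p, q) = (2, 1) then 1 else 0)"

text \<open>Wootters concurrence: lambda_1 >= ... >= lambda_4 are the square roots of the
  eigenvalues (with multiplicity, roots of the characteristic polynomial; they are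
  real and nonnegative for positive semidefinite omega) of
  omega (sigma_y x sigma_y) omega^* (sigma_y x sigma_y).\<close>
definition wootters :: "complex mat \<Rightarrow> real" where
  "wootters \<omega> =
     (let R = \<omega> * sigma_yy * map_mat cnj \<omega> * sigma_yy;
          L = rev (sorted_list_of_multiset (image_mset (\<lambda>r. sqrt (Re r)) (proots (char_poly R))))
      in max 0 (L ! 0 - L ! 1 - L ! 2 - L ! 3))"

definition Cij :: "nat \<Rightarrow> qop \<Rightarrow> nat \<Rightarrow> nat \<Rightarrow> real" where
  "Cij N \<tau> i j = wootters (two_qubit_red N \<tau> i j)"

end

theory Submission
  imports Defs "HOL-Analysis.L2_Norm"
begin

text \<open>
  If \<open>\<tau> \<ge> 0\<close> is a two-qubit operator and \<open>X\<close> a \<open>2 \<times> 2\<close> matrix of determinant 1, viewed as a vector,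
  then \<open>- \<langle>X | \<tau>\<^sup>\<Gamma> | X\<rangle>\<close> (\<open>\<Gamma>\<close> the partial transpose) is linear in \<open>\<tau>\<close>, and its supremum over \<open>X\<close>, cut
  off at 0, is the Wootters concurrence; only the upper bound on the concurrence is needed. It follows from
  Takagi's factorisation of \<open>\<tau>\<close> and a determinant-1 conjugation that turns the other Takagi vectors, divided by
  the dominant one, into multiples of Pauli matrices.

  For witnesses, monogamy on a pure state of qubits \<open>A, B\<^sub>1, \<dots>, B\<^sub>n\<close> is proved by measuring one \<open>B\<^sub>j\<close>: linearity
  splits the other witnesses over the outcomes, and a suitable measurement basis, read off from
  \<open>X\<^sub>j\<close>, decreases \<open>4 det \<rho>\<^sub>A\<close> on average by at least the square of the \<open>j\<close>-th witness. Measuring a second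
  qubit of a two-party block extends the bound to cuts of size 2 by concavity. Summing over the
  cuts of size 1, 2, N-2 and N-1, which differ for \<open>N \<ge> 5\<close>, gives the factor \<open>N\<close>.

  In dimension \<open>d\<close>, \<open>(tr \<sigma>)\<^sup>2 - tr \<sigma>\<^sub>\<alpha>\<^sup>2\<close> is half the sum of all squared \<open>2 \<times> 2\<close> minors, and a minor
  occurs in at most \<open>(d\<^sub>1 - 1) \<cdots> (d\<^sub>N - 1)\<close> qubit substates. Minkowski's inequality passes to ensembles.
\<close>

section \<open>Complex 2 by 2 matrices\<close>

text \<open>A concurrence is not linear in the state, whereas a witness value is; so one matrix
  \<open>X\<close> for each substate and pair, chosen from the mixed state alone, can be evaluated
  on every member of an ensemble and on every measurement outcome. The supremum over determinant-1
  matrices need not be attained, because the conjugation orbit of a nonzero nilpotent matrix has 0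
  as a limit point outside it; hence witnesses reach the concurrence only up to
  \<open>\<epsilon>\<close>, which is removed after the ensemble estimate. The constant arises as
  follows. Let T be the sum of the squared positive parts of the witness values over unordered pairs
  of qubits. The cuts of size 1 carry at least 2T in total, each pair being seen from both ends, and
  the cuts of size 2 at least (N-2)T. Complementary cuts have equal values, which gives 2(2T +
  (N-2)T) = 2NT. The squared pure-state concurrence is the total over all cuts divided by
  \<open>2 ^ (N - 1)\<close>, hence the factor \<open>N / 2 ^ (N - 2)\<close>.\<close>

datatype m2 = M2 (e11: complex) (e12: complex) (e21: complex) (e22: complex)

instantiation m2 :: ring_1
begin
definition "0 = M2 0 0 0 0"
definition "1 = M2 1 0 0 1"
definition "A + B = M2 (e11 A + e11 B) (e12 A + e12 B) (e21 A + e21 B) (e22 A + e22 B)"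
definition "A - B = M2 (e11 A - e11 B) (e12 A - e12 B) (e21 A - e21 B) (e22 A - e22 B)"
definition "- A = M2 (- e11 A) (- e12 A) (- e21 A) (- e22 A)"
definition "A * B = M2 (e11 A * e11 B + e12 A * e21 B) (e11 A * e12 B + e12 A * e22 B)
                       (e21 A * e11 B + e22 A * e21 B) (e21 A * e12 B + e22 A * e22 B)"
instance
  by standard (auto simp: zero_m2_def one_m2_def plus_m2_def minus_m2_def uminus_m2_def times_m2_def
      algebra_simps)
end

lemma m2_sel [simp]:
  "e11 0 = 0" "e12 0 = 0" "e21 0 = 0" "e22 0 = 0"
  "e11 1 = 1" "e12 1 = 0" "e21 1 = 0" "e22 1 = 1"
  "e11 (A + B) = e11 A + e11 B" "e12 (A + B) = e12 A + e12 B"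
  "e21 (A + B) = e21 A + e21 B" "e22 (A + B) = e22 A + e22 B"
  "e11 (A * B) = e11 A * e11 B + e12 A * e21 B" "e12 (A * B) = e11 A * e12 B + e12 A * e22 B"
  "e21 (A * B) = e21 A * e11 B + e22 A * e21 B" "e22 (A * B) = e21 A * e12 B + e22 A * e22 B"
  by (auto simp: zero_m2_def one_m2_def plus_m2_def times_m2_def)

lemma m2_sel_sum [simp]:
  "e11 (sum f I) = (\<Sum>i\<in>I. e11 (f i))" "e12 (sum f I) = (\<Sum>i\<in>I. e12 (f i))"
  "e21 (sum f I) = (\<Sum>i\<in>I. e21 (f i))" "e22 (sum f I) = (\<Sum>i\<in>I. e22 (f i))"
  by (induct I rule: infinite_finite_induct; simp)+

definition tp :: "m2 \<Rightarrow> m2" where "tp A = M2 (e11 A) (e21 A) (e12 A) (e22 A)"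
definition cj :: "m2 \<Rightarrow> m2" where "cj A = M2 (cnj (e11 A)) (cnj (e12 A)) (cnj (e21 A)) (cnj (e22 A))"
definition dg :: "m2 \<Rightarrow> m2" where "dg A = M2 (cnj (e11 A)) (cnj (e21 A)) (cnj (e12 A)) (cnj (e22 A))"
definition adjug :: "m2 \<Rightarrow> m2" where "adjug A = M2 (e22 A) (- e12 A) (- e21 A) (e11 A)"
definition tr2 :: "m2 \<Rightarrow> complex" where "tr2 A = e11 A + e22 A"
definition det2 :: "m2 \<Rightarrow> complex" where "det2 A = e11 A * e22 A - e12 A * e21 A"
definition sc :: "complex \<Rightarrow> m2" where "sc c = M2 c 0 0 c"

lemma m2_ops_sel [simp]:
  "e11 (tp A) = e11 A" "e12 (tp A) = e21 A" "e21 (tp A) = e12 A" "e22 (tp A) = e22 A"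
  "e11 (cj A) = cnj (e11 A)" "e12 (cj A) = cnj (e12 A)" "e21 (cj A) = cnj (e21 A)" "e22 (cj A) = cnj (e22 A)"
  "e11 (dg A) = cnj (e11 A)" "e12 (dg A) = cnj (e21 A)" "e21 (dg A) = cnj (e12 A)" "e22 (dg A) = cnj (e22 A)"
  "e11 (adjug A) = e22 A" "e12 (adjug A) = - e12 A" "e21 (adjug A) = - e21 A" "e22 (adjug A) = e11 A"
  "e11 (sc c) = c" "e12 (sc c) = 0" "e21 (sc c) = 0" "e22 (sc c) = c"
  by (auto simp: tp_def cj_def dg_def adjug_def sc_def)

lemma m2_eqI: "e11 A = e11 B \<Longrightarrow> e12 A = e12 B \<Longrightarrow> e21 A = e21 B \<Longrightarrow> e22 A = e22 B \<Longrightarrow> A = B"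
  by (cases A; cases B) auto

lemma tp_mult: "tp (A * B) = tp B * tp A"
  and cj_mult: "cj (A * B) = cj A * cj B"
  and dg_mult: "dg (A * B) = dg B * dg A"
  and tp_tp [simp]: "tp (tp A) = A"
  and dg_dg [simp]: "dg (dg A) = A"
  and tp_cj [simp]: "tp (cj A) = dg A"
  and cj_tp [simp]: "cj (tp A) = dg A"
  and dg_tp [simp]: "dg (tp A) = cj A"
  and tp_dg [simp]: "tp (dg A) = cj A"
  and dg_cj [simp]: "dg (cj A) = tp A"
  and tp_one [simp]: "tp 1 = 1"
  and dg_one [simp]: "dg 1 = 1" 
  by (auto intro!: m2_eqI simp: algebra_simps)

lemma det2_mult: "det2 (A * B) = det2 A * det2 B"
  and det2_tp [simp]: "det2 (tp A) = det2 A"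
  and det2_cj [simp]: "det2 (cj A) = cnj (det2 A)"
  and det2_dg [simp]: "det2 (dg A) = cnj (det2 A)"
  and det2_one [simp]: "det2 1 = 1"
  and det2_sc [simp]: "det2 (sc c) = c\<^sup>2"
  and det2_adjug [simp]: "det2 (adjug A) = det2 A"
  by (auto simp: det2_def algebra_simps power2_eq_square)

lemma tr2_mult_commute: "tr2 (A * B) = tr2 (B * A)"
  and tr2_add: "tr2 (A + B) = tr2 A + tr2 B"
  by (auto simp: tr2_def algebra_simps)

lemma tr2_sum: "tr2 (sum f I) = (\<Sum>i\<in>I. tr2 (f i))"
  by (simp add: tr2_def sum.distrib)

lemma dg_sum: "dg (sum f I) = (\<Sum>i\<in>I. dg (f i))"
  by (auto intro!: m2_eqI)

lemma mult_adjug: "A * adjug A = sc (det2 A)" "adjug A * A = sc (det2 A)"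
  by (auto intro!: m2_eqI simp: det2_def algebra_simps)

lemma sc_one [simp]: "sc 1 = 1"
  by (auto intro!: m2_eqI)

text \<open>The equation \<open>dg F * F = 1\<close> encodes unitarity throughout; the other order
  follows because the adjugate identifies \<open>dg F\<close> with the two-sided inverse.\<close>

lemma dg_mult_self_commute:
  assumes "dg F * F = 1" shows "F * dg F = 1"
proof -
  have d: "det2 (dg F) * det2 F = 1" using assms by (metis det2_mult det2_one)
  have "dg F = dg F * (F * adjug F) * sc (1 / det2 F)"
    using d by (auto simp: mult_adjug intro!: m2_eqI)
  also have "\<dots> = adjug F * sc (1 / det2 F)"
    using assms by (simp add: mult.assoc[symmetric])
  finally have "F * dg F = F * adjug F * sc (1 / det2 F)"
    by (metis mult.assoc)
  also have "\<dots> = 1" using d by (auto simp: mult_adjug intro!: m2_eqI)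
  finally show ?thesis .
qed

text \<open>Unit eigenvector of the larger eigenvalue, completed by its orthogonal complement.\<close>
lemma hermitian_diagonalize:
  assumes "dg H = H"
  obtains F l1 l2 where "dg F * F = 1" "H = F * M2 (of_real l1) 0 0 (of_real l2) * dg F"
proof (cases "e12 H = 0")
  case True
  have "e21 H = 0" using assms True by (metis complex_cnj_zero m2_ops_sel(11))
  moreover have "e11 H = of_real (Re (e11 H))" "e22 H = of_real (Re (e22 H))"
    using assms by (metis Reals_cnj_iff complex_is_Real_iff of_real_Re m2_ops_sel(9),
        metis Reals_cnj_iff complex_is_Real_iff of_real_Re m2_ops_sel(12))
  ultimately show ?thesis using True
    by (intro that[of 1 "Re (e11 H)" "Re (e22 H)"]) (auto intro!: m2_eqI)
next
  case False
  define g where "g = e12 H"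
  define a b where "a = Re (e11 H)" and "b = Re (e22 H)"
  have H: "H = M2 (of_real a) g (cnj g) (of_real b)"
  proof (rule m2_eqI)
    show "e11 H = e11 (M2 (of_real a) g (cnj g) (of_real b))"
      using assms unfolding a_def by (metis Reals_cnj_iff m2.sel(1) of_real_Re m2_ops_sel(9))
    show "e22 H = e22 (M2 (of_real a) g (cnj g) (of_real b))"
      using assms unfolding b_def by (metis Reals_cnj_iff m2.sel(4) of_real_Re m2_ops_sel(12))
    show "e21 H = e21 (M2 (of_real a) g (cnj g) (of_real b))"
      using assms unfolding g_def by (metis m2.sel(3) m2_ops_sel(11))
  qed (simp add: g_def)
  define q where "q = (cmod g)\<^sup>2"
  \<comment> \<open>Here \<open>r\<close> is half the spectral gap, so \<open>a + y\<close> and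
    \<open>b - y\<close> are the mean of \<open>a\<close> and \<open>b\<close> plus and minus
    \<open>r\<close>; the column with entries \<open>g\<close> and \<open>y\<close> is an
    unnormalised eigenvector for \<open>a + y\<close>.\<close>
  define D where "D = (a - b) / 2"
  define r where "r = sqrt (D\<^sup>2 + q)"
  define y where "y = r - D"
  define n where "n = sqrt (q + y\<^sup>2)"
  have q: "q > 0" using False by (simp add: q_def g_def)
  have "r > \<bar>D\<bar>" unfolding r_def using q by (intro real_less_rsqrt) auto
  then have y: "y > 0" unfolding y_def by linarith
  have n: "n > 0" "n\<^sup>2 = q + y\<^sup>2" unfolding n_def using q by (auto simp: add_pos_nonneg)
  have y2: "y\<^sup>2 + 2 * D * y = q" 
  proof -
    have "r\<^sup>2 = D\<^sup>2 + q" unfolding r_def using q by simp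
    then show ?thesis unfolding y_def by (simp add: power2_eq_square algebra_simps)
  qed
  have gg: "g * cnj g = of_real q" unfolding q_def using complex_norm_square[of g] by simp
  define F where "F = M2 (g / of_real n) (- of_real (y / n)) (of_real (y / n)) (cnj g / of_real n)"
  have nn: "of_real n * of_real n = (of_real q + of_real y * of_real y :: complex)"
    using n(2) by (metis of_real_add of_real_mult power2_eq_square)
  have n0: "of_real n \<noteq> (0::complex)" using n by simp
  have F1: "dg F * F = 1"
  proof -
    have "(of_real q + of_real y * of_real y) / (of_real n * of_real n) = (1::complex)"
      using nn n0 by (metis divide_self mult_eq_0_iff)
    then show ?thesis
      using gg by (auto intro!: m2_eqI simp: F_def mult.commute add_divide_distrib add.commute)
  qed
  have DH: "dg F * H * F = M2 (of_real (a + y)) 0 0 (of_real (b - y))"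
  proof -
    have bb: "complex_of_real b = of_real a - 2 * of_real D" unfolding D_def by (simp add: field_simps)
    have y2c: "of_real q = (of_real y * of_real y + 2 * of_real D * of_real y :: complex)"
      using y2 by (metis (no_types, lifting) of_real_add of_real_mult of_real_numeral power2_eq_square)
    have gg': "cnj g * g = of_real q" using gg by (simp add: mult.commute)
    \<comment> \<open>These are the entries of the conjugated matrix with denominators cleared;
      \<open>h\<close>, \<open>k\<close>, \<open>u\<close>, \<open>v\<close>, \<open>w\<close>,
      \<open>p\<close> stand for \<open>cnj g\<close>, \<open>g\<close>, \<open>a\<close>,
      \<open>y\<close>, \<open>D\<close>, \<open>q\<close>. Each identity is certified as an
      explicit combination of the two relations assumed.\<close>
    have poly_ids:
      "(h * u + v * h) * k + (h * k + v * (u - 2 * w)) * v = (u + v) * (p + v * v)"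
      "(h * u + v * h) * (- v) + (h * k + v * (u - 2 * w)) * h = 0"
      "(- v * u + k * h) * k + (- v * k + k * (u - 2 * w)) * v = 0"
      "(- v * u + k * h) * (- v) + (- v * k + k * (u - 2 * w)) * h = (u - 2 * w - v) * (p + v * v)"
      if "k * h = p" "p = v * v + 2 * w * v" for u v w p h k :: complex
    proof -
      have z: "k * h - p = 0" "p - v * v - 2 * w * v = 0" using that by auto
      have "(h * u + v * h) * k + (h * k + v * (u - 2 * w)) * v - (u + v) * (p + v * v)
          = (u + 2 * v) * (k * h - p) + v * (p - v * v - 2 * w * v)" by (simp add: algebra_simps)
      then show "(h * u + v * h) * k + (h * k + v * (u - 2 * w)) * v = (u + v) * (p + v * v)"
        unfolding z by simp
      have "(h * u + v * h) * (- v) + (h * k + v * (u - 2 * w)) * h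
          = h * (k * h - p) + h * (p - v * v - 2 * w * v)" by (simp add: algebra_simps)
      then show "(h * u + v * h) * (- v) + (h * k + v * (u - 2 * w)) * h = 0"
        unfolding z by simp
      have "(- v * u + k * h) * k + (- v * k + k * (u - 2 * w)) * v
          = k * (k * h - p) + k * (p - v * v - 2 * w * v)" by (simp add: algebra_simps)
      then show "(- v * u + k * h) * k + (- v * k + k * (u - 2 * w)) * v = 0"
        unfolding z by simp
      have "(- v * u + k * h) * (- v) + (- v * k + k * (u - 2 * w)) * h - (u - 2 * w - v) * (p + v * v)
          = (u - 2 * w - 2 * v) * (k * h - p) - v * (p - v * v - 2 * w * v)" by (simp add: algebra_simps)
      then show "(- v * u + k * h) * (- v) + (- v * k + k * (u - 2 * w)) * h = (u - 2 * w - v) * (p + v * v)"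
        unfolding z by simp
    qed
    note ids = poly_ids[OF gg y2c, of "of_real a"]
    have 1: "(cnj g * of_real a + of_real y * cnj g) * g + (cnj g * g + of_real y * of_real b) * of_real y
       = of_real (a + y) * (of_real n * of_real n)"
      unfolding nn bb of_real_add by (rule ids(1))
    have 2: "(cnj g * of_real a + of_real y * cnj g) * (- of_real y) + (cnj g * g + of_real y * of_real b) * cnj g
       = 0 * (of_real n * of_real n)"
      unfolding bb using ids(2) by simp
    have 3: "(- of_real y * of_real a + g * cnj g) * g + (- of_real y * g + g * of_real b) * of_real y
       = 0 * (of_real n * of_real n)"
      unfolding bb using ids(3) by simp
    have 4: "(- of_real y * of_real a + g * cnj g) * (- of_real y) + (- of_real y * g + g * of_real b) * cnj g
       = of_real (b - y) * (of_real n * of_real n)"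
      unfolding nn of_real_diff bb by (rule ids(4))
    define F0 where "F0 = M2 g (- of_real y) (of_real y) (cnj g)"
    have "F = F0 * sc (1 / of_real n)"
      by (auto intro!: m2_eqI simp: F_def F0_def)
    moreover have "dg F = sc (1 / of_real n) * dg F0"
      by (auto intro!: m2_eqI simp: F_def F0_def)
    moreover have "dg F0 * H * F0 = M2 (of_real (a + y) * (of_real n * of_real n)) 0 0
        (of_real (b - y) * (of_real n * of_real n))"
      using 1 2 3 4 by (auto intro!: m2_eqI simp: F0_def H)
    ultimately have "dg F * H * F = sc (1 / of_real n) * M2 (of_real (a + y) * (of_real n * of_real n)) 0 0
        (of_real (b - y) * (of_real n * of_real n)) * sc (1 / of_real n)"
      by (metis mult.assoc)
    also have "\<dots> = M2 (of_real (a + y)) 0 0 (of_real (b - y))"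
      using n0 by (auto intro!: m2_eqI)
    finally show ?thesis .
  qed
  have "H = F * dg F * H * (F * dg F)"
    using dg_mult_self_commute[OF F1] by simp
  also have "\<dots> = F * (dg F * H * F) * dg F" by (simp add: mult.assoc)
  finally have "H = F * M2 (of_real (a + y)) 0 0 (of_real (b - y)) * dg F" unfolding DH .
  with F1 show ?thesis by (rule that)
qed

section \<open>Concurrence witnesses and an optimal measurement\<close>

text \<open>The value at \<open>|M\<rangle>\<langle>M|\<close> of the witness \<open>- |X\<rangle>\<langle>X|\<^sup>\<Gamma>\<close>; the entry \<open>M\<^sub>a\<^sub>b\<close> is the amplitude of \<open>|ab\<rangle>\<close>.\<close>
definition witness :: "m2 \<Rightarrow> m2 \<Rightarrow> real" where
  "witness X M = - Re (tr2 (dg X * M * tp X * cj M))"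

lemma unitary_det:
  assumes "dg F * F = 1" shows "det2 F * cnj (det2 F) = 1"
  by (metis assms det2_dg det2_mult det2_one mult.commute)

lemma unitary_tp:
  assumes "dg F * F = 1" shows "cj F * tp F = 1"
  by (metis assms dg_mult_self_commute tp_dg tp_mult tp_one)

text \<open>The phases \<open>1\<close> and \<open>\<i>\<close> give cross terms of opposite sign,
  so one of them does not shrink the modulus.\<close>

lemma cmod_sq_le_rotated:
  obtains \<zeta> :: complex where "\<zeta> * cnj \<zeta> = 1" "cmod u \<le> cmod (\<zeta> * u + cnj \<zeta> * v)"
proof -
  have *: "(cmod (1 * u + cnj 1 * v))\<^sup>2 = (cmod u)\<^sup>2 + (cmod v)\<^sup>2 + 2 * Re (u * cnj v)"
    "(cmod (\<i> * u + cnj \<i> * v))\<^sup>2 = (cmod u)\<^sup>2 + (cmod v)\<^sup>2 - 2 * Re (u * cnj v)"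
    unfolding cmod_power2 by (simp_all add: power2_eq_square algebra_simps)
  consider "(cmod u)\<^sup>2 \<le> (cmod (1 * u + cnj 1 * v))\<^sup>2" | "(cmod u)\<^sup>2 \<le> (cmod (\<i> * u + cnj \<i> * v))\<^sup>2"
    unfolding * using zero_le_power2[of "cmod v"] by linarith
  then show ?thesis
    by cases (auto intro: that[of 1] that[of \<i>] dest: power2_le_imp_le)
qed

text \<open>In the bases that diagonalise the B-marginal relative to \<open>X\<close>, only one off-diagonal
  correlation \<open>u\<close> contributes positively to the witness, and the Hermitian \<open>E\<close> picks it out.\<close>
lemma witness_le_hermitian_probe:
  assumes X: "det2 X = 1"
  obtains E where "dg E = E" "det2 E = -1" "tr2 (\<Sum>z\<in>Z. M z * E * dg (M z)) = 0"
    "(max 0 (\<Sum>z\<in>Z. witness X (M z)))\<^sup>2 \<le> - 4 * Re (det2 (\<Sum>z\<in>Z. M z * E * dg (M z)))"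
proof -
  define S where "S = (\<Sum>z\<in>Z. dg (M z) * M z)"
  have S: "dg S = S" unfolding S_def dg_sum by (simp add: dg_mult)
  have "dg (cj X * S * tp X) = cj X * S * tp X"
    using S by (simp add: dg_mult mult.assoc)
  then obtain F l1 l2 where F: "dg F * F = 1"
    and K: "cj X * S * tp X = F * M2 (of_real l1) 0 0 (of_real l2) * dg F"
    by (rule hermitian_diagonalize)
  note F' = dg_mult_self_commute[OF F]
  note F'' = unitary_tp[OF F]
  define T where "T = tp X * F"
  define N where "N z = tp F * M z * T" for z
  define u where "u = (\<Sum>z\<in>Z. e12 (N z) * cnj (e21 (N z)))"
  define v where "v = (\<Sum>z\<in>Z. e11 (N z) * cnj (e22 (N z)))"
  obtain \<zeta> where \<zeta>: "\<zeta> * cnj \<zeta> = 1" "cmod u \<le> cmod (\<zeta> * u + cnj \<zeta> * v)"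
    by (rule cmod_sq_le_rotated)
  \<comment> \<open>Being off-diagonal, \<open>E0\<close> has trace zero against the diagonal
    marginal of the blocks \<open>N z\<close>; the unit phase \<open>\<zeta>\<close> fixes the
    determinant -1 and keeps \<open>e12 \<Psi>\<close> at least as large as \<open>u\<close> in
    modulus.\<close>
  define E0 where "E0 = M2 0 (cnj \<zeta>) \<zeta> 0"
  define E where "E = T * E0 * dg T"
  define \<Phi> where "\<Phi> = (\<Sum>z\<in>Z. M z * E * dg (M z))"
  define \<Psi> where "\<Psi> = (\<Sum>z\<in>Z. N z * E0 * dg (N z))"
  have E0: "dg E0 = E0" unfolding E0_def by (auto intro!: m2_eqI)
  have E: "dg E = E" unfolding E_def by (simp add: dg_mult E0 mult.assoc)
  have detT: "det2 T = det2 F" unfolding T_def by (simp add: det2_mult X)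
  have detE: "det2 E = -1"
  proof -
    have "det2 E = (det2 F * cnj (det2 F)) * det2 E0"
      unfolding E_def by (simp add: det2_mult detT mult_ac)
    also have "det2 E0 = -1" unfolding E0_def det2_def using \<zeta>(1) by (simp add: mult.commute)
    also have "(det2 F * cnj (det2 F)) * -1 = -1" unfolding unitary_det[OF F] by simp
    finally show ?thesis .
  qed
  have \<Psi>\<Phi>: "\<Psi> = tp F * \<Phi> * cj F"
    unfolding \<Psi>_def \<Phi>_def sum_distrib_left sum_distrib_right N_def E_def
    by (simp add: dg_mult mult.assoc)
  have "det2 \<Psi> = (det2 F * cnj (det2 F)) * det2 \<Phi>" unfolding \<Psi>\<Phi> by (simp add: det2_mult mult_ac)
  then have det\<Psi>: "det2 \<Psi> = det2 \<Phi>" by (simp add: unitary_det[OF F])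
  have "tr2 \<Psi> = tr2 (cj F * (tp F * \<Phi>))" unfolding \<Psi>\<Phi> by (rule tr2_mult_commute)
  also have "\<dots> = tr2 \<Phi>" by (metis F'' mult.assoc mult_1)
  finally have tr\<Psi>: "tr2 \<Psi> = tr2 \<Phi>" .
  have NN: "(\<Sum>z\<in>Z. dg (N z) * N z) = M2 (of_real l1) 0 0 (of_real l2)"
  proof -
    have "dg (N z) * N z = dg F * (cj X * (dg (M z) * M z) * tp X) * F" for z
    proof -
      have "dg (N z) * N z = dg T * dg (M z) * (cj F * tp F) * M z * T"
        unfolding N_def by (simp add: dg_mult mult.assoc)
      then show ?thesis unfolding F'' by (simp add: T_def dg_mult mult.assoc)
    qed
    then have "(\<Sum>z\<in>Z. dg (N z) * N z) = dg F * (cj X * S * tp X) * F"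
      unfolding S_def sum_distrib_left sum_distrib_right by simp
    also have "\<dots> = (dg F * F) * M2 (of_real l1) 0 0 (of_real l2) * (dg F * F)"
      unfolding K by (simp add: mult.assoc)
    finally show ?thesis unfolding F by simp
  qed
  have "tr2 \<Psi> = (\<Sum>z\<in>Z. tr2 (E0 * (dg (N z) * N z)))"
    unfolding \<Psi>_def tr2_sum by (intro sum.cong refl) (metis mult.assoc tr2_mult_commute)
  also have "\<dots> = tr2 (E0 * M2 (of_real l1) 0 0 (of_real l2))"
    unfolding NN[symmetric] by (simp only: sum_distrib_left tr2_sum)
  also have "\<dots> = 0" by (simp add: E0_def tr2_def)
  finally have tr0: "tr2 \<Psi> = 0" .
  have \<Psi>h: "dg \<Psi> = \<Psi>" unfolding \<Psi>_def dg_sum by (simp add: dg_mult E0 mult.assoc)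
  have \<Psi>12: "e12 \<Psi> = \<zeta> * u + cnj \<zeta> * v"
    unfolding \<Psi>_def u_def v_def E0_def by (simp add: sum_distrib_left sum.distrib algebra_simps)
  have "(cmod u)\<^sup>2 \<le> - Re (det2 \<Psi>)"
  proof -
    have "e22 \<Psi> = - e11 \<Psi>" using tr0 unfolding tr2_def by (simp add: add_eq_0_iff)
    moreover have "e21 \<Psi> = cnj (e12 \<Psi>)" using \<Psi>h by (metis m2_ops_sel(11))
    moreover have "Im (e11 \<Psi>) = 0" using \<Psi>h by (metis Reals_cnj_iff complex_is_Real_iff m2_ops_sel(9))
    ultimately have "- Re (det2 \<Psi>) = (Re (e11 \<Psi>))\<^sup>2 + (cmod (e12 \<Psi>))\<^sup>2"
      unfolding det2_def cmod_power2 by (simp add: power2_eq_square)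
    moreover have "(cmod u)\<^sup>2 \<le> (cmod (e12 \<Psi>))\<^sup>2"
      unfolding \<Psi>12 by (rule power_mono[OF \<zeta>(2)]) simp
    ultimately show ?thesis by (smt (verit) zero_le_power2)
  qed
  moreover have "(\<Sum>z\<in>Z. witness X (M z)) \<le> 2 * cmod u"
  proof -
    \<comment> \<open>By cyclicity of the trace the unitary factors cancel, leaving
      \<open>- Re (tr2 (N z * cj (N z)))\<close>. The diagonal entries contribute minus a sum of
      squares and are dropped.\<close>
    have "witness X (M z) \<le> - 2 * Re (e12 (N z) * cnj (e21 (N z)))" for z
    proof -
      have "N z * cj (N z) = tp F * M z * tp X * (F * dg F) * cj (M z) * dg X * cj F"
        unfolding N_def T_def by (simp add: cj_mult mult.assoc)
      then have "tr2 (N z * cj (N z)) = tr2 (tp F * (M z * tp X * cj (M z) * dg X * cj F))"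
        unfolding F' by (simp add: mult.assoc)
      also have "\<dots> = tr2 ((M z * tp X * cj (M z) * dg X) * (cj F * tp F))"
        unfolding tr2_mult_commute[of "tp F"] by (simp add: mult.assoc)
      also have "\<dots> = tr2 (dg X * M z * tp X * cj (M z))"
        unfolding F'' by (simp add: mult.assoc tr2_mult_commute[of "dg X"])
      finally have "witness X (M z) = - Re (tr2 (N z * cj (N z)))" unfolding witness_def by simp
      also have "\<dots> = - 2 * Re (e12 (N z) * cnj (e21 (N z)))
          - ((cmod (e11 (N z)))\<^sup>2 + (cmod (e22 (N z)))\<^sup>2)"
        unfolding tr2_def cmod_power2 by (simp add: power2_eq_square)
      finally show ?thesis by (smt (verit) zero_le_power2)
    qed
    then have "(\<Sum>z\<in>Z. witness X (M z)) \<le> (\<Sum>z\<in>Z. - 2 * Re (e12 (N z) * cnj (e21 (N z))))"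
      by (intro sum_mono)
    also have "\<dots> = - 2 * Re u" by (simp only: u_def Re_sum sum_distrib_left)
    also have "\<dots> \<le> 2 * cmod u" using abs_Re_le_cmod[of u] by linarith
    finally show ?thesis .
  qed
  then have "(max 0 (\<Sum>z\<in>Z. witness X (M z)))\<^sup>2 \<le> (2 * cmod u)\<^sup>2"
    by (intro power_mono) auto
  ultimately have "(max 0 (\<Sum>z\<in>Z. witness X (M z)))\<^sup>2 \<le> - 4 * Re (det2 \<Phi>)"
    unfolding det\<Psi> by (simp add: power_mult_distrib)
  with E detE tr0 tr\<Psi> show ?thesis
    by (intro that[of E]) (auto simp: \<Phi>_def)
qed

text \<open>Cauchy-Schwarz in quotient form; the two implications cover outcomes of probability zero
  under \<open>x / 0 = 0\<close>.\<close>

lemma weighted_cauchy: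
  fixes x y p q :: real
  assumes "p \<ge> 0" "q \<ge> 0" "p = 0 \<Longrightarrow> x = 0" "q = 0 \<Longrightarrow> y = 0"
  shows "(x + y)\<^sup>2 \<le> (p + q) * (x\<^sup>2 / p + y\<^sup>2 / q)"
proof (cases "p = 0 \<or> q = 0")
  case True
  then show ?thesis using assms by auto
next
  case False
  then have p: "p > 0" "q > 0" using assms by auto
  have "(p + q) * (x\<^sup>2 / p + y\<^sup>2 / q) - (x + y)\<^sup>2 = (q * x - p * y)\<^sup>2 / (p * q)"
    using p by (simp add: field_simps power2_eq_square)
  moreover have "\<dots> \<ge> 0" using p by simp
  ultimately show ?thesis by linarith
qed

definition proj1 :: m2 where "proj1 = M2 1 0 0 0"
definition proj2 :: m2 where "proj2 = M2 0 0 0 1"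

lemma tr2_proj:
  "tr2 (A * proj1 * dg A) = of_real ((cmod (e11 A))\<^sup>2 + (cmod (e21 A))\<^sup>2)"
  "tr2 (A * proj2 * dg A) = of_real ((cmod (e12 A))\<^sup>2 + (cmod (e22 A))\<^sup>2)"
  by (simp_all add: tr2_def proj1_def proj2_def complex_norm_square del: of_real_power)

text \<open>The basis \<open>F\<close> diagonalises the probe \<open>E\<close>, whose eigenvalues
  satisfy \<open>l1 * l2 = -1\<close>. The vanishing trace gives
  \<open>l1 * p1 + l2 * p2 = 0\<close>, so for nonzero probabilities
  \<open>p2 / p1 = l1\<^sup>2\<close> and \<open>p1 / p2 = l2\<^sup>2\<close>; expanding
  \<open>- 4 * Re (det2 \<Phi>)\<close> then produces exactly the right-hand side. The quantified
  \<open>\<rho>1\<close>, \<open>\<rho>2\<close> merely name the unnormalised outcome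
  states.\<close>

lemma witness_measurement:
  assumes X: "det2 X = 1" and Z: "finite Z"
  obtains F where "dg F * F = 1"
    "\<And>\<rho>1 \<rho>2. \<rho>1 = (\<Sum>z\<in>Z. M z * F * proj1 * dg (M z * F)) \<Longrightarrow>
       \<rho>2 = (\<Sum>z\<in>Z. M z * F * proj2 * dg (M z * F)) \<Longrightarrow>
      (max 0 (\<Sum>z\<in>Z. witness X (M z)))\<^sup>2 \<le> 4 * Re (det2 (\<rho>1 + \<rho>2))
        - (Re (tr2 \<rho>1) + Re (tr2 \<rho>2)) *
          (4 * Re (det2 \<rho>1) / Re (tr2 \<rho>1) + 4 * Re (det2 \<rho>2) / Re (tr2 \<rho>2))"
proof -
  obtain E where E: "dg E = E" "det2 E = -1" "tr2 (\<Sum>z\<in>Z. M z * E * dg (M z)) = 0"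
    "(max 0 (\<Sum>z\<in>Z. witness X (M z)))\<^sup>2 \<le> - 4 * Re (det2 (\<Sum>z\<in>Z. M z * E * dg (M z)))"
    using witness_le_hermitian_probe[OF X, where Z = Z and M = M] by blast
  obtain F l1 l2 where F: "dg F * F = 1" and EF: "E = F * M2 (of_real l1) 0 0 (of_real l2) * dg F"
    using hermitian_diagonalize[OF E(1)] by blast
  have "det2 E = (det2 F * cnj (det2 F)) * of_real (l1 * l2)"
    unfolding EF by (simp add: det2_mult mult_ac) (simp add: det2_def)
  then have "complex_of_real (l1 * l2) = of_real (-1)" using unitary_det[OF F] E(2) by simp
  then have l: "l1 * l2 = -1" unfolding of_real_eq_iff .
  define \<rho>1 where "\<rho>1 = (\<Sum>z\<in>Z. M z * F * proj1 * dg (M z * F))"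
  define \<rho>2 where "\<rho>2 = (\<Sum>z\<in>Z. M z * F * proj2 * dg (M z * F))"
  define \<Phi> where "\<Phi> = (\<Sum>z\<in>Z. M z * E * dg (M z))"
  define p1 where "p1 = Re (tr2 \<rho>1)"
  define p2 where "p2 = Re (tr2 \<rho>2)"
  have dec: "M2 (of_real l1) 0 0 (of_real l2) = sc (of_real l1) * proj1 + sc (of_real l2) * proj2"
    by (auto intro!: m2_eqI simp: proj1_def proj2_def)
  have sc_comm: "A * (sc c * B) = sc c * (A * B)" for A B c
    by (auto intro!: m2_eqI simp: algebra_simps)
  have \<Phi>: "\<Phi> = sc (of_real l1) * \<rho>1 + sc (of_real l2) * \<rho>2"
    unfolding \<Phi>_def \<rho>1_def \<rho>2_def EF dec sum_distrib_left sum.distrib[symmetric]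
    by (intro sum.cong refl) (simp add: dg_mult mult.assoc distrib_left distrib_right sc_comm)
  have tr1: "tr2 \<rho>1 = of_real (\<Sum>z\<in>Z. (cmod (e11 (M z * F)))\<^sup>2 + (cmod (e21 (M z * F)))\<^sup>2)"
    unfolding \<rho>1_def tr2_sum of_real_sum
    by (intro sum.cong refl tr2_proj)
  have tr2: "tr2 \<rho>2 = of_real (\<Sum>z\<in>Z. (cmod (e12 (M z * F)))\<^sup>2 + (cmod (e22 (M z * F)))\<^sup>2)"
    unfolding \<rho>2_def tr2_sum of_real_sum
    by (intro sum.cong refl tr2_proj)
  have p_nonneg: "p1 \<ge> 0" "p2 \<ge> 0" unfolding p1_def p2_def tr1 tr2 by (auto intro!: sum_nonneg add_nonneg_nonneg)
  have "tr2 \<Phi> = of_real (l1 * p1 + l2 * p2)"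
    unfolding \<Phi> tr2_add p1_def p2_def using tr1 tr2
    by (simp add: tr2_def distrib_left[symmetric])
  then have lp: "l1 * p1 + l2 * p2 = 0" using E(3) unfolding \<Phi>_def by (metis of_real_eq_0_iff)
  have "(max 0 (\<Sum>z\<in>Z. witness X (M z)))\<^sup>2 \<le> 4 * Re (det2 (\<rho>1 + \<rho>2))
        - (p1 + p2) * (4 * Re (det2 \<rho>1) / p1 + 4 * Re (det2 \<rho>2) / p2)"
  proof (cases "p1 = 0 \<or> p2 = 0")
    case True
    \<comment> \<open>Both eigenvalues are nonzero, so one vanishing probability forces the other to
      vanish, and then every block is zero.\<close>
    then have p0: "p1 = 0" "p2 = 0" using lp l by auto
    have "M z = 0" if "z \<in> Z" for z
    proof -
      have "(cmod (e11 (M z * F)))\<^sup>2 + (cmod (e21 (M z * F)))\<^sup>2 = 0"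
        using p0(1) that Z unfolding p1_def tr1 Re_complex_of_real by (subst (asm) sum_nonneg_eq_0_iff) auto
      moreover have "(cmod (e12 (M z * F)))\<^sup>2 + (cmod (e22 (M z * F)))\<^sup>2 = 0"
        using p0(2) that Z unfolding p2_def tr2 Re_complex_of_real by (subst (asm) sum_nonneg_eq_0_iff) auto
      ultimately have "M z * F = 0"
        by (intro m2_eqI) (auto simp: sum_power2_eq_zero_iff)
      then have "M z * (F * dg F) = 0" by (simp add: mult.assoc[symmetric])
      then show ?thesis using dg_mult_self_commute[OF F] by simp
    qed
    then have "(\<Sum>z\<in>Z. witness X (M z)) = 0" "\<rho>1 = 0" "\<rho>2 = 0"
      by (auto simp: witness_def tr2_def \<rho>1_def \<rho>2_def intro!: sum.neutral)
    then show ?thesis by (simp add: det2_def)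
  next
    case False
    have l0: "l1 \<noteq> 0" "l2 \<noteq> 0" using l by auto
    have "p2 = l1\<^sup>2 * p1"
    proof -
      have "l1 * (l1 * p1 + l2 * p2) = l1\<^sup>2 * p1 + (l1 * l2) * p2"
        by (simp add: power2_eq_square algebra_simps)
      then show ?thesis using lp l by simp
    qed
    moreover have "p1 = l2\<^sup>2 * p2"
    proof -
      have "l2 * (l1 * p1 + l2 * p2) = l2\<^sup>2 * p2 + (l1 * l2) * p1"
        by (simp add: power2_eq_square algebra_simps)
      then show ?thesis using lp l by simp
    qed
    ultimately have r: "p2 / p1 = l1\<^sup>2" "p1 / p2 = l2\<^sup>2" using False by (metis nonzero_eq_divide_eq)+
    have "det2 \<Phi> = of_real (l1\<^sup>2) * det2 \<rho>1 + of_real (l2\<^sup>2) * det2 \<rho>2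
        + of_real (l1 * l2) * (det2 (\<rho>1 + \<rho>2) - det2 \<rho>1 - det2 \<rho>2)"
      unfolding \<Phi> by (simp add: det2_def power2_eq_square algebra_simps)
    then have "Re (det2 \<Phi>) = l1\<^sup>2 * Re (det2 \<rho>1) + l2\<^sup>2 * Re (det2 \<rho>2)
        - (Re (det2 (\<rho>1 + \<rho>2)) - Re (det2 \<rho>1) - Re (det2 \<rho>2))"
      unfolding l by simp
    moreover have "(p1 + p2) * (4 * a / p1 + 4 * b / p2) = 4 * (a + b) + 4 * (p2 / p1) * a + 4 * (p1 / p2) * b" for a b
      using False by (simp add: field_simps)
    ultimately show ?thesis using E(4) unfolding \<Phi>_def[symmetric] r by simp
  qed
  then show ?thesis using F
    by (intro that[of F]) (auto simp: p1_def p2_def \<rho>1_def \<rho>2_def)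
qed

section \<open>Monogamy of the witnesses\<close>

lemma configs_empty [simp]: "configs d {} = {\<lambda>_. 0}"
  by (auto simp: configs_def)

lemma inj_on_configs_insert:
  assumes "k \<notin> J"
  shows "inj_on (\<lambda>(b, z). z(k := b)) ({..<d k} \<times> configs d J)"
proof (rule inj_onI, clarsimp)
  fix b z b' z'
  assume z: "z \<in> configs d J" "z' \<in> configs d J" and eq: "z(k := b) = z'(k := b')"
  have "z k = 0" "z' k = 0" using z assms by (auto simp: configs_def)
  then have "z = z'" using eq by (metis fun_upd_triv fun_upd_upd)
  then show "b = b' \<and> z = z'" using eq by (metis fun_upd_same)
qed

lemma configs_insert:
  assumes "k \<notin> J"
  shows "configs d (insert k J) = (\<lambda>(b, z). z(k := b)) ` ({..<d k} \<times> configs d J)"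
proof (intro equalityI subsetI)
  fix x assume "x \<in> configs d (insert k J)"
  then have "x = (\<lambda>(b, z). z(k := b)) (x k, x(k := 0))" "x k < d k" "x(k := 0) \<in> configs d J"
    using assms by (auto simp: configs_def)
  then show "x \<in> (\<lambda>(b, z). z(k := b)) ` ({..<d k} \<times> configs d J)" by blast
qed (use assms in \<open>auto simp: configs_def\<close>)

lemma finite_configs [simp]: "finite A \<Longrightarrow> finite (configs d A)"
  by (induct A rule: finite_induct) (auto simp: configs_insert)

lemma sum_configs_insert:
  assumes "k \<notin> J"
  shows "(\<Sum>x\<in>configs d (insert k J). f x) = (\<Sum>b<d k. \<Sum>z\<in>configs d J. f (z(k := b)))"
  unfolding configs_insert[OF assms] sum.reindex[OF inj_on_configs_insert[OF assms]]
    sum.cartesian_product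
  by (simp add: case_prod_unfold)

abbreviation qconfigs :: "nat set \<Rightarrow> (nat \<Rightarrow> nat) set" where
  "qconfigs \<equiv> configs (\<lambda>_. 2)"

lemma sum_qconfigs_insert:
  assumes "k \<notin> J"
  shows "(\<Sum>x\<in>qconfigs (insert k J). f x) =
    (\<Sum>z\<in>qconfigs J. f (z(k := 0)) + f (z(k := 1)))"
  unfolding sum_configs_insert[OF assms] by (simp add: numeral_2_eq_2 sum.distrib)

lemma configs_upd:
  "z \<in> configs d (J - {j}) \<Longrightarrow> j \<in> J \<Longrightarrow> b < d j \<Longrightarrow> z(j := b) \<in> configs d J"
  by (auto simp: configs_def)

text \<open>A vector on a distinguished qubit and the qubits in \<open>J\<close> is a pair \<open>u\<close>, \<open>v\<close> of
  functions on configurations of \<open>J\<close>, one for each value of the distinguished qubit.\<close>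
definition blk :: "nat \<Rightarrow> ((nat \<Rightarrow> nat) \<Rightarrow> complex) \<Rightarrow> ((nat \<Rightarrow> nat) \<Rightarrow> complex) \<Rightarrow> (nat \<Rightarrow> nat) \<Rightarrow> m2" where
  "blk j u v z = M2 (u (z(j := 0))) (u (z(j := 1))) (v (z(j := 0))) (v (z(j := 1)))"

text \<open>By linearity this is the witness value of the reduced operator of the distinguished
  qubit and qubit \<open>j\<close>; each configuration of the traced-out qubits contributes one pure
  slice.\<close>

definition witness_sum :: "m2 \<Rightarrow> nat \<Rightarrow> nat set \<Rightarrow> ((nat \<Rightarrow> nat) \<Rightarrow> complex) \<Rightarrow> ((nat \<Rightarrow> nat) \<Rightarrow> complex) \<Rightarrow> real" where
  "witness_sum X j J u v = (\<Sum>z\<in>qconfigs (J - {j}). witness X (blk j u v z))"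

text \<open>The reduced density matrix of the distinguished qubit. Four times its determinant is the
  squared concurrence of that qubit against all of \<open>J\<close>.\<close>

definition gram :: "nat set \<Rightarrow> ((nat \<Rightarrow> nat) \<Rightarrow> complex) \<Rightarrow> ((nat \<Rightarrow> nat) \<Rightarrow> complex) \<Rightarrow> m2" where
  "gram J u v = (\<Sum>z\<in>qconfigs J. M2 (u z * cnj (u z)) (u z * cnj (v z)) (v z * cnj (u z)) (v z * cnj (v z)))"

text \<open>The witness comes from a sesquilinear form in the block, so its total over two vectors
  depends only on the sum of their outer products, which unitary mixing preserves.\<close>

lemma witness_unitary_mix:
  assumes "F * dg F = 1"
  shows "witness X (A * sc (e11 F) + B * sc (e21 F)) + witness X (A * sc (e12 F) + B * sc (e22 F))
    = witness X A + witness X B"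
proof -
  define q where "q A B = tr2 (dg X * A * tp X * cj B)" for A B
  have q: "q (A * sc a + B * sc b) (A * sc a + B * sc b) =
      a * cnj a * q A A + a * cnj b * q A B + b * cnj a * q B A + b * cnj b * q B B" for a b
    unfolding q_def by (simp add: tr2_def algebra_simps)
  have e: "e11 F * cnj (e11 F) + e12 F * cnj (e12 F) = 1"
    "e11 F * cnj (e21 F) + e12 F * cnj (e22 F) = 0"
    "e21 F * cnj (e11 F) + e22 F * cnj (e12 F) = 0"
    "e21 F * cnj (e21 F) + e22 F * cnj (e22 F) = 1"
    using arg_cong[OF assms, of e11] arg_cong[OF assms, of e12] arg_cong[OF assms, of e21]
      arg_cong[OF assms, of e22] by simp_all
  have "q (A * sc (e11 F) + B * sc (e21 F)) (A * sc (e11 F) + B * sc (e21 F))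
    + q (A * sc (e12 F) + B * sc (e22 F)) (A * sc (e12 F) + B * sc (e22 F))
    = (e11 F * cnj (e11 F) + e12 F * cnj (e12 F)) * q A A
    + (e11 F * cnj (e21 F) + e12 F * cnj (e22 F)) * q A B
    + (e21 F * cnj (e11 F) + e22 F * cnj (e12 F)) * q B A
    + (e21 F * cnj (e21 F) + e22 F * cnj (e22 F)) * q B B"
    unfolding q by (simp add: algebra_simps)
  then have "q (A * sc (e11 F) + B * sc (e21 F)) (A * sc (e11 F) + B * sc (e21 F))
    + q (A * sc (e12 F) + B * sc (e22 F)) (A * sc (e12 F) + B * sc (e22 F)) = q A A + q B B"
    unfolding e by simp
  then show ?thesis unfolding witness_def q_def[symmetric]
    by (metis (no_types, lifting) minus_add_distrib plus_complex.sel(1))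
qed

text \<open>The columns of \<open>blk k u v z * F\<close> are the unnormalised vectors left by a
  measurement of qubit \<open>k\<close> in the basis \<open>F\<close>. Tracing out \<open>k\<close>
  and averaging over the outcomes give the same operator on the other qubits.\<close>

lemma witness_sum_measure:
  assumes F: "dg F * F = 1" and k: "k \<notin> J" and j: "j \<in> J"
  shows "witness_sum X j (insert k J) u v =
    witness_sum X j J (\<lambda>z. e11 (blk k u v z * F)) (\<lambda>z. e21 (blk k u v z * F)) +
    witness_sum X j J (\<lambda>z. e12 (blk k u v z * F)) (\<lambda>z. e22 (blk k u v z * F))"
proof -
  have jk: "j \<noteq> k" using k j by auto
  have "insert k J - {j} = insert k (J - {j})" using jk by auto
  then have "witness_sum X j (insert k J) u v = (\<Sum>z\<in>qconfigs (J - {j}).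
      witness X (blk j u v (z(k := 0))) + witness X (blk j u v (z(k := 1))))"
    unfolding witness_sum_def using k by (simp add: sum_qconfigs_insert)
  also have "\<dots> = (\<Sum>z\<in>qconfigs (J - {j}).
      witness X (blk j (\<lambda>z. e11 (blk k u v z * F)) (\<lambda>z. e21 (blk k u v z * F)) z) +
      witness X (blk j (\<lambda>z. e12 (blk k u v z * F)) (\<lambda>z. e22 (blk k u v z * F)) z))"
  proof (intro sum.cong refl)
    fix z :: "nat \<Rightarrow> nat"
    have tw: "z(j := a, k := b) = z(k := b, j := a)" for a b
      using jk by (simp add: fun_upd_twist)
    have "blk j (\<lambda>z. e11 (blk k u v z * F)) (\<lambda>z. e21 (blk k u v z * F)) z
        = blk j u v (z(k := 0)) * sc (e11 F) + blk j u v (z(k := 1)) * sc (e21 F)"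
      by (auto intro!: m2_eqI simp: blk_def tw)
    moreover have "blk j (\<lambda>z. e12 (blk k u v z * F)) (\<lambda>z. e22 (blk k u v z * F)) z
        = blk j u v (z(k := 0)) * sc (e12 F) + blk j u v (z(k := 1)) * sc (e22 F)"
      by (auto intro!: m2_eqI simp: blk_def tw)
    ultimately show "witness X (blk j u v (z(k := 0))) + witness X (blk j u v (z(k := 1))) =
      witness X (blk j (\<lambda>z. e11 (blk k u v z * F)) (\<lambda>z. e21 (blk k u v z * F)) z) +
      witness X (blk j (\<lambda>z. e12 (blk k u v z * F)) (\<lambda>z. e22 (blk k u v z * F)) z)"
      using witness_unitary_mix[OF dg_mult_self_commute[OF F]] by simp
  qed
  finally show ?thesis unfolding witness_sum_def by (simp add: sum.distrib)
qed

lemma tr2_gram: "tr2 (gram J u v) = of_real (\<Sum>z\<in>qconfigs J. (cmod (u z))\<^sup>2 + (cmod (v z))\<^sup>2)"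
  unfolding gram_def tr2_sum of_real_sum
  by (intro sum.cong refl) (simp add: tr2_def complex_norm_square del: of_real_power)

lemma tr2_gram_nonneg: "Re (tr2 (gram J u v)) \<ge> 0"
  unfolding tr2_gram Re_complex_of_real by (intro sum_nonneg) simp

lemma tr2_gram_zeroD:
  assumes "Re (tr2 (gram J u v)) = 0" "finite J" "z \<in> qconfigs J"
  shows "u z = 0" "v z = 0"
proof -
  have "(cmod (u z))\<^sup>2 + (cmod (v z))\<^sup>2 = 0"
    using assms unfolding tr2_gram Re_complex_of_real by (subst (asm) sum_nonneg_eq_0_iff) auto
  then show "u z = 0" "v z = 0" by (auto simp: sum_power2_eq_zero_iff)
qed

lemma witness_sum_zero:
  assumes "Re (tr2 (gram J u v)) = 0" "finite J" "j \<in> J"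
  shows "witness_sum X j J u v = 0"
  unfolding witness_sum_def
proof (rule sum.neutral, rule ballI)
  fix z assume "z \<in> qconfigs (J - {j})"
  then have "z(j := 0) \<in> qconfigs J" "z(j := 1) \<in> qconfigs J"
    using assms(3) by (auto intro: configs_upd)
  then have "blk j u v z = 0"
    using tr2_gram_zeroD[OF assms(1,2)] by (auto intro!: m2_eqI simp: blk_def)
  then show "witness X (blk j u v z) = 0" by (simp add: witness_def tr2_def)
qed

lemma outer_columns:
  "A * proj1 * dg A = M2 (e11 A * cnj (e11 A)) (e11 A * cnj (e21 A)) (e21 A * cnj (e11 A)) (e21 A * cnj (e21 A))"
  "A * proj2 * dg A = M2 (e12 A * cnj (e12 A)) (e12 A * cnj (e22 A)) (e22 A * cnj (e12 A)) (e22 A * cnj (e22 A))"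
  by (auto intro!: m2_eqI simp: proj1_def proj2_def)

lemma proj_add: "proj1 + proj2 = 1"
  by (auto intro!: m2_eqI simp: proj1_def proj2_def)

lemma gram_measure:
  assumes F: "dg F * F = 1" and k: "k \<notin> J"
  shows "gram (insert k J) u v =
    gram J (\<lambda>z. e11 (blk k u v z * F)) (\<lambda>z. e21 (blk k u v z * F)) +
    gram J (\<lambda>z. e12 (blk k u v z * F)) (\<lambda>z. e22 (blk k u v z * F))"
proof -
  have "gram (insert k J) u v = (\<Sum>z\<in>qconfigs J. blk k u v z * dg (blk k u v z))"
    unfolding gram_def sum_qconfigs_insert[OF k]
    by (intro sum.cong refl m2_eqI) (simp_all add: blk_def)
  also have "\<dots> = (\<Sum>z\<in>qconfigs J. (blk k u v z * F) * dg (blk k u v z * F))"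
    by (simp add: dg_mult mult.assoc) (metis dg_mult_self_commute[OF F] mult.assoc mult_1)
  also have "\<dots> = gram J (\<lambda>z. e11 (blk k u v z * F)) (\<lambda>z. e21 (blk k u v z * F)) +
    gram J (\<lambda>z. e12 (blk k u v z * F)) (\<lambda>z. e22 (blk k u v z * F))"
    unfolding gram_def sum.distrib[symmetric] outer_columns[symmetric]
    by (simp add: distrib_left[symmetric] distrib_right[symmetric] proj_add)
  finally show ?thesis .
qed

text \<open>The Coffman-Kundu-Wootters inequality with positive parts of witness values in place of
  concurrences.\<close>

definition monogamous :: "nat set \<Rightarrow> (nat \<Rightarrow> m2) \<Rightarrow> ((nat \<Rightarrow> nat) \<Rightarrow> complex) \<Rightarrow> ((nat \<Rightarrow> nat) \<Rightarrow> complex) \<Rightarrow> bool" where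
  "monogamous J X u v \<longleftrightarrow> (\<Sum>j\<in>J. (max 0 (witness_sum (X j) j J u v))\<^sup>2) \<le> 4 * Re (det2 (gram J u v))"

text \<open>Measuring qubit \<open>k\<close> splits every witness value additively, so Cauchy's inequality with
  the outcome probabilities reduces a sum of squares to the post-measurement vectors.\<close>
lemma witness_sum_measure_bound:
  assumes F: "dg F * F = 1" and k: "k \<notin> J" and J: "finite J"
    and u1: "u1 = (\<lambda>z. e11 (blk k u v z * F))" "v1 = (\<lambda>z. e21 (blk k u v z * F))"
    and u2: "u2 = (\<lambda>z. e12 (blk k u v z * F))" "v2 = (\<lambda>z. e22 (blk k u v z * F))"
    and m1: "monogamous J X u1 v1" and m2: "monogamous J X u2 v2"
    and p: "p1 = Re (tr2 (gram J u1 v1))" "p2 = Re (tr2 (gram J u2 v2))"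
  shows "(\<Sum>j\<in>J. (max 0 (witness_sum (X j) j (insert k J) u v))\<^sup>2) \<le>
    (p1 + p2) * (4 * Re (det2 (gram J u1 v1)) / p1 + 4 * Re (det2 (gram J u2 v2)) / p2)"
proof -
  have p0: "p1 \<ge> 0" "p2 \<ge> 0" unfolding p by (rule tr2_gram_nonneg)+
  have "(\<Sum>j\<in>J. (max 0 (witness_sum (X j) j (insert k J) u v))\<^sup>2) \<le>
      (\<Sum>j\<in>J. (p1 + p2) * ((max 0 (witness_sum (X j) j J u1 v1))\<^sup>2 / p1 + (max 0 (witness_sum (X j) j J u2 v2))\<^sup>2 / p2))"
  proof (rule sum_mono)
    fix j assume j: "j \<in> J"
    have "max 0 (witness_sum (X j) j (insert k J) u v) \<le>
        max 0 (witness_sum (X j) j J u1 v1) + max 0 (witness_sum (X j) j J u2 v2)"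
      unfolding witness_sum_measure[OF F k j] u1 u2 by linarith
    then have "(max 0 (witness_sum (X j) j (insert k J) u v))\<^sup>2 \<le>
        (max 0 (witness_sum (X j) j J u1 v1) + max 0 (witness_sum (X j) j J u2 v2))\<^sup>2"
      by (intro power_mono) auto
    also have "\<dots> \<le> (p1 + p2) * ((max 0 (witness_sum (X j) j J u1 v1))\<^sup>2 / p1 + (max 0 (witness_sum (X j) j J u2 v2))\<^sup>2 / p2)"
      using p0 witness_sum_zero[OF _ J j] unfolding p by (intro weighted_cauchy) auto
    finally show "(max 0 (witness_sum (X j) j (insert k J) u v))\<^sup>2 \<le>
      (p1 + p2) * ((max 0 (witness_sum (X j) j J u1 v1))\<^sup>2 / p1 + (max 0 (witness_sum (X j) j J u2 v2))\<^sup>2 / p2)" .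
  qed
  also have "\<dots> = (p1 + p2) * ((\<Sum>j\<in>J. (max 0 (witness_sum (X j) j J u1 v1))\<^sup>2) / p1
      + (\<Sum>j\<in>J. (max 0 (witness_sum (X j) j J u2 v2))\<^sup>2) / p2)"
    by (simp add: sum_distrib_left sum.distrib sum_divide_distrib algebra_simps)
  also have "\<dots> \<le> (p1 + p2) * (4 * Re (det2 (gram J u1 v1)) / p1 + 4 * Re (det2 (gram J u2 v2)) / p2)"
    using m1 m2 p0 unfolding monogamous_def
    by (intro mult_left_mono add_mono divide_right_mono) auto
  finally show ?thesis .
qed

text \<open>Qubit \<open>k\<close> is measured in the basis that is optimal for its own witness. The
  witnesses of \<open>J\<close> are bounded by the average entropy after the measurement, the
  witness of \<open>k\<close> by the entropy lost, and the two bounds add up to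
  \<open>4 * Re (det2 (gram (insert k J) u v))\<close>.\<close>

theorem witness_monogamy:
  assumes "finite J" "\<forall>j\<in>J. det2 (X j) = 1"
  shows "monogamous J X u v"
  using assms
proof (induct J arbitrary: u v rule: finite_induct)
  case empty
  show ?case by (simp add: monogamous_def gram_def det2_def)
next
  case (insert k J u v)
  obtain F where F: "dg F * F = 1" and
    b: "\<And>\<rho>1 \<rho>2. \<rho>1 = (\<Sum>z\<in>qconfigs J. blk k u v z * F * proj1 * dg (blk k u v z * F)) \<Longrightarrow>
       \<rho>2 = (\<Sum>z\<in>qconfigs J. blk k u v z * F * proj2 * dg (blk k u v z * F)) \<Longrightarrow>
      (max 0 (\<Sum>z\<in>qconfigs J. witness (X k) (blk k u v z)))\<^sup>2 \<le> 4 * Re (det2 (\<rho>1 + \<rho>2))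
        - (Re (tr2 \<rho>1) + Re (tr2 \<rho>2)) *
          (4 * Re (det2 \<rho>1) / Re (tr2 \<rho>1) + 4 * Re (det2 \<rho>2) / Re (tr2 \<rho>2))"
    using witness_measurement[of "X k" "qconfigs J" "blk k u v"] insert.prems insert.hyps(1)
    by auto
  define u1 where "u1 = (\<lambda>z. e11 (blk k u v z * F))"
  define v1 where "v1 = (\<lambda>z. e21 (blk k u v z * F))"
  define u2 where "u2 = (\<lambda>z. e12 (blk k u v z * F))"
  define v2 where "v2 = (\<lambda>z. e22 (blk k u v z * F))"
  have r1: "gram J u1 v1 = (\<Sum>z\<in>qconfigs J. blk k u v z * F * proj1 * dg (blk k u v z * F))"
    unfolding gram_def u1_def v1_def outer_columns ..
  have r2: "gram J u2 v2 = (\<Sum>z\<in>qconfigs J. blk k u v z * F * proj2 * dg (blk k u v z * F))"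
    unfolding gram_def u2_def v2_def outer_columns ..
  have "monogamous J X u1 v1" "monogamous J X u2 v2" using insert by auto
  from witness_sum_measure_bound[OF F insert.hyps(2,1) u1_def v1_def u2_def v2_def this refl refl]
  have "(\<Sum>j\<in>J. (max 0 (witness_sum (X j) j (insert k J) u v))\<^sup>2) \<le>
    (Re (tr2 (gram J u1 v1)) + Re (tr2 (gram J u2 v2))) *
    (4 * Re (det2 (gram J u1 v1)) / Re (tr2 (gram J u1 v1)) + 4 * Re (det2 (gram J u2 v2)) / Re (tr2 (gram J u2 v2)))" .
  moreover have "(max 0 (witness_sum (X k) k (insert k J) u v))\<^sup>2 \<le> 4 * Re (det2 (gram (insert k J) u v))
     - (Re (tr2 (gram J u1 v1)) + Re (tr2 (gram J u2 v2))) *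
    (4 * Re (det2 (gram J u1 v1)) / Re (tr2 (gram J u1 v1)) + 4 * Re (det2 (gram J u2 v2)) / Re (tr2 (gram J u2 v2)))"
  proof -
    have "insert k J - {k} = J" using insert.hyps by auto
    then have "witness_sum (X k) k (insert k J) u v = (\<Sum>z\<in>qconfigs J. witness (X k) (blk k u v z))"
      unfolding witness_sum_def by simp
    then show ?thesis using b[OF r1 r2] gram_measure[OF F insert.hyps(2), of u v]
      unfolding u1_def v1_def u2_def v2_def by simp
  qed
  ultimately show ?case unfolding monogamous_def using insert.hyps by simp
qed

section \<open>Purities, minors and cuts of size one and two\<close>

lemma merge_merge [simp]:
  "merge A (merge A x y) z = merge A x z" "merge A x (merge A y z) = merge A x z"
  by (auto simp: merge_def)

lemma merge_idem [simp]: "merge A x x = x"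
  by (auto simp: merge_def)

lemma merge_configs:
  "a \<in> configs d U \<Longrightarrow> b \<in> configs d U \<Longrightarrow> merge A a b \<in> configs d U"
  by (auto simp: configs_def merge_def)

lemma sum_configs_merge:
  assumes "A \<subseteq> U"
  shows "(\<Sum>a\<in>configs d U. f a) = (\<Sum>x\<in>configs d A. \<Sum>z\<in>configs d (U - A). f (merge A x z))"
proof -
  have "(\<Sum>a\<in>configs d U. f a) =
      (\<Sum>p\<in>configs d A \<times> configs d (U - A). f (merge A (fst p) (snd p)))"
    by (rule sum.reindex_bij_witness[where i = "\<lambda>p. merge A (fst p) (snd p)" and
          j = "\<lambda>a. (merge A a (\<lambda>_. 0), merge A (\<lambda>_. 0) a)"])
      (use assms in \<open>auto simp: configs_def\<close>, auto simp: merge_def fun_eq_iff)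
  then show ?thesis by (simp add: sum.cartesian_product case_prod_unfold)
qed

definition purity :: "(nat \<Rightarrow> nat) \<Rightarrow> nat set \<Rightarrow> nat set \<Rightarrow> ((nat \<Rightarrow> nat) \<Rightarrow> complex) \<Rightarrow> complex" where
  "purity d U A \<psi> = trsq d A (ptrace d U A (proj \<psi>))"

text \<open>The swap trick: the purity of a marginal is an expectation over two copies whose
  \<open>A\<close>-parts are exchanged.\<close>

lemma purity_exchange:
  assumes "A \<subseteq> U"
  shows "purity d U A \<psi> = (\<Sum>a\<in>configs d U. \<Sum>b\<in>configs d U.
    \<psi> a * \<psi> b * cnj (\<psi> (merge A a b) * \<psi> (merge A b a)))"
proof -
  have "purity d U A \<psi> = (\<Sum>x\<in>configs d A. \<Sum>y\<in>configs d A.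
      \<Sum>z\<in>configs d (U - A). \<Sum>z'\<in>configs d (U - A).
      \<psi> (merge A x z) * \<psi> (merge A y z') * cnj (\<psi> (merge A x z') * \<psi> (merge A y z)))"
    unfolding purity_def trsq_def ptrace_def proj_def sum_product
    by (intro sum.cong refl) (simp add: mult_ac)
  also have "\<dots> = (\<Sum>x\<in>configs d A. \<Sum>z\<in>configs d (U - A). \<Sum>y\<in>configs d A. \<Sum>z'\<in>configs d (U - A).
      \<psi> (merge A x z) * \<psi> (merge A y z') * cnj (\<psi> (merge A x z') * \<psi> (merge A y z)))"
    by (rule sum.cong[OF refl], rule sum.swap)
  also have "\<dots> = (\<Sum>a\<in>configs d U. \<Sum>b\<in>configs d U.
    \<psi> a * \<psi> b * cnj (\<psi> (merge A a b) * \<psi> (merge A b a)))"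
    unfolding sum_configs_merge[OF assms] by simp
  finally show ?thesis .
qed

text \<open>Exchanging the complementary parts of two copies differs from exchanging the
  \<open>A\<close>-parts only by the order of the copies.\<close>

lemma purity_compl:
  assumes "A \<subseteq> U"
  shows "purity d U (U - A) \<psi> = purity d U A \<psi>"
proof -
  have m: "merge (U - A) a b = merge A b a" if "a \<in> configs d U" "b \<in> configs d U" for a b
    using that assms by (auto simp: merge_def configs_def fun_eq_iff)
  show ?thesis
    unfolding purity_exchange[OF assms] purity_exchange[OF Diff_subset]
    by (intro sum.cong refl) (simp add: m mult_ac)
qed

definition mass :: "(nat \<Rightarrow> nat) \<Rightarrow> nat set \<Rightarrow> ((nat \<Rightarrow> nat) \<Rightarrow> complex) \<Rightarrow> real" where
  "mass d U \<psi> = (\<Sum>a\<in>configs d U. (cmod (\<psi> a))\<^sup>2)"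

lemma tr_proj: "tr d U (proj \<psi>) = of_real (mass d U \<psi>)"
  unfolding tr_def proj_def mass_def of_real_sum
  by (intro sum.cong refl) (simp add: complex_norm_square del: of_real_power)

text \<open>Read \<open>\<psi>\<close> as a matrix with rows indexed by configurations of
  \<open>A\<close> and columns by those of the complement. The ordered pairs \<open>a\<close>,
  \<open>b\<close> count each of its 2 by 2 minors four times.\<close>

definition minor_sum :: "(nat \<Rightarrow> nat) \<Rightarrow> nat set \<Rightarrow> nat set \<Rightarrow> ((nat \<Rightarrow> nat) \<Rightarrow> complex) \<Rightarrow> real" where
  "minor_sum d U A \<psi> = (\<Sum>a\<in>configs d U. \<Sum>b\<in>configs d U.
     (cmod (\<psi> a * \<psi> b - \<psi> (merge A a b) * \<psi> (merge A b a)))\<^sup>2)"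

text \<open>Exchanging \<open>A\<close>-parts is an involution on pairs of configurations, so both
  products in a minor have the same total square, and the cross terms sum to the purity.\<close>

lemma minor_sum_purity:
  assumes "A \<subseteq> U"
  shows "minor_sum d U A \<psi> = 2 * ((mass d U \<psi>)\<^sup>2 - Re (purity d U A \<psi>))"
proof -
  let ?C = "configs d U"
  define f where "f a b = \<psi> a * \<psi> b" for a b
  define g where "g a b = \<psi> (merge A a b) * \<psi> (merge A b a)" for a b
  have "(\<Sum>a\<in>?C. \<Sum>b\<in>?C. (cmod (g a b))\<^sup>2) = (\<Sum>p\<in>?C \<times> ?C. (cmod (g (fst p) (snd p)))\<^sup>2)"
    by (simp add: sum.cartesian_product case_prod_unfold)
  also have "\<dots> = (\<Sum>p\<in>?C \<times> ?C. (cmod (f (fst p) (snd p)))\<^sup>2)"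
    by (rule sum.reindex_bij_witness[where i = "\<lambda>(a, b). (merge A a b, merge A b a)" and
          j = "\<lambda>(a, b). (merge A a b, merge A b a)"])
      (auto simp: merge_configs f_def g_def)
  also have "\<dots> = (\<Sum>a\<in>?C. \<Sum>b\<in>?C. (cmod (f a b))\<^sup>2)"
    by (simp add: sum.cartesian_product case_prod_unfold)
  finally have g: "(\<Sum>a\<in>?C. \<Sum>b\<in>?C. (cmod (g a b))\<^sup>2) = (\<Sum>a\<in>?C. \<Sum>b\<in>?C. (cmod (f a b))\<^sup>2)" .
  have f: "(\<Sum>a\<in>?C. \<Sum>b\<in>?C. (cmod (f a b))\<^sup>2) = (mass d U \<psi>)\<^sup>2"
    unfolding mass_def f_def power2_eq_square[of "sum _ _"] sum_product
    by (simp add: norm_mult power_mult_distrib)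
  have "(cmod (f a b - g a b))\<^sup>2 = (cmod (f a b))\<^sup>2 + (cmod (g a b))\<^sup>2 - 2 * Re (f a b * cnj (g a b))" for a b
    unfolding cmod_power2 by (simp add: power2_eq_square algebra_simps)
  moreover have "minor_sum d U A \<psi> = (\<Sum>a\<in>?C. \<Sum>b\<in>?C. (cmod (f a b - g a b))\<^sup>2)"
    unfolding minor_sum_def f_def g_def ..
  ultimately have "minor_sum d U A \<psi> = (\<Sum>a\<in>?C. \<Sum>b\<in>?C. (cmod (f a b))\<^sup>2) + (\<Sum>a\<in>?C. \<Sum>b\<in>?C. (cmod (g a b))\<^sup>2)
     - 2 * (\<Sum>a\<in>?C. \<Sum>b\<in>?C. Re (f a b * cnj (g a b)))"
    by (simp add: sum.distrib sum_subtractf sum_distrib_left del: times_complex.sel)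
  also have "(\<Sum>a\<in>?C. \<Sum>b\<in>?C. Re (f a b * cnj (g a b))) = Re (purity d U A \<psi>)"
    unfolding purity_exchange[OF assms] f_def g_def by (simp only: Re_sum)
  finally show ?thesis unfolding g f by simp
qed

lemma minor_sum_nonneg: "minor_sum d U A \<psi> \<ge> 0"
  unfolding minor_sum_def by (intro sum_nonneg) simp

definition pair_witness :: "nat set \<Rightarrow> m2 \<Rightarrow> nat \<Rightarrow> nat \<Rightarrow> ((nat \<Rightarrow> nat) \<Rightarrow> complex) \<Rightarrow> real" where
  "pair_witness U X i j \<psi> = (\<Sum>z\<in>qconfigs (U - {i, j}).
     witness X (M2 (\<psi> (z(i := 0, j := 0))) (\<psi> (z(i := 0, j := 1)))
               (\<psi> (z(i := 1, j := 0))) (\<psi> (z(i := 1, j := 1)))))"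

lemma pair_witness_eq:
  assumes "i \<noteq> j"
  shows "pair_witness U X i j \<psi> = witness_sum X j (U - {i}) (\<lambda>z. \<psi> (z(i := 0))) (\<lambda>z. \<psi> (z(i := 1)))"
proof -
  have "U - {i} - {j} = U - {i, j}" by auto
  then show ?thesis unfolding pair_witness_def witness_sum_def blk_def using assms by (simp add: fun_upd_twist)
qed

text \<open>Transposing the block exchanges the two parties, so the same witness can be read from
  either end of a pair if \<open>X\<close> is replaced by its adjoint.\<close>

lemma witness_swap: "witness (dg X) (tp M) = witness X M"
proof -
  have "tr2 (dg A) = cnj (tr2 A)" for A by (simp add: tr2_def)
  moreover have "dg (dg X * M * tp X * cj M) = tp M * (cj X * dg M * X)"
    by (simp add: dg_mult mult.assoc)
  ultimately have "cnj (tr2 (dg X * M * tp X * cj M)) = tr2 (X * tp M * cj X * dg M)"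
    by (metis (no_types, lifting) mult.assoc tr2_mult_commute)
  then have "Re (tr2 (dg X * M * tp X * cj M)) = Re (tr2 (X * tp M * cj X * dg M))"
    by (metis complex_cnj(1) complex.sel(1) complex_surj cnj.sel(1))
  then show ?thesis unfolding witness_def by simp
qed

lemma pair_witness_swap:
  assumes "i \<noteq> j"
  shows "pair_witness U (dg X) j i \<psi> = pair_witness U X i j \<psi>"
proof -
  have "witness (dg X) (M2 (\<psi> (z(j := 0, i := 0))) (\<psi> (z(j := 0, i := 1)))
               (\<psi> (z(j := 1, i := 0))) (\<psi> (z(j := 1, i := 1))))
      = witness X (M2 (\<psi> (z(i := 0, j := 0))) (\<psi> (z(i := 0, j := 1)))
               (\<psi> (z(i := 1, j := 0))) (\<psi> (z(i := 1, j := 1))))" for z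
    unfolding witness_swap[of X, symmetric] tp_def using assms by (simp add: fun_upd_twist)
  then show ?thesis unfolding pair_witness_def by (simp add: insert_commute)
qed

lemma tr2_sq_det2: "(tr2 G)\<^sup>2 - tr2 (G * G) = 2 * det2 G"
  by (simp add: tr2_def det2_def power2_eq_square algebra_simps)

lemma mass_gram:
  assumes "i \<in> U"
  shows "tr2 (gram (U - {i}) (\<lambda>z. \<psi> (z(i := 0))) (\<lambda>z. \<psi> (z(i := 1)))) = of_real (mass (\<lambda>_. 2) U \<psi>)"
proof -
  have "insert i (U - {i}) = U" using assms by auto
  then show ?thesis
    using sum_qconfigs_insert[of i "U - {i}" "\<lambda>a. (cmod (\<psi> a))\<^sup>2"]
    unfolding tr2_gram mass_def by simp
qed

lemma purity_single:
  fixes \<psi> :: "(nat \<Rightarrow> nat) \<Rightarrow> complex"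
  assumes "i \<in> U"
  defines "G \<equiv> gram (U - {i}) (\<lambda>z. \<psi> (z(i := 0))) (\<lambda>z. \<psi> (z(i := 1)))"
  shows "purity (\<lambda>_. 2) U {i} \<psi> = tr2 (G * G)"
proof -
  define c where "c a = (\<lambda>_. 0::nat)(i := a)" for a
  have m: "merge {i} (c b) z = z(i := b)" for b z
    by (auto simp: merge_def c_def)
  have e: "i \<notin> {}" by simp
  have single: "(\<Sum>z\<in>{a}. f z) = f a" for a :: "nat \<Rightarrow> nat" and f :: "(nat \<Rightarrow> nat) \<Rightarrow> complex" by simp
  define P where "P a b = (\<Sum>z\<in>qconfigs (U - {i}). \<psi> (z(i := a)) * cnj (\<psi> (z(i := b))))" for a b
  have pt: "ptrace (\<lambda>_. 2) U {i} (proj \<psi>) (c a) (c b) = P a b" for a b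
    unfolding ptrace_def proj_def m P_def ..
  have "purity (\<lambda>_. 2) U {i} \<psi> = P 0 0 * P 0 0 + P 0 1 * P 1 0 + (P 1 0 * P 0 1 + P 1 1 * P 1 1)"
    unfolding purity_def trsq_def sum_qconfigs_insert[OF e] configs_empty single c_def[symmetric]
    unfolding pt ..
  moreover have "G = M2 (P 0 0) (P 0 1) (P 1 0) (P 1 1)"
    unfolding G_def gram_def P_def by (auto intro!: m2_eqI)
  ultimately show ?thesis by (simp add: tr2_def)
qed

lemma witness_single_cut:
  assumes U: "finite U" "i \<in> U" and X: "\<forall>j\<in>U - {i}. det2 (X j) = 1"
  shows "(\<Sum>j\<in>U - {i}. (max 0 (pair_witness U (X j) i j \<psi>))\<^sup>2) \<le> minor_sum (\<lambda>_. 2) U {i} \<psi>"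
proof -
  define G where "G = gram (U - {i}) (\<lambda>z. \<psi> (z(i := 0))) (\<lambda>z. \<psi> (z(i := 1)))"
  have "monogamous (U - {i}) X (\<lambda>z. \<psi> (z(i := 0))) (\<lambda>z. \<psi> (z(i := 1)))"
    using U X by (intro witness_monogamy) auto
  then have "(\<Sum>j\<in>U - {i}. (max 0 (pair_witness U (X j) i j \<psi>))\<^sup>2) \<le> 4 * Re (det2 G)"
    unfolding monogamous_def G_def by (simp add: pair_witness_eq)
  also have "\<dots> = 2 * Re ((tr2 G)\<^sup>2 - tr2 (G * G))"
    unfolding tr2_sq_det2 by simp
  also have "\<dots> = minor_sum (\<lambda>_. 2) U {i} \<psi>"
    using U minor_sum_purity[of "{i}" U "\<lambda>_. 2" \<psi>]
    unfolding G_def mass_gram[OF U(2)] purity_single[OF U(2)] by (simp add: power2_eq_square)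
  finally show ?thesis .
qed

text \<open>Both marginals of a pure state have the same purity; here the \<open>J\<close>-side is
  expressed through the qubit side.\<close>

lemma sum_cmod_sq_gram:
  "of_real (\<Sum>x\<in>qconfigs J. \<Sum>y\<in>qconfigs J. (cmod (u x * cnj (u y) + v x * cnj (v y)))\<^sup>2)
   = tr2 (gram J u v * gram J u v)"
proof -
  have "complex_of_real ((cmod (u x * cnj (u y) + v x * cnj (v y)))\<^sup>2) =
     (u x * cnj (u x)) * (u y * cnj (u y)) + (u x * cnj (v x)) * (v y * cnj (u y))
     + (v x * cnj (u x)) * (u y * cnj (v y)) + (v x * cnj (v x)) * (v y * cnj (v y))" for x y
    unfolding complex_norm_square by (simp add: algebra_simps)
  then show ?thesis
    unfolding of_real_sum by (simp add: gram_def tr2_def sum_product sum.distrib algebra_simps)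
qed

text \<open>Measuring \<open>k\<close> turns the cut \<open>{i, k}\<close> into single cuts at \<open>i\<close>; the linear entropy of the
  remaining qubits is concave, so it can only drop.\<close>
lemma witness_pair_cut:
  assumes U: "finite U" "i \<in> U" "k \<in> U" "i \<noteq> k" and X: "\<forall>j\<in>U - {i, k}. det2 (X j) = 1"
  shows "(\<Sum>j\<in>U - {i, k}. (max 0 (pair_witness U (X j) i j \<psi>))\<^sup>2) \<le> minor_sum (\<lambda>_. 2) U {i, k} \<psi>"
proof -
  define J where "J = U - {i, k}"
  have J: "finite J" "k \<notin> J" "i \<notin> J" "insert k J = U - {i}" using U by (auto simp: J_def)
  define u where "u z = \<psi> (z(i := 0))" for z
  define v where "v z = \<psi> (z(i := 1))" for z
  define u1 where "u1 z = u (z(k := 0))" for z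
  define v1 where "v1 z = v (z(k := 0))" for z
  define u2 where "u2 z = u (z(k := 1))" for z
  define v2 where "v2 z = v (z(k := 1))" for z
  define G1 where "G1 = gram J u1 v1"
  define G2 where "G2 = gram J u2 v2"
  define p1 where "p1 = Re (tr2 G1)"
  define p2 where "p2 = Re (tr2 G2)"
  define s1 where "s1 = Re (tr2 (G1 * G1))"
  define s2 where "s2 = Re (tr2 (G2 * G2))"
  define t where "t = mass (\<lambda>_. 2) U \<psi>"
  have p: "p1 \<ge> 0" "p2 \<ge> 0" unfolding p1_def p2_def G1_def G2_def by (rule tr2_gram_nonneg)+
  \<comment> \<open>The measurement of \<open>k\<close> is in the computational basis, that is, with
    the unitary 1.\<close>
  have eqs: "u1 = (\<lambda>z. e11 (blk k u v z * 1))" "v1 = (\<lambda>z. e21 (blk k u v z * 1))"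
    "u2 = (\<lambda>z. e12 (blk k u v z * 1))" "v2 = (\<lambda>z. e22 (blk k u v z * 1))"
    unfolding u1_def v1_def u2_def v2_def blk_def by auto
  have "gram (insert k J) u v = G1 + G2"
    using gram_measure[of 1 k J u v] J unfolding G1_def G2_def eqs by simp
  then have "complex_of_real t = tr2 G1 + tr2 G2"
    using mass_gram[OF U(2), of \<psi>] unfolding J(4) u_def[abs_def] v_def[abs_def] t_def by (simp add: tr2_add)
  then have t: "t = p1 + p2" unfolding p1_def p2_def by (metis Re_complex_of_real plus_complex.sel(1))
  have det: "4 * Re (det2 G1) = 2 * (p1\<^sup>2 - s1)" "4 * Re (det2 G2) = 2 * (p2\<^sup>2 - s2)"
  proof -
    have "tr2 G1 = of_real p1" "tr2 G2 = of_real p2" unfolding p1_def p2_def G1_def G2_def tr2_gram by auto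
    then have "complex_of_real (p1\<^sup>2) - tr2 (G1 * G1) = 2 * det2 G1" "complex_of_real (p2\<^sup>2) - tr2 (G2 * G2) = 2 * det2 G2"
      using tr2_sq_det2[of G1] tr2_sq_det2[of G2] by simp_all
    from this[THEN arg_cong[of _ _ Re]] 
    show "4 * Re (det2 G1) = 2 * (p1\<^sup>2 - s1)" "4 * Re (det2 G2) = 2 * (p2\<^sup>2 - s2)" unfolding s1_def s2_def by simp_all
  qed
  have "(\<Sum>j\<in>J. (max 0 (witness_sum (X j) j (insert k J) u v))\<^sup>2) \<le>
    (p1 + p2) * (4 * Re (det2 (gram J u1 v1)) / p1 + 4 * Re (det2 (gram J u2 v2)) / p2)"
    using X by (intro witness_sum_measure_bound[OF _ J(2,1) eqs] witness_monogamy J(1))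
      (auto simp: J_def p1_def p2_def G1_def G2_def)
  also have "\<dots> = 2 * (t * (p1\<^sup>2 / p1 + p2\<^sup>2 / p2) - t * (s1 / p1 + s2 / p2))"
    unfolding G1_def[symmetric] G2_def[symmetric] det t by (simp add: diff_divide_distrib algebra_simps)
  also have "p1\<^sup>2 / p1 + p2\<^sup>2 / p2 = t" unfolding t by (simp add: power2_eq_square)
  finally have main: "(\<Sum>j\<in>J. (max 0 (witness_sum (X j) j (insert k J) u v))\<^sup>2) \<le> 2 * (t\<^sup>2 - t * (s1 / p1 + s2 / p2))"
    by (simp add: power2_eq_square)
  \<comment> \<open>This is convexity of the purity: the marginal on \<open>J\<close> is
    \<open>c1 + c2\<close>, the sum over the outcomes, and weighted Cauchy-Schwarz is applied to
    each of its entries.\<close>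
  have "Re (purity (\<lambda>_. 2) U {i, k} \<psi>) \<le> t * (s1 / p1 + s2 / p2)"
  proof -
    define c1 where "c1 x y = u1 x * cnj (u1 y) + v1 x * cnj (v1 y)" for x y
    define c2 where "c2 x y = u2 x * cnj (u2 y) + v2 x * cnj (v2 y)" for x y
    have UJ: "U - J = insert i (insert k {})" using U by (auto simp: J_def)
    have pt: "ptrace (\<lambda>_. 2) U J (proj \<psi>) x y = c1 x y + c2 x y" if "x \<in> qconfigs J" "y \<in> qconfigs J" for x y
    proof -
      have m: "merge J x ((\<lambda>_. 0)(k := b, i := a)) = x(k := b, i := a)"
         "merge J y ((\<lambda>_. 0)(k := b, i := a)) = y(k := b, i := a)" for a b
        using that J by (auto simp: merge_def configs_def)
      have ik: "i \<notin> insert k {}" "k \<notin> {}" using U by auto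
      have "ptrace (\<lambda>_. 2) U J (proj \<psi>) x y =
         (\<Sum>z\<in>{(\<lambda>_. 0::nat)}.
           \<psi> (merge J x (z(k := 0, i := 0))) * cnj (\<psi> (merge J y (z(k := 0, i := 0)))) +
           \<psi> (merge J x (z(k := 0, i := 1))) * cnj (\<psi> (merge J y (z(k := 0, i := 1)))) +
          (\<psi> (merge J x (z(k := 1, i := 0))) * cnj (\<psi> (merge J y (z(k := 1, i := 0)))) +
           \<psi> (merge J x (z(k := 1, i := 1))) * cnj (\<psi> (merge J y (z(k := 1, i := 1))))))"
        unfolding ptrace_def proj_def UJ sum_qconfigs_insert[OF ik(1)] sum_qconfigs_insert[OF ik(2)] configs_empty ..
      then show ?thesis
        unfolding c1_def c2_def u1_def u2_def v1_def v2_def u_def v_def by (simp only: m sum.insert[OF finite.emptyI] empty_iff not_False_eq_True sum.empty add_0_right)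
    qed
    have "ptrace (\<lambda>_. 2) U J (proj \<psi>) x y * ptrace (\<lambda>_. 2) U J (proj \<psi>) y x = of_real ((cmod (c1 x y + c2 x y))\<^sup>2)"
      if "x \<in> qconfigs J" "y \<in> qconfigs J" for x y
    proof -
      have "c1 y x = cnj (c1 x y)" "c2 y x = cnj (c2 x y)" unfolding c1_def c2_def by (simp_all add: mult.commute)
      then show ?thesis unfolding pt[OF that] pt[OF that(2,1)] complex_norm_square by simp
    qed
    then have "purity (\<lambda>_. 2) U J \<psi> = of_real (\<Sum>x\<in>qconfigs J. \<Sum>y\<in>qconfigs J. (cmod (c1 x y + c2 x y))\<^sup>2)"
      unfolding purity_def trsq_def of_real_sum by (intro sum.cong refl) auto
    moreover have "purity (\<lambda>_. 2) U {i, k} \<psi> = purity (\<lambda>_. 2) U J \<psi>"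
      unfolding J_def using U by (intro purity_compl[symmetric]) auto
    ultimately have "Re (purity (\<lambda>_. 2) U {i, k} \<psi>) = (\<Sum>x\<in>qconfigs J. \<Sum>y\<in>qconfigs J. (cmod (c1 x y + c2 x y))\<^sup>2)"
      by simp
    also have "\<dots> \<le> (\<Sum>x\<in>qconfigs J. \<Sum>y\<in>qconfigs J. t * ((cmod (c1 x y))\<^sup>2 / p1 + (cmod (c2 x y))\<^sup>2 / p2))"
    proof (intro sum_mono)
      fix x y assume xy: "x \<in> qconfigs J" "y \<in> qconfigs J"
      have "(cmod (c1 x y + c2 x y))\<^sup>2 \<le> (cmod (c1 x y) + cmod (c2 x y))\<^sup>2"
        by (intro power_mono norm_triangle_ineq) auto
      also have "\<dots> \<le> t * ((cmod (c1 x y))\<^sup>2 / p1 + (cmod (c2 x y))\<^sup>2 / p2)"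
        unfolding t
      proof (rule weighted_cauchy[OF p])
        show "cmod (c1 x y) = 0" if "p1 = 0"
          using tr2_gram_zeroD[of J u1 v1, OF _ J(1) xy(1)] that unfolding p1_def G1_def c1_def by simp
        show "cmod (c2 x y) = 0" if "p2 = 0"
          using tr2_gram_zeroD[of J u2 v2, OF _ J(1) xy(1)] that unfolding p2_def G2_def c2_def by simp
      qed
      finally show "(cmod (c1 x y + c2 x y))\<^sup>2 \<le> t * ((cmod (c1 x y))\<^sup>2 / p1 + (cmod (c2 x y))\<^sup>2 / p2)" .
    qed
    also have "\<dots> = t * ((\<Sum>x\<in>qconfigs J. \<Sum>y\<in>qconfigs J. (cmod (c1 x y))\<^sup>2) / p1
        + (\<Sum>x\<in>qconfigs J. \<Sum>y\<in>qconfigs J. (cmod (c2 x y))\<^sup>2) / p2)"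
      by (simp add: sum_distrib_left sum.distrib sum_divide_distrib algebra_simps)
    also have "\<dots> = t * (s1 / p1 + s2 / p2)"
      unfolding s1_def s2_def G1_def G2_def sum_cmod_sq_gram[symmetric] c1_def c2_def by simp
    finally show ?thesis .
  qed
  then have "(\<Sum>j\<in>J. (max 0 (witness_sum (X j) j (insert k J) u v))\<^sup>2) \<le> 2 * (t\<^sup>2 - Re (purity (\<lambda>_. 2) U {i, k} \<psi>))"
    by (intro order.trans[OF main] mult_left_mono diff_left_mono) simp_all
  also have "\<dots> = minor_sum (\<lambda>_. 2) U {i, k} \<psi>"
    unfolding t_def using U by (intro minor_sum_purity[symmetric]) auto
  also have "(\<Sum>j\<in>J. (max 0 (witness_sum (X j) j (insert k J) u v))\<^sup>2) = (\<Sum>j\<in>U - {i, k}. (max 0 (pair_witness U (X j) i j \<psi>))\<^sup>2)"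
    unfolding J(4) unfolding J_def u_def[abs_def] v_def[abs_def] using U
    by (intro sum.cong refl) (simp add: pair_witness_eq)
  finally show ?thesis .
qed

section \<open>Summation over cuts and substates\<close>

lemma sum_ordered_pairs:
  fixes g :: "nat \<Rightarrow> nat \<Rightarrow> real"
  assumes "\<And>i k. i < N \<Longrightarrow> k < N \<Longrightarrow> i \<noteq> k \<Longrightarrow> g i k = g k i"
  shows "(\<Sum>i<N. \<Sum>k\<in>{..<N} - {i}. g i k) = 2 * (\<Sum>i<N. \<Sum>k\<in>{i<..<N}. g i k)"
proof -
  have "(\<Sum>i<N. \<Sum>k\<in>{..<N} - {i}. g i k) = (\<Sum>i<N. (\<Sum>k\<in>{..<i}. g i k) + (\<Sum>k\<in>{i<..<N}. g i k))"
  proof (rule sum.cong[OF refl])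
    fix i assume "i \<in> {..<N}"
    then have "{..<N} - {i} = {..<i} \<union> {i<..<N}" by auto
    moreover have "sum (g i) ({..<i} \<union> {i<..<N}) = (\<Sum>k\<in>{..<i}. g i k) + (\<Sum>k\<in>{i<..<N}. g i k)"
      by (rule sum.union_disjoint) auto
    ultimately show "(\<Sum>k\<in>{..<N} - {i}. g i k) = (\<Sum>k\<in>{..<i}. g i k) + (\<Sum>k\<in>{i<..<N}. g i k)"
      by (simp only:)
  qed
  also have "\<dots> = (\<Sum>i<N. \<Sum>k\<in>{..<i}. g i k) + (\<Sum>i<N. \<Sum>k\<in>{i<..<N}. g i k)"
    by (rule sum.distrib)
  also have "(\<Sum>i<N. \<Sum>k\<in>{..<i}. g i k) = (\<Sum>p\<in>(SIGMA i:{..<N}. {..<i}). g (fst p) (snd p))"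
    by (simp add: sum.Sigma case_prod_unfold)
  also have "\<dots> = (\<Sum>p\<in>(SIGMA i:{..<N}. {i<..<N}). g (fst p) (snd p))"
    by (rule sum.reindex_bij_witness[where i = prod.swap and j = prod.swap])
      (use assms in \<open>force+\<close>)
  also have "\<dots> = (\<Sum>i<N. \<Sum>k\<in>{i<..<N}. g i k)"
    by (simp add: sum.Sigma case_prod_unfold)
  finally show ?thesis by simp
qed

definition proper_cuts :: "nat set \<Rightarrow> nat set set" where
  "proper_cuts U = {\<alpha>. \<alpha> \<subseteq> U \<and> \<alpha> \<noteq> {} \<and> \<alpha> \<noteq> U}"

lemma finite_proper_cuts: "finite U \<Longrightarrow> finite (proper_cuts U)"
  unfolding proper_cuts_def by (rule finite_subset[of _ "Pow U"]) auto

lemma minor_sum_compl: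
  assumes "A \<subseteq> U"
  shows "minor_sum d U (U - A) \<psi> = minor_sum d U A \<psi>"
  unfolding minor_sum_purity[OF assms] minor_sum_purity[OF Diff_subset] purity_compl[OF assms] ..

text \<open>The four families are disjoint because their cardinalities differ. For
  \<open>N = 4\<close> the sizes 2 and \<open>N - 2\<close> coincide, and the doubled second sum
  would count cuts twice.\<close>

lemma sum_small_cuts_le:
  fixes f :: "nat set \<Rightarrow> real"
  assumes N: "N \<ge> 5" and f0: "\<And>A. f A \<ge> 0" and fc: "\<And>A. A \<subseteq> {..<N} \<Longrightarrow> f ({..<N} - A) = f A"
  shows "2 * (\<Sum>i<N. f {i}) + 2 * (\<Sum>i<N. \<Sum>k\<in>{i<..<N}. f {i, k}) \<le> (\<Sum>\<alpha>\<in>proper_cuts {..<N}. f \<alpha>)"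
proof -
  let ?U = "{..<N}"
  define B1 where "B1 = (\<lambda>i. {i}) ` ?U"
  define B2 where "B2 = (\<lambda>p. {fst p, snd p}) ` (SIGMA i:?U. {i<..<N})"
  define C where "C B = (\<lambda>A. ?U - A) ` B" for B
  have sub: "A \<subseteq> ?U" "card A = 1" if "A \<in> B1" for A using that by (auto simp: B1_def)
  have sub2: "A \<subseteq> ?U" "card A = 2" if "A \<in> B2" for A using that by (auto simp: B2_def)
  have cardC: "card (?U - A) = N - card A" if "A \<subseteq> ?U" for A
    using that by (simp add: card_Diff_subset finite_subset)
  have c1: "card A = N - 1" if "A \<in> C B1" for A using that cardC sub by (auto simp: C_def)
  have c2: "card A = N - 2" if "A \<in> C B2" for A using that cardC sub2 by (auto simp: C_def)
  have fin: "finite B1" "finite B2" "finite (C B1)" "finite (C B2)" by (auto simp: B1_def B2_def C_def)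
  have "A \<notin> B2" if "A \<in> B1" for A using sub(2)[OF that] sub2(2)[of A] by auto
  then have "B1 \<inter> B2 = {}" by blast
  moreover have "A \<notin> B1 \<union> B2" if "A \<in> C B1" for A
    using c1[OF that] sub(2)[of A] sub2(2)[of A] N by auto
  then have "(B1 \<union> B2) \<inter> C B1 = {}" by blast
  moreover have "A \<notin> B1 \<union> B2 \<union> C B1" if "A \<in> C B2" for A
    using c2[OF that] c1[of A] sub(2)[of A] sub2(2)[of A] N by auto
  then have "(B1 \<union> B2 \<union> C B1) \<inter> C B2 = {}" by blast
  ultimately have "sum f (B1 \<union> B2 \<union> C B1 \<union> C B2) = sum f B1 + sum f B2 + sum f (C B1) + sum f (C B2)"
    using fin by (simp add: sum.union_disjoint)
  moreover have "sum f (B1 \<union> B2 \<union> C B1 \<union> C B2) \<le> sum f (proper_cuts ?U)"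
  proof (rule sum_mono2)
    have "B1 \<union> B2 \<union> C B1 \<union> C B2 \<subseteq> {\<alpha>. \<alpha> \<subseteq> ?U \<and> 0 < card \<alpha> \<and> card \<alpha> < N}"
      using sub sub2 c1 c2 N by (auto simp: C_def)
    also have "\<dots> \<subseteq> proper_cuts ?U" by (auto simp: proper_cuts_def)
    finally show "B1 \<union> B2 \<union> C B1 \<union> C B2 \<subseteq> proper_cuts ?U" .
  qed (auto simp: finite_proper_cuts f0)
  moreover have "sum f (C B) = sum f B" if "B \<subseteq> Pow ?U" for B
  proof -
    have "inj_on (\<lambda>A. ?U - A) B" using that by (auto intro!: inj_onI)
    then have "sum f (C B) = (\<Sum>A\<in>B. f (?U - A))" unfolding C_def by (simp add: sum.reindex)
    also have "\<dots> = sum f B" using that by (intro sum.cong refl fc) auto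
    finally show ?thesis .
  qed
  then have "sum f (C B1) = sum f B1" "sum f (C B2) = sum f B2" using sub sub2 by (auto simp: subset_iff)
  moreover have "sum f B1 = (\<Sum>i<N. f {i})" unfolding B1_def by (simp add: sum.reindex)
  moreover have "sum f B2 = (\<Sum>i<N. \<Sum>k\<in>{i<..<N}. f {i, k})"
  proof -
    have "inj_on (\<lambda>p. {fst p, snd p}) (SIGMA i:?U. {i<..<N})"
      by (auto intro!: inj_onI simp: doubleton_eq_iff)
    then show ?thesis unfolding B2_def by (simp add: sum.reindex sum.Sigma case_prod_unfold)
  qed
  ultimately show ?thesis by linarith
qed

text \<open>The adjoint condition makes \<open>w\<close> symmetric, so each pair of qubits can be
  charged to the cuts at either end.\<close>

lemma witness_all_cuts:
  assumes N: "N \<ge> 5" and X: "\<And>i j. i < N \<Longrightarrow> j < N \<Longrightarrow> i \<noteq> j \<Longrightarrow> det2 (X i j) = 1 \<and> X j i = dg (X i j)"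
  shows "2 * real N * (\<Sum>i<N. \<Sum>j\<in>{i<..<N}. (max 0 (pair_witness {..<N} (X i j) i j \<psi>))\<^sup>2)
    \<le> (\<Sum>\<alpha>\<in>proper_cuts {..<N}. minor_sum (\<lambda>_. 2) {..<N} \<alpha> \<psi>)"
proof -
  let ?U = "{..<N}"
  define w where "w i j = (max 0 (pair_witness ?U (X i j) i j \<psi>))\<^sup>2" for i j
  define E where "E \<alpha> = minor_sum (\<lambda>_. 2) ?U \<alpha> \<psi>" for \<alpha>
  define T where "T = (\<Sum>i<N. \<Sum>j\<in>{i<..<N}. w i j)"
  have wsym: "w i j = w j i" if "i < N" "j < N" "i \<noteq> j" for i j
    using X[OF that] pair_witness_swap[OF that(3)] unfolding w_def by simp
  have X1: "det2 (X i j) = 1" if "i < N" "j < N" "i \<noteq> j" for i j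
    using X[OF that] by simp
  have T2: "(\<Sum>i<N. \<Sum>j\<in>?U - {i}. w i j) = 2 * T"
    unfolding T_def by (rule sum_ordered_pairs) (rule wsym)
  have "2 * T \<le> (\<Sum>i<N. E {i})"
    unfolding T2[symmetric] w_def E_def using X1 by (intro sum_mono witness_single_cut) auto
  \<comment> \<open>The cut \<open>{i, k}\<close> dominates both the witnesses at \<open>i\<close>
    and those at \<open>k\<close>; summing over ordered pairs averages these two bounds. A fixed
    \<open>w i j\<close> then occurs once for each of the \<open>N - 2\<close> values of
    \<open>k\<close>.\<close>
  moreover have "real (N - 2) * T \<le> (\<Sum>i<N. \<Sum>k\<in>{i<..<N}. E {i, k})"
  proof -
    have "2 * (\<Sum>i<N. \<Sum>k\<in>{i<..<N}. E {i, k}) = (\<Sum>i<N. \<Sum>k\<in>?U - {i}. E {i, k})"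
      by (rule sum_ordered_pairs[symmetric]) (simp add: insert_commute)
    also have "\<dots> \<ge> (\<Sum>i<N. \<Sum>k\<in>?U - {i}. \<Sum>j\<in>?U - {i, k}. w i j)"
      unfolding w_def E_def using X1 by (intro sum_mono witness_pair_cut) auto
    also have "(\<Sum>i<N. \<Sum>k\<in>?U - {i}. \<Sum>j\<in>?U - {i, k}. w i j) = (\<Sum>i<N. \<Sum>j\<in>?U - {i}. real (N - 2) * w i j)"
    proof (rule sum.cong[OF refl])
      fix i assume i: "i \<in> ?U"
      have "(\<Sum>k\<in>?U - {i}. \<Sum>j\<in>?U - {i, k}. w i j) = (\<Sum>k\<in>?U - {i}. \<Sum>j\<in>{j \<in> ?U - {i}. k \<noteq> j}. w i j)"
        by (intro sum.cong refl) auto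
      also have "\<dots> = (\<Sum>j\<in>?U - {i}. \<Sum>k\<in>{k \<in> ?U - {i}. k \<noteq> j}. w i j)"
        by (rule sum.swap_restrict) auto
      also have "\<dots> = (\<Sum>j\<in>?U - {i}. real (N - 2) * w i j)"
      proof (rule sum.cong[OF refl])
        fix j assume j: "j \<in> ?U - {i}"
        have "{k \<in> ?U - {i}. k \<noteq> j} = ?U - {i, j}" by auto
        moreover have "card (?U - {i, j}) = N - 2" using i j by (subst card_Diff_subset) auto
        ultimately show "(\<Sum>k\<in>{k \<in> ?U - {i}. k \<noteq> j}. w i j) = real (N - 2) * w i j" by simp
      qed
      finally show "(\<Sum>k\<in>?U - {i}. \<Sum>j\<in>?U - {i, k}. w i j) = (\<Sum>j\<in>?U - {i}. real (N - 2) * w i j)" .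
    qed
    also have "\<dots> = real (N - 2) * (2 * T)"
      unfolding T2[symmetric] by (simp add: sum_distrib_left)
    finally show ?thesis by simp
  qed
  moreover have "2 * (\<Sum>i<N. E {i}) + 2 * (\<Sum>i<N. \<Sum>k\<in>{i<..<N}. E {i, k}) \<le> (\<Sum>\<alpha>\<in>proper_cuts ?U. E \<alpha>)"
    by (rule sum_small_cuts_le[OF N]) (simp_all add: E_def minor_sum_nonneg minor_sum_compl)
  moreover have "2 * real N * T = 2 * (2 * T) + 2 * (real (N - 2) * T)"
    using N by (simp add: of_nat_diff algebra_simps)
  ultimately show ?thesis unfolding T_def[symmetric, unfolded w_def] E_def by linarith
qed

text \<open>There are \<open>2 ^ N - 2\<close> proper cuts, so the radicand splits into one
  nonnegative term for each cut, half its minor sum; the squared prefactor is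
  \<open>2 / 2 ^ (N - 1)\<close>.\<close>

lemma CN_pure_sq:
  assumes "N \<ge> 1"
  shows "(CN_pure N d \<phi>)\<^sup>2 = (\<Sum>\<alpha>\<in>proper_cuts {..<N}. minor_sum d {..<N} \<alpha> \<phi>) / 2 ^ (N - 1)"
    and "CN_pure N d \<phi> \<ge> 0"
proof -
  let ?U = "{..<N}"
  define r where "r = (2 ^ N - 2) * (Re (tr d ?U (proj \<phi>)))\<^sup>2
            - (\<Sum>\<alpha>\<in>proper_cuts ?U. Re (purity d ?U \<alpha> \<phi>))"
  have "proper_cuts ?U = Pow ?U - {{}, ?U}" by (auto simp: proper_cuts_def)
  moreover have "card (Pow ?U - {{}, ?U}) = 2 ^ N - 2"
  proof -
    have "0 \<in> ?U" using assms by simp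
    then have "{} \<noteq> ?U" by blast
    then have "card {{}, ?U} = 2" by simp
    then show ?thesis by (subst card_Diff_subset) (auto simp: card_Pow)
  qed
  moreover have "(2::nat) ^ N \<ge> 2" using assms by (cases N) auto
  ultimately have card: "real (card (proper_cuts ?U)) = 2 ^ N - 2" by (simp add: of_nat_diff)
  have "(\<Sum>\<alpha>\<in>proper_cuts ?U. minor_sum d ?U \<alpha> \<phi>) =
     (\<Sum>\<alpha>\<in>proper_cuts ?U. 2 * ((mass d ?U \<phi>)\<^sup>2 - Re (purity d ?U \<alpha> \<phi>)))"
    by (intro sum.cong refl minor_sum_purity) (auto simp: proper_cuts_def)
  also have "\<dots> = 2 * r"
    unfolding r_def tr_proj card[symmetric] by (simp add: sum_subtractf sum_distrib_left[symmetric])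
  finally have r: "r = (\<Sum>\<alpha>\<in>proper_cuts ?U. minor_sum d ?U \<alpha> \<phi>) / 2" by simp
  have r0: "r \<ge> 0" unfolding r by (simp add: sum_nonneg minor_sum_nonneg)
  have C: "CN_pure N d \<phi> = 2 powr (1 - real N / 2) * sqrt r"
    unfolding CN_pure_def r_def purity_def proper_cuts_def Let_def ..
  show "CN_pure N d \<phi> \<ge> 0" unfolding C using r0 by simp
  have "(2 powr (1 - real N / 2))\<^sup>2 = 2 powr (2 - real N)"
    by (simp add: powr_powr[symmetric] powr_numeral[symmetric] powr_powr mult.commute algebra_simps)
  also have "\<dots> = 2 / 2 ^ (N - 1)"
    using assms by (simp add: powr_diff powr_realpow power_diff)
  finally show "(CN_pure N d \<phi>)\<^sup>2 = (\<Sum>\<alpha>\<in>proper_cuts {..<N}. minor_sum d {..<N} \<alpha> \<phi>) / 2 ^ (N - 1)"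
    unfolding C power_mult_distrib using r0 by (simp add: r)
qed

section \<open>Qubit substates and the multiplicity of minors\<close>

lemma emb_merge: "emb N S (merge A a b) = merge A (emb N S a) (emb N S b)"
  by (auto simp: emb_def merge_def)

lemma bij_betw_emb:
  assumes S: "S \<in> substate_choices N d"
  shows "bij_betw (emb N S) (qconfigs {..<N}) {a \<in> configs d {..<N}. \<forall>i<N. a i \<in> S i}"
proof -
  define s where "s i = sorted_list_of_set (S i)" for i
  have s: "length (s i) = 2" "distinct (s i)" "set (s i) = S i" "S i \<subseteq> {..<d i}" if "i < N" for i
  proof -
    have Si: "S i \<subseteq> {..<d i}" "card (S i) = 2"
      using S that by (auto simp: substate_choices_def PiE_def Pi_def)
    then show "S i \<subseteq> {..<d i}" "length (s i) = 2" "distinct (s i)" "set (s i) = S i"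
      unfolding s_def by (auto simp: finite_subset[OF Si(1)])
  qed
  have e: "emb N S x i = s i ! x i" if "i < N" for x i using that by (simp add: emb_def s_def)
  show ?thesis
  proof (rule bij_betw_imageI)
    show "inj_on (emb N S) (qconfigs {..<N})"
    proof (rule inj_onI, rule ext)
      fix x y i assume xy: "x \<in> qconfigs {..<N}" "y \<in> qconfigs {..<N}" "emb N S x = emb N S y"
      show "x i = y i"
      proof (cases "i < N")
        case True
        then have "s i ! x i = s i ! y i" using xy(3) e by metis
        moreover have "x i < 2" "y i < 2" using xy True by (auto simp: configs_def)
        ultimately show ?thesis using s[OF True] by (metis nth_eq_iff_index_eq)
      qed (use xy in \<open>auto simp: configs_def\<close>)
    qed
    show "emb N S ` qconfigs {..<N} = {a \<in> configs d {..<N}. \<forall>i<N. a i \<in> S i}"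
    proof (intro equalityI subsetI)
      fix a assume "a \<in> emb N S ` qconfigs {..<N}"
      then obtain x where x: "x \<in> qconfigs {..<N}" "a = emb N S x" by blast
      have "a i \<in> S i" if "i < N" for i
        using x s[OF that] e[OF that] that by (metis (mono_tags, lifting) configs_def lessThan_iff mem_Collect_eq nth_mem)
      then show "a \<in> {a \<in> configs d {..<N}. \<forall>i<N. a i \<in> S i}"
        using s(4) x(2) by (fastforce simp: configs_def emb_def)
    next
      fix a assume a: "a \<in> {a \<in> configs d {..<N}. \<forall>i<N. a i \<in> S i}"
      have "\<exists>b<2. s i ! b = a i" if "i < N" for i
        using a s[OF that] that by (metis (mono_tags, lifting) in_set_conv_nth mem_Collect_eq)
      then obtain x where x: "\<And>i. i < N \<Longrightarrow> x i < 2 \<and> s i ! x i = a i" by metis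
      define y where "y i = (if i < N then x i else 0)" for i
      have "y \<in> qconfigs {..<N}" using x by (auto simp: configs_def y_def)
      moreover have "a = emb N S y"
        using a x by (auto simp: fun_eq_iff emb_def y_def s_def[symmetric] configs_def)
      ultimately show "a \<in> emb N S ` qconfigs {..<N}" by blast
    qed
  qed
qed

lemma finite_substate_choices: "finite (substate_choices N d)"
  unfolding substate_choices_def
  by (intro finite_PiE) (auto intro: finite_subset[of _ "Pow {..<d i}" for i])

text \<open>At each party a two-element set containing \<open>a i\<close> is determined by its other
  element, which leaves at most \<open>d i - 1\<close> choices; requiring \<open>b i\<close> as well
  can only lower the number.\<close>

lemma card_choices_containing:
  assumes "a \<in> configs d {..<N}" "\<forall>i<N. d i \<ge> 2"
  shows "real (card {S \<in> substate_choices N d. \<forall>i<N. a i \<in> S i \<and> b i \<in> S i}) \<le> (\<Prod>i<N. real (d i) - 1)"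
proof -
  let ?F = "\<lambda>i. {T. T \<subseteq> {..<d i} \<and> card T = 2 \<and> a i \<in> T \<and> b i \<in> T}"
  have "{S \<in> substate_choices N d. \<forall>i<N. a i \<in> S i \<and> b i \<in> S i} = PiE {..<N} ?F"
    by (auto simp: substate_choices_def PiE_def Pi_def)
  then have "real (card {S \<in> substate_choices N d. \<forall>i<N. a i \<in> S i \<and> b i \<in> S i}) = (\<Prod>i<N. real (card (?F i)))"
    by (simp add: card_PiE)
  also have "\<dots> \<le> (\<Prod>i<N. real (d i) - 1)"
  proof (rule prod_mono, intro conjI)
    fix i assume i: "i \<in> {..<N}"
    have "?F i \<subseteq> (\<lambda>c. {a i, c}) ` ({..<d i} - {a i})"
    proof
      fix T assume T: "T \<in> ?F i"
      then obtain x y where "T = {x, y}" "x \<noteq> y" by (auto simp: card_2_iff)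
      then show "T \<in> (\<lambda>c. {a i, c}) ` ({..<d i} - {a i})" using T by (cases "a i = x") auto
    qed
    then have "card (?F i) \<le> card ((\<lambda>c. {a i, c}) ` ({..<d i} - {a i}))" by (intro card_mono) auto
    also have "\<dots> \<le> card ({..<d i} - {a i})" by (rule card_image_le) simp
    also have "\<dots> = d i - 1" using assms i by (auto simp: configs_def)
    finally show "real (card (?F i)) \<le> real (d i) - 1" using assms(2) i by (auto simp: of_nat_diff)
  qed simp
  finally show ?thesis .
qed

text \<open>The embedding commutes with \<open>merge\<close>, so every minor of a substate is a
  minor of \<open>\<phi>\<close>. Exchanging the sums counts the substates containing a given pair
  of configurations.\<close>

lemma sum_substates_minor_sum:
  assumes d: "\<forall>i<N. d i \<ge> 2"
  shows "(\<Sum>S\<in>substate_choices N d. minor_sum (\<lambda>_. 2) {..<N} A (\<phi> \<circ> emb N S))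
    \<le> (\<Prod>i<N. real (d i) - 1) * minor_sum d {..<N} A \<phi>"
proof -
  let ?C = "configs d {..<N}" and ?P = "substate_choices N d"
  define g where "g a b = (cmod (\<phi> a * \<phi> b - \<phi> (merge A a b) * \<phi> (merge A b a)))\<^sup>2" for a b
  have g0: "g a b \<ge> 0" for a b by (simp add: g_def)
  have "minor_sum (\<lambda>_. 2) {..<N} A (\<phi> \<circ> emb N S) =
      (\<Sum>p\<in>{p\<in>?C \<times> ?C. \<forall>i<N. fst p i \<in> S i \<and> snd p i \<in> S i}. g (fst p) (snd p))" if "S \<in> ?P" for S
  proof -
    let ?R = "{a \<in> ?C. \<forall>i<N. a i \<in> S i}"
    have "minor_sum (\<lambda>_. 2) {..<N} A (\<phi> \<circ> emb N S) =
      (\<Sum>a\<in>qconfigs {..<N}. \<Sum>b\<in>qconfigs {..<N}. g (emb N S a) (emb N S b))"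
      unfolding minor_sum_def g_def by (simp add: emb_merge)
    also have "\<dots> = (\<Sum>a\<in>qconfigs {..<N}. \<Sum>b\<in>?R. g (emb N S a) b)"
      by (intro sum.cong refl sum.reindex_bij_betw[OF bij_betw_emb[OF that]])
    also have "\<dots> = (\<Sum>a\<in>?R. \<Sum>b\<in>?R. g a b)"
      by (rule sum.reindex_bij_betw[OF bij_betw_emb[OF that]])
    also have "\<dots> = (\<Sum>p\<in>?R \<times> ?R. g (fst p) (snd p))"
      by (simp add: sum.cartesian_product case_prod_unfold)
    also have "?R \<times> ?R = {p\<in>?C \<times> ?C. \<forall>i<N. fst p i \<in> S i \<and> snd p i \<in> S i}" by auto
    finally show ?thesis .
  qed
  then have "(\<Sum>S\<in>?P. minor_sum (\<lambda>_. 2) {..<N} A (\<phi> \<circ> emb N S)) =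
    (\<Sum>S\<in>?P. \<Sum>p\<in>{p\<in>?C \<times> ?C. \<forall>i<N. fst p i \<in> S i \<and> snd p i \<in> S i}. g (fst p) (snd p))"
    by (intro sum.cong) auto
  also have "\<dots> = (\<Sum>p\<in>?C \<times> ?C. \<Sum>S\<in>{S\<in>?P. \<forall>i<N. fst p i \<in> S i \<and> snd p i \<in> S i}. g (fst p) (snd p))"
    by (rule sum.swap_restrict) (auto simp: finite_substate_choices)
  also have "\<dots> \<le> (\<Sum>p\<in>?C \<times> ?C. (\<Prod>i<N. real (d i) - 1) * g (fst p) (snd p))"
    by (intro sum_mono) (auto intro!: mult_right_mono card_choices_containing d g0)
  also have "\<dots> = (\<Prod>i<N. real (d i) - 1) * minor_sum d {..<N} A \<phi>"
    unfolding minor_sum_def g_def[symmetric]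
    by (simp add: sum.cartesian_product case_prod_unfold sum_distrib_left)
  finally show ?thesis .
qed

lemma pure_substate_bound:
  assumes N: "N \<ge> 5" and d: "\<forall>i<N. d i \<ge> 2" 
    and Y: "\<And>S i j. det2 (Y S i j) = 1"
  shows "real N / (2 ^ (N - 2) * (\<Prod>i<N. real (d i) - 1)) *
      (\<Sum>S\<in>substate_choices N d. \<Sum>i<N. \<Sum>j\<in>{i<..<N}. (max 0 (pair_witness {..<N} (Y S i j) i j (\<phi> \<circ> emb N S)))\<^sup>2)
     \<le> (CN_pure N d \<phi>)\<^sup>2"
proof -
  let ?P = "substate_choices N d"
  define D where "D = (\<Prod>i<N. real (d i) - 1)"
  define T where "T = (\<Sum>S\<in>?P. \<Sum>i<N. \<Sum>j\<in>{i<..<N}. (max 0 (pair_witness {..<N} (Y S i j) i j (\<phi> \<circ> emb N S)))\<^sup>2)"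
  have D: "D > 0" unfolding D_def using d by (intro prod_pos) force
  have "2 * real N * T = (\<Sum>S\<in>?P. 2 * real N * (\<Sum>i<N. \<Sum>j\<in>{i<..<N}. (max 0 (pair_witness {..<N} (Y S i j) i j (\<phi> \<circ> emb N S)))\<^sup>2))"
    unfolding T_def by (simp add: sum_distrib_left)
  also have "\<dots> \<le> (\<Sum>S\<in>?P. \<Sum>\<alpha>\<in>proper_cuts {..<N}. minor_sum (\<lambda>_. 2) {..<N} \<alpha> (\<phi> \<circ> emb N S))"
  proof (rule sum_mono)
    fix S
    \<comment> \<open>Witnesses are given for \<open>i < j\<close>; the opposite order is filled in
      by adjoints, as required for summing over all cuts.\<close>
    define X where "X i j = (if i < j then Y S i j else dg (Y S j i))" for i j
    have X: "det2 (X i j) = 1 \<and> X j i = dg (X i j)" if "i < N" "j < N" "i \<noteq> j" for i j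
      using that Y by (auto simp: X_def)
    have "2 * real N * (\<Sum>i<N. \<Sum>j\<in>{i<..<N}. (max 0 (pair_witness {..<N} (X i j) i j (\<phi> \<circ> emb N S)))\<^sup>2)
      \<le> (\<Sum>\<alpha>\<in>proper_cuts {..<N}. minor_sum (\<lambda>_. 2) {..<N} \<alpha> (\<phi> \<circ> emb N S))"
      by (rule witness_all_cuts[OF N X])
    then show "2 * real N * (\<Sum>i<N. \<Sum>j\<in>{i<..<N}. (max 0 (pair_witness {..<N} (Y S i j) i j (\<phi> \<circ> emb N S)))\<^sup>2)
      \<le> (\<Sum>\<alpha>\<in>proper_cuts {..<N}. minor_sum (\<lambda>_. 2) {..<N} \<alpha> (\<phi> \<circ> emb N S))"
      unfolding X_def by simp
  qed
  also have "\<dots> = (\<Sum>\<alpha>\<in>proper_cuts {..<N}. \<Sum>S\<in>?P. minor_sum (\<lambda>_. 2) {..<N} \<alpha> (\<phi> \<circ> emb N S))"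
    by (rule sum.swap)
  also have "\<dots> \<le> (\<Sum>\<alpha>\<in>proper_cuts {..<N}. D * minor_sum d {..<N} \<alpha> \<phi>)"
    unfolding D_def by (intro sum_mono sum_substates_minor_sum d)
  also have "\<dots> = D * (2 ^ (N - 1) * (CN_pure N d \<phi>)\<^sup>2)"
    using N by (subst CN_pure_sq(1)) (simp_all add: sum_distrib_left[symmetric])
  finally have "2 * real N * T \<le> D * (2 ^ (N - 1) * (CN_pure N d \<phi>)\<^sup>2)" .
  moreover have "(2::real) ^ (N - 1) = 2 * 2 ^ (N - 2)"
  proof -
    have "N - 1 = Suc (N - 2)" using N by simp
    then show ?thesis by (simp only: power_Suc)
  qed
  ultimately have "real N * T \<le> (2 ^ (N - 2) * D) * (CN_pure N d \<phi>)\<^sup>2" by (simp add: mult_ac)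
  then show ?thesis unfolding T_def[symmetric] D_def[symmetric]
    using D by (simp add: field_simps)
qed

section \<open>Cholesky and Takagi factorisations\<close>

text \<open>The quadratic-form condition of \<open>density_op\<close> over an arbitrary index set,
  shared by the global state and the two-qubit reductions.\<close>

definition psd_on :: "'a set \<Rightarrow> ('a \<Rightarrow> 'a \<Rightarrow> complex) \<Rightarrow> bool" where
  "psd_on X K \<longleftrightarrow> (\<forall>v. let q = (\<Sum>x\<in>X. \<Sum>y\<in>X. cnj (v x) * K x y * v y) in Im q = 0 \<and> Re q \<ge> 0)"

lemma psd_onI:
  assumes "\<And>v. Im (\<Sum>x\<in>X. \<Sum>y\<in>X. cnj (v x) * K x y * v y) = 0"
    "\<And>v. Re (\<Sum>x\<in>X. \<Sum>y\<in>X. cnj (v x) * K x y * v y) \<ge> 0"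
  shows "psd_on X K"
  using assms unfolding psd_on_def Let_def by blast

lemma psd_onD:
  assumes "psd_on X K"
  shows "Im (\<Sum>x\<in>X. \<Sum>y\<in>X. cnj (v x) * K x y * v y) = 0"
    "Re (\<Sum>x\<in>X. \<Sum>y\<in>X. cnj (v x) * K x y * v y) \<ge> 0"
  using assms unfolding psd_on_def Let_def by blast+

lemma psd_on_two_points:
  assumes "psd_on X K" "finite X" "x \<in> X" "y \<in> X" "x \<noteq> y"
  defines "q \<equiv> \<lambda>a b. cnj a * K x x * a + cnj a * K x y * b + cnj b * K y x * a + cnj b * K y y * b"
  shows "Im (q a b) = 0" "Re (q a b) \<ge> 0"
proof -
  define v where "v = (\<lambda>z. if z = x then a else if z = y then b else 0)"
  have s: "(\<Sum>z\<in>X. f z) = f x + f y" if "\<And>z. z \<noteq> x \<Longrightarrow> z \<noteq> y \<Longrightarrow> f z = 0" for f :: "'a \<Rightarrow> complex"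
  proof -
    have "(\<Sum>z\<in>X. f z) = (\<Sum>z\<in>{x, y}. f z)"
      using assms(2-4) that by (intro sum.mono_neutral_right) auto
    then show ?thesis using assms(5) by simp
  qed
  have v: "v x = a" "v y = b" "\<And>z. z \<noteq> x \<Longrightarrow> z \<noteq> y \<Longrightarrow> v z = 0"
    using assms(5) by (auto simp: v_def)
  have "(\<Sum>z\<in>X. \<Sum>w\<in>X. cnj (v z) * K z w * v w) = q a b"
    by (subst s, use v in simp, (subst s, use v in simp)+) (simp add: v q_def algebra_simps)
  then show "Im (q a b) = 0" "Re (q a b) \<ge> 0"
    using psd_onD[OF assms(1), of v] by simp_all
qed

lemma psd_on_subset:
  assumes "psd_on X K" "finite X" "Z \<subseteq> X"
  shows "psd_on Z K"
proof (rule psd_onI)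
  fix v :: "'a \<Rightarrow> complex"
  define w where "w x = (if x \<in> Z then v x else 0)" for x
  have "(\<Sum>x\<in>X. \<Sum>y\<in>X. cnj (w x) * K x y * w y) = (\<Sum>x\<in>Z. \<Sum>y\<in>Z. cnj (w x) * K x y * w y)"
    using assms(2,3) by (intro sum.mono_neutral_cong_right) (auto simp: w_def intro!: sum.mono_neutral_cong_right)
  also have "\<dots> = (\<Sum>x\<in>Z. \<Sum>y\<in>Z. cnj (v x) * K x y * v y)"
    by (intro sum.cong) (auto simp: w_def)
  finally show "Im (\<Sum>x\<in>Z. \<Sum>y\<in>Z. cnj (v x) * K x y * v y) = 0"
    "Re (\<Sum>x\<in>Z. \<Sum>y\<in>Z. cnj (v x) * K x y * v y) \<ge> 0"
    using psd_onD[OF assms(1), of w] by simp_all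
qed

lemma psd_on_diag:
  assumes "psd_on X K" "finite X" "x \<in> X"
  shows "K x x = of_real (Re (K x x))" "Re (K x x) \<ge> 0"
proof -
  have "psd_on {x} K" using psd_on_subset[OF assms(1,2)] assms(3) by simp
  then have "Im (K x x) = 0 \<and> Re (K x x) \<ge> 0"
    unfolding psd_on_def Let_def by (auto dest!: spec[of _ "\<lambda>_. 1"])
  then show "K x x = of_real (Re (K x x))" "Re (K x x) \<ge> 0" by (auto simp: complex_eq_iff)
qed

text \<open>Reality of the quadratic form at the vectors (1, 1) and \<open>(1, \<i>)\<close> yields
  the imaginary and the real part of the claim.\<close>

lemma psd_on_hermitian:
  assumes "psd_on X K" "finite X" "x \<in> X" "y \<in> X"
  shows "K y x = cnj (K x y)"
proof (cases "x = y")
  case True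
  then show ?thesis using psd_on_diag(1)[OF assms(1-3)] by (metis complex_cnj_complex_of_real)
next
  case False
  have d: "Im (K x x) = 0" "Im (K y y) = 0"
    using psd_on_diag(1)[OF assms(1,2)] assms(3,4) by (metis Im_complex_of_real)+
  have "Im (K x y) + Im (K y x) = 0"
    using psd_on_two_points(1)[OF assms False, of 1 1] d by simp
  moreover have "Re (K x y) - Re (K y x) = 0"
    using psd_on_two_points(1)[OF assms False, of 1 \<i>] d by simp
  ultimately show ?thesis by (simp add: complex_eq_iff)
qed

lemma psd_on_zero_diag:
  assumes "psd_on X K" "finite X" "x \<in> X" "y \<in> X" "K x x = 0"
  shows "K x y = 0"
proof (cases "x = y")
  case False
  define h where "h = K x y"
  define r where "r = Re (K y y)"
  have yx: "K y x = cnj h" unfolding h_def by (rule psd_on_hermitian[OF assms(1-4)])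
  have yy: "K y y = of_real r" unfolding r_def by (rule psd_on_diag(1)[OF assms(1,2,4)])
  have "0 \<le> r - 2 * t * (cmod h)\<^sup>2" for t
  proof -
    have "0 \<le> Re (cnj (- of_real t * h) * K x y + K y x * (- of_real t * h) + K y y)"
      using psd_on_two_points(2)[OF assms(1-4) False, of "- of_real t * h" 1] assms(5) by simp
    also have "\<dots> = r - 2 * t * (cmod h)\<^sup>2"
      unfolding yx yy h_def[symmetric] cmod_power2 by (simp add: power2_eq_square algebra_simps)
    finally show ?thesis .
  qed
  \<comment> \<open>For nonzero \<open>h\<close> this \<open>t\<close> would make the value of the
    quadratic form -1.\<close>
  from this[of "(r + 1) / (2 * (cmod h)\<^sup>2)"] have "h = 0" by (cases "h = 0") auto
  then show ?thesis by (simp add: h_def)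
qed (use assms in simp)

text \<open>Cholesky factorisation; a vanishing pivot is covered by \<open>x / 0 = 0\<close>.\<close>
lemma psd_on_factor:
  assumes "finite X" "psd_on X K"
  shows "\<exists>\<phi>. \<forall>x\<in>X. \<forall>y\<in>X. K x y = (\<Sum>k<card X. \<phi> k x * cnj (\<phi> k y))"
  using assms
proof (induct X arbitrary: K rule: finite_induct)
  case (insert a X)
  note fin = finite.insertI[OF insert.hyps(1), of a]
  note herm = psd_on_hermitian[OF insert.prems fin]
  define r where "r = Re (K a a)"
  have r: "K a a = of_real r" "r \<ge> 0"
    unfolding r_def using psd_on_diag[OF insert.prems fin] by auto
  \<comment> \<open>The Schur complement of the pivot \<open>K a a\<close>.\<close>
  define K' where "K' x y = K x y - K x a * K a y / K a a" for x y
  have "psd_on X K'"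
  proof (rule psd_onI)
    fix v :: "'a \<Rightarrow> complex"
    define s where "s = (\<Sum>y\<in>X. K a y * v y)"
    \<comment> \<open>The coordinate at \<open>a\<close> completes the square, so the form of
      \<open>K\<close> at \<open>w\<close> equals the form of \<open>K'\<close> at
      \<open>v\<close>.\<close>
    define w where "w = v(a := - s / K a a)"
    define Q where "Q = (\<Sum>x\<in>X. \<Sum>y\<in>X. cnj (v x) * K x y * v y)"
    have cs: "cnj s = (\<Sum>x\<in>X. cnj (v x) * K x a)"
      unfolding s_def cnj_sum by (intro sum.cong refl) (subst herm[of a], auto)
    have wX: "w x = v x" if "x \<in> X" for x using that insert.hyps(2) by (auto simp: w_def)
    have wa: "w a = - s / K a a" by (simp add: w_def)
    have "(\<Sum>x\<in>insert a X. \<Sum>y\<in>insert a X. cnj (w x) * K x y * w y)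
      = cnj (w a) * K a a * w a + cnj (w a) * s + cnj s * w a + Q"
    proof -
      have "(\<Sum>y\<in>X. cnj (w a) * K a y * v y) = cnj (w a) * s"
        by (simp add: s_def sum_distrib_left mult.assoc)
      moreover have "(\<Sum>x\<in>X. cnj (v x) * K x a * w a) = cnj s * w a"
        unfolding cs by (simp add: sum_distrib_right)
      ultimately show ?thesis
        using insert.hyps by (simp add: wX sum.distrib Q_def)
    qed
    also have "\<dots> = Q - s * cnj s / K a a"
      unfolding wa r(1) by (cases "r = 0") (auto simp: field_simps)
    also have "\<dots> = (\<Sum>x\<in>X. \<Sum>y\<in>X. cnj (v x) * K' x y * v y)"
    proof -
      have "s * cnj s / K a a = (\<Sum>x\<in>X. \<Sum>y\<in>X. cnj (v x) * (K x a * K a y / K a a) * v y)"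
      proof -
        have "s * cnj s / K a a = (\<Sum>x\<in>X. cnj (v x) * K x a) * (\<Sum>y\<in>X. K a y * v y) / K a a"
          by (subst cs[symmetric], subst s_def[symmetric]) (simp add: mult.commute)
        then show ?thesis unfolding sum_product sum_divide_distrib by (simp add: mult_ac)
      qed
      then show ?thesis unfolding Q_def K'_def by (simp add: sum_subtractf algebra_simps)
    qed
    finally show "Im (\<Sum>x\<in>X. \<Sum>y\<in>X. cnj (v x) * K' x y * v y) = 0"
      "Re (\<Sum>x\<in>X. \<Sum>y\<in>X. cnj (v x) * K' x y * v y) \<ge> 0"
      using psd_onD[OF insert.prems, of w] by simp_all
  qed
  then obtain \<phi> where \<phi>: "\<And>x y. x \<in> X \<Longrightarrow> y \<in> X \<Longrightarrow> K' x y = (\<Sum>k<card X. \<phi> k x * cnj (\<phi> k y))"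
    using insert.hyps(3) by blast
  define \<phi>' where "\<phi>' k x = (if k < card X then if x = a then 0 else \<phi> k x else K x a / of_real (sqrt r))" for k x
  have ss: "complex_of_real (sqrt r) * of_real (sqrt r) = of_real r"
    using r(2) by (metis of_real_mult real_sqrt_mult_self abs_of_nonneg)
  have last: "\<phi>' (card X) x * cnj (\<phi>' (card X) y) = K x a * K a y / K a a"
    if "x \<in> insert a X" "y \<in> insert a X" for x y
    using herm[OF that(2) insertI1] by (simp add: \<phi>'_def r(1) ss)
  have "K x y = (\<Sum>k<card (insert a X). \<phi>' k x * cnj (\<phi>' k y))"
    if xy: "x \<in> insert a X" "y \<in> insert a X" for x y
  proof -
    have "(\<Sum>k<card (insert a X). \<phi>' k x * cnj (\<phi>' k y)) = (\<Sum>k<card X. \<phi>' k x * cnj (\<phi>' k y)) + K x a * K a y / K a a"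
      using insert.hyps last[OF xy] by simp
    also have "(\<Sum>k<card X. \<phi>' k x * cnj (\<phi>' k y)) = (if x = a \<or> y = a then 0 else K' x y)"
      using xy \<phi>[of x y] by (auto simp: \<phi>'_def)
    also have "\<dots> + K x a * K a y / K a a = K x y"
    proof (cases "x = a \<or> y = a")
      case True
      have "K a a = 0 \<Longrightarrow> K a y = 0" "K a a = 0 \<Longrightarrow> K a x = 0"
        using psd_on_zero_diag[OF insert.prems fin] xy by auto
      moreover have "K x a = cnj (K a x)" by (rule herm[OF insertI1 xy(1)])
      ultimately show ?thesis using True by (cases "K a a = 0") auto
    qed (simp add: K'_def)
    finally show ?thesis by simp
  qed
  then show ?case by blast
qed simp

text \<open>A unitary with prescribed first row: the reflection \<open>H\<close> along
  \<open>w\<close> maps the first basis vector, up to the phase \<open>\<gamma>\<close>, to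
  \<open>y\<close>.\<close>

lemma householder:
  fixes y :: "nat \<Rightarrow> complex" and m :: nat
  assumes m: "m > 0" and y: "(\<Sum>l<m. y l * cnj (y l)) = 1"
  obtains U where "\<And>l. l < m \<Longrightarrow> U 0 l = y l"
    "\<And>k k'. k < m \<Longrightarrow> k' < m \<Longrightarrow> (\<Sum>l<m. U k l * cnj (U k' l)) = (if k = k' then 1 else 0)"
    "\<And>l l'. l < m \<Longrightarrow> l' < m \<Longrightarrow> (\<Sum>k<m. U k l * cnj (U k l')) = (if l = l' then 1 else 0)"
proof -
  define c where "c = complex_of_real (cmod (y 0))"
  \<comment> \<open>The phase is opposite to that of \<open>y 0\<close>, so the squared norm of
    \<open>w\<close> is \<open>2 * h\<close> with \<open>h = 1 + c\<close> bounded away from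
    zero.\<close>
  define \<gamma> where "\<gamma> = (if y 0 = 0 then -1 else - (y 0 / c))"
  define h where "h = 1 + c"
  define w where "w l = y l - (if l = 0 then \<gamma> else 0)" for l
  have cc: "y 0 * cnj (y 0) = c * c" unfolding c_def using complex_norm_square[of "y 0"] by (simp add: power2_eq_square)
  have cr: "cnj c = c" unfolding c_def by simp
  have \<gamma>: "\<gamma> * cnj \<gamma> = 1"
  proof (cases "y 0 = 0")
    case False
    then have "c * c \<noteq> 0" by (simp add: c_def)
    then show ?thesis using cc False by (simp add: \<gamma>_def cr)
  qed (simp add: \<gamma>_def)
  have y0: "y 0 = - \<gamma> * c" by (auto simp: \<gamma>_def c_def)
  have y0': "cnj (y 0) = - cnj \<gamma> * c" unfolding y0 by (simp add: cr)
  have h0: "h \<noteq> 0"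
  proof -
    have "1 + cmod (y 0) > 0" by (simp add: add_pos_nonneg)
    moreover have "h = of_real (1 + cmod (y 0))" by (simp add: h_def c_def)
    ultimately show ?thesis by (metis less_irrefl of_real_eq_0_iff)
  qed
  have hr: "cnj h = h" by (simp add: h_def cr)
  have ww: "(\<Sum>l<m. w l * cnj (w l)) = 2 * h"
  proof -
    have "(\<Sum>l<m. w l * cnj (w l)) = w 0 * cnj (w 0) + (\<Sum>l\<in>{..<m} - {0}. w l * cnj (w l))"
      using m by (subst sum.remove[of _ 0]) auto
    also have "(\<Sum>l\<in>{..<m} - {0}. w l * cnj (w l)) = (\<Sum>l\<in>{..<m} - {0}. y l * cnj (y l))"
      by (intro sum.cong refl) (auto simp: w_def)
    also have "\<dots> = 1 - y 0 * cnj (y 0)"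
      using m y by (subst (asm) sum.remove[of _ 0]) (auto simp: algebra_simps)
    also have "w 0 * cnj (w 0) = \<gamma> * cnj \<gamma> * (1 + c) * (1 + c)"
      unfolding w_def by (simp add: y0 cr algebra_simps)
    also have "\<dots> = (1 + c) * (1 + c)" using \<gamma> by simp
    finally show ?thesis using cc by (simp add: h_def algebra_simps)
  qed
  define H where "H l k = (if l = k then 1 else 0) - w l * cnj (w k) / h" for l k
  have HH: "(\<Sum>l<m. H l k * cnj (H l k')) = (if k = k' then 1 else 0)" if "k < m" "k' < m" for k k'
  proof -
    define C where "C = cnj (w k) * w k' / (h * h)"
    have "H l k * cnj (H l k') = (if l = k then (if k = k' then 1 else 0) - cnj (w k) * w k' / h else 0)
      + (if l = k' then - w k' * cnj (w k) / h else 0) + w l * cnj (w l) * C" for l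
      by (auto simp: H_def hr C_def algebra_simps)
    then have "(\<Sum>l<m. H l k * cnj (H l k')) = (if k = k' then 1 else 0) - cnj (w k) * w k' / h
       - w k' * cnj (w k) / h + (\<Sum>l<m. w l * cnj (w l) * C)"
      using that by (simp add: sum.distrib sum.delta)
    also have "(\<Sum>l<m. w l * cnj (w l) * C) = 2 * h * C"
      unfolding sum_distrib_right[symmetric] ww ..
    finally show ?thesis using h0 by (simp add: C_def field_simps)
  qed
  have Hh: "cnj (H l k) = H k l" for l k by (simp add: H_def hr mult.commute)
  define U where "U k l = H l k * \<gamma>" for k l
  have 1: "U 0 l = y l" if "l < m" for l
  proof -
    have "cnj (w 0) = - cnj \<gamma> * h" unfolding w_def h_def using y0' by (simp add: algebra_simps)
    then have "U 0 l = ((if l = 0 then 1 else 0) + w l * cnj \<gamma>) * \<gamma>"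
      unfolding U_def H_def using h0 by simp
    also have "\<dots> = (if l = 0 then \<gamma> else 0) + w l * (\<gamma> * cnj \<gamma>)" by (simp add: algebra_simps)
    finally show ?thesis unfolding \<gamma> w_def by simp
  qed
  have p: "(a * \<gamma>) * cnj (b * \<gamma>) = a * cnj b" for a b
    using \<gamma> by (metis (no_types, lifting) complex_cnj_mult mult.commute mult.left_commute mult.right_neutral)
  have 2: "(\<Sum>l<m. U k l * cnj (U k' l)) = (if k = k' then 1 else 0)" if "k < m" "k' < m" for k k'
    unfolding U_def p by (rule HH[OF that])
  have 3: "(\<Sum>k<m. U k l * cnj (U k l')) = (if l = l' then 1 else 0)" if "l < m" "l' < m" for l l'
  proof -
    have "(\<Sum>k<m. U k l * cnj (U k l')) = (\<Sum>k<m. H k l' * cnj (H k l))"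
      unfolding U_def p Hh by (intro sum.cong refl) (metis Hh mult.commute)
    then show ?thesis using HH[OF that(2,1)] by auto
  qed
  show ?thesis by (rule that[OF 1 2 3])
qed

text \<open>An eigenvector \<open>v\<close> of \<open>\<tau> \<tau>\<^sup>*\<close> yields the coneigenvector \<open>\<tau> v\<^sup>* + \<lambda> v\<close>, or \<open>\<i> v\<close> if that vanishes.\<close>
lemma coneigenvector:
  fixes \<tau> :: "nat \<Rightarrow> nat \<Rightarrow> complex"
  assumes m: "m > 0" and sym: "\<And>k l. k < m \<Longrightarrow> l < m \<Longrightarrow> \<tau> k l = \<tau> l k"
  obtains x and lam :: real where "lam \<ge> 0" "(\<Sum>l<m. x l * cnj (x l)) = 1"
    "\<And>k. k < m \<Longrightarrow> (\<Sum>l<m. \<tau> k l * cnj (x l)) = of_real lam * x k"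
proof -
  define A where "A = mat m m (\<lambda>(k, j). \<Sum>l<m. \<tau> k l * cnj (\<tau> l j))"
  have A: "A \<in> carrier_mat m m" by (simp add: A_def)
  obtain as where as: "char_poly A = (\<Prod>a\<leftarrow>as. [:- a, 1:])" "length as = m"
    using char_poly_factorized[OF A] by blast
  obtain e as' where "as = e # as'" using as(2) m by (cases as) auto
  then have "poly (char_poly A) e = 0" unfolding as(1) by simp
  then have "eigenvalue A e" using eigenvalue_root_char_poly[OF A] by simp
  then obtain vv where vv: "vv \<in> carrier_vec m" "vv \<noteq> 0\<^sub>v m" "A *\<^sub>v vv = e \<cdot>\<^sub>v vv"
    using A by (auto simp: eigenvalue_def eigenvector_def)
  define v where "v k = vv $ k" for k
  define u where "u k = (\<Sum>j<m. cnj (\<tau> k j) * v j)" for k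
  have Av: "(\<Sum>l<m. \<tau> k l * u l) = e * v k" if "k < m" for k
  proof -
    have "(A *\<^sub>v vv) $ k = (\<Sum>j<m. (\<Sum>l<m. \<tau> k l * cnj (\<tau> l j)) * v j)"
      using that vv(1) A by (simp add: A_def scalar_prod_def v_def atLeast0LessThan)
    also have "\<dots> = (\<Sum>j<m. \<Sum>l<m. \<tau> k l * (cnj (\<tau> l j) * v j))"
      by (simp add: sum_distrib_right mult.assoc)
    also have "\<dots> = (\<Sum>l<m. \<tau> k l * u l)"
      unfolding u_def sum_distrib_left by (rule sum.swap)
    finally show ?thesis using vv(1,3) that by (simp add: v_def)
  qed
  obtain j where j: "j < m" "v j \<noteq> 0"
    using vv(1,2) by (metis (no_types, lifting) carrier_vecD eq_vecI index_zero_vec(1) index_zero_vec(2) v_def)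
  have cn: "z * cnj z = of_real ((cmod z)\<^sup>2)" for z by (simp add: complex_norm_square del: of_real_power)
  have pos: "(\<Sum>l<m. (cmod (z l))\<^sup>2) > 0" if "k < m" "z k \<noteq> 0" for z :: "nat \<Rightarrow> complex" and k
    using that by (intro sum_pos2[of _ k]) auto
  define nv where "nv = (\<Sum>l<m. (cmod (v l))\<^sup>2)"
  define nu where "nu = (\<Sum>l<m. (cmod (u l))\<^sup>2)"
  have nv: "nv > 0" unfolding nv_def using j by (rule pos)
  \<comment> \<open>By symmetry the product of \<open>\<tau>\<close> with its conjugate is positive
    semidefinite, so the eigenvalue \<open>e\<close> is the nonnegative quotient
    \<open>nu / nv\<close>.\<close>
  have "of_real nu = (\<Sum>l<m. u l * (\<Sum>k<m. \<tau> l k * cnj (v k)))"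
    unfolding nu_def of_real_sum cn[symmetric] u_def by (simp add: mult_ac)
  also have "\<dots> = (\<Sum>k<m. \<Sum>l<m. \<tau> l k * cnj (v k) * u l)"
    unfolding sum_distrib_left by (subst sum.swap) (simp add: mult_ac)
  also have "\<dots> = (\<Sum>k<m. cnj (v k) * (\<Sum>l<m. \<tau> k l * u l))"
    unfolding sum_distrib_left by (intro sum.cong refl) (use sym in \<open>simp add: mult_ac\<close>)
  also have "\<dots> = (\<Sum>k<m. e * (v k * cnj (v k)))"
    using Av by (intro sum.cong refl) simp
  also have "\<dots> = e * of_real nv"
    unfolding nv_def of_real_sum cn[symmetric] sum_distrib_left ..
  finally have e: "e = of_real (nu / nv)" using nv by (simp add: field_simps)
  define lam where "lam = sqrt (nu / nv)"
  have nu: "nu / nv \<ge> 0" using nv unfolding nu_def by (intro divide_nonneg_pos sum_nonneg) auto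
  have ll: "lam * lam = nu / nv" using nu unfolding lam_def by (simp only: real_sqrt_mult_self abs_of_nonneg)
  have lam: "lam \<ge> 0" "e = of_real lam * of_real lam"
    unfolding of_real_mult[symmetric] ll e using nu by (simp_all add: lam_def)
  have "\<exists>z. (\<exists>k<m. z k \<noteq> 0) \<and> (\<forall>k<m. (\<Sum>l<m. \<tau> k l * cnj (z l)) = of_real lam * z k)"
  proof (cases "\<exists>k<m. cnj (u k) + of_real lam * v k \<noteq> 0")
    case True
    have "(\<Sum>l<m. \<tau> k l * cnj (cnj (u l) + of_real lam * v l)) = of_real lam * (cnj (u k) + of_real lam * v k)" if "k < m" for k
    proof -
      have "(\<Sum>l<m. \<tau> k l * cnj (cnj (u l) + of_real lam * v l)) =
         (\<Sum>l<m. \<tau> k l * u l) + of_real lam * cnj (u k)"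
        unfolding u_def[of k] by (simp add: sum.distrib sum_distrib_left algebra_simps)
      then show ?thesis using Av[OF that] lam(2) by (simp add: algebra_simps)
    qed
    then show ?thesis using True by (intro exI[of _ "\<lambda>k. cnj (u k) + of_real lam * v k"]) auto
  next
    case False
    \<comment> \<open>Here \<open>\<tau>\<close> maps the conjugate of \<open>v\<close> to
      \<open>- lam\<close> times \<open>v\<close>; the map is conjugate-linear, so multiplication by
      \<open>\<i>\<close> reverses the sign.\<close>
    have "(\<Sum>l<m. \<tau> k l * cnj (\<i> * v l)) = of_real lam * (\<i> * v k)" if "k < m" for k
    proof -
      have "(\<Sum>l<m. \<tau> k l * cnj (\<i> * v l)) = - \<i> * cnj (u k)"
        unfolding u_def by (simp add: sum_distrib_left algebra_simps)
      also have "cnj (u k) = - of_real lam * v k" using False that by (simp add: add_eq_0_iff)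
      finally show ?thesis by simp
    qed
    then show ?thesis using j by (intro exI[of _ "\<lambda>k. \<i> * v k"]) auto
  qed
  then obtain z k where z: "k < m" "z k \<noteq> 0" "\<And>k. k < m \<Longrightarrow> (\<Sum>l<m. \<tau> k l * cnj (z l)) = of_real lam * z k"
    by blast
  define n where "n = (\<Sum>l<m. (cmod (z l))\<^sup>2)"
  have n: "n > 0" unfolding n_def using z(1,2) by (rule pos)
  have sn: "complex_of_real (sqrt n) * of_real (sqrt n) = of_real n"
    using n by (metis of_real_mult real_sqrt_mult_self abs_of_pos)
  show ?thesis
  proof (rule that[of lam "\<lambda>l. z l / of_real (sqrt n)"])
    have "(\<Sum>l<m. z l / of_real (sqrt n) * cnj (z l / of_real (sqrt n))) = (\<Sum>l<m. z l * cnj (z l)) / of_real n"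
      by (simp add: sn sum_divide_distrib)
    then show "(\<Sum>l<m. z l / of_real (sqrt n) * cnj (z l / of_real (sqrt n))) = 1"
      using n unfolding cn of_real_sum[symmetric] n_def[symmetric] by simp
    show "(\<Sum>l<m. \<tau> k l * cnj (z l / of_real (sqrt n))) = of_real lam * (z k / of_real (sqrt n))" if "k < m" for k
      using z(3)[OF that] by (simp add: sum_divide_distrib[symmetric])
  qed (rule lam)
qed

definition bil :: "('a \<Rightarrow> 'a \<Rightarrow> complex) \<Rightarrow> 'a set \<Rightarrow> ('a \<Rightarrow> complex) \<Rightarrow> ('a \<Rightarrow> complex) \<Rightarrow> complex" where
  "bil Y P v w = (\<Sum>p\<in>P. \<Sum>q\<in>P. v p * Y p q * w q)"

lemma bil_sum_left: "bil Y P (\<lambda>p. \<Sum>l\<in>I. c l * V l p) w = (\<Sum>l\<in>I. c l * bil Y P (V l) w)"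
proof -
  have "bil Y P (\<lambda>p. \<Sum>l\<in>I. c l * V l p) w = (\<Sum>p\<in>P. \<Sum>q\<in>P. \<Sum>l\<in>I. c l * (V l p * Y p q * w q))"
    unfolding bil_def by (intro sum.cong refl) (simp add: sum_distrib_right mult.assoc)
  also have "\<dots> = (\<Sum>p\<in>P. \<Sum>l\<in>I. \<Sum>q\<in>P. c l * (V l p * Y p q * w q))"
    by (rule sum.cong[OF refl], rule sum.swap)
  also have "\<dots> = (\<Sum>l\<in>I. \<Sum>p\<in>P. \<Sum>q\<in>P. c l * (V l p * Y p q * w q))"
    by (rule sum.swap)
  finally show ?thesis by (simp add: bil_def sum_distrib_left)
qed

lemma bil_sym:
  assumes "\<And>p q. p \<in> P \<Longrightarrow> q \<in> P \<Longrightarrow> Y p q = Y q p"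
  shows "bil Y P v w = bil Y P w v"
proof -
  have "bil Y P v w = (\<Sum>q\<in>P. \<Sum>p\<in>P. v p * Y p q * w q)"
    unfolding bil_def by (rule sum.swap)
  also have "\<dots> = bil Y P w v"
    unfolding bil_def by (intro sum.cong refl) (subst assms, auto)
  finally show ?thesis .
qed

lemma sum_norm_outer:
  "(\<Sum>k\<in>I. (\<Sum>p\<in>P. c p * V k p) * cnj (\<Sum>q\<in>P. c q * V k q)) =
    (\<Sum>p\<in>P. \<Sum>q\<in>P. c p * cnj (c q) * (\<Sum>k\<in>I. V k p * cnj (V k q)))"
proof -
  have "(\<Sum>k\<in>I. (\<Sum>p\<in>P. c p * V k p) * cnj (\<Sum>q\<in>P. c q * V k q)) =
      (\<Sum>k\<in>I. \<Sum>p\<in>P. \<Sum>q\<in>P. c p * cnj (c q) * (V k p * cnj (V k q)))"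
    unfolding cnj_sum sum_product by (intro sum.cong refl) (simp add: mult_ac)
  also have "\<dots> = (\<Sum>p\<in>P. \<Sum>k\<in>I. \<Sum>q\<in>P. c p * cnj (c q) * (V k p * cnj (V k q)))"
    by (rule sum.swap)
  also have "\<dots> = (\<Sum>p\<in>P. \<Sum>q\<in>P. \<Sum>k\<in>I. c p * cnj (c q) * (V k p * cnj (V k q)))"
    by (rule sum.cong[OF refl], rule sum.swap)
  finally show ?thesis by (simp add: sum_distrib_left)
qed

lemma bil_norm_from_outer:
  assumes "\<And>p q. (\<Sum>k\<in>I. V k p * cnj (V k q)) = (\<Sum>k\<in>J. V' k p * cnj (V' k q))"
  shows "(\<Sum>k\<in>I. bil Y P u (V k) * cnj (bil Y P u (V k))) = (\<Sum>k\<in>J. bil Y P u (V' k) * cnj (bil Y P u (V' k)))"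
proof -
  define c where "c q = (\<Sum>p\<in>P. u p * Y p q)" for q
  have b: "bil Y P u v = (\<Sum>q\<in>P. c q * v q)" for v
    unfolding bil_def c_def sum_distrib_right by (rule sum.swap)
  show ?thesis unfolding b sum_norm_outer using assms by simp
qed

text \<open>Takagi factorisation. Deflation needs no bookkeeping of spans: orthogonality to the first
  vector only depends on \<open>\<Sum>\<^sub>k V\<^sub>k V\<^sub>k\<^sup>*\<close>, which the induction hypothesis preserves.\<close>
lemma takagi_vectors:
  fixes V :: "nat \<Rightarrow> 'a \<Rightarrow> complex"
  assumes sym: "\<And>p q. p \<in> P \<Longrightarrow> q \<in> P \<Longrightarrow> Y p q = Y q p"
  shows "\<exists>V' lam. (\<forall>p q. (\<Sum>k<m. V k p * cnj (V k q)) = (\<Sum>k<m. V' k p * cnj (V' k q))) \<and>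
     (\<forall>k<m. lam k \<ge> (0::real)) \<and>
     (\<forall>k<m. \<forall>l<m. bil Y P (V' k) (V' l) = (if k = l then of_real (lam k) else 0))"
proof (induct m arbitrary: V)
  case (Suc m)
  let ?b = "bil Y P"
  have bsym: "?b v w = ?b w v" for v w by (rule bil_sym) (rule sym)
  \<comment> \<open>A coneigenvector of the symmetric Gram matrix of the \<open>V k\<close> under
    the bilinear form; its conjugate becomes the first row of the unitary \<open>U\<close>.\<close>
  obtain x and lam0 :: real where x: "lam0 \<ge> 0" "(\<Sum>l<Suc m. x l * cnj (x l)) = 1"
    "\<And>k. k < Suc m \<Longrightarrow> (\<Sum>l<Suc m. ?b (V k) (V l) * cnj (x l)) = of_real lam0 * x k"
    using coneigenvector[of "Suc m" "\<lambda>k l. ?b (V k) (V l)", OF zero_less_Suc bsym] by blast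
  have "(\<Sum>l<Suc m. cnj (x l) * cnj (cnj (x l))) = 1" using x(2) by (simp add: mult.commute)
  then obtain U where U: "\<And>l. l < Suc m \<Longrightarrow> U 0 l = cnj (x l)"
    "\<And>k k'. k < Suc m \<Longrightarrow> k' < Suc m \<Longrightarrow> (\<Sum>l<Suc m. U k l * cnj (U k' l)) = (if k = k' then 1 else 0)"
    "\<And>l l'. l < Suc m \<Longrightarrow> l' < Suc m \<Longrightarrow> (\<Sum>k<Suc m. U k l * cnj (U k l')) = (if l = l' then 1 else 0)"
    using householder[of "Suc m" "\<lambda>l. cnj (x l)"] by blast
  define V1 where "V1 k = (\<lambda>p. \<Sum>l<Suc m. U k l * V l p)" for k
  have b1: "?b (V1 k) (V1 0) = (if k = 0 then of_real lam0 else 0)" if "k < Suc m" for k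
  proof -
    have "?b (V l) (V1 0) = of_real lam0 * x l" if "l < Suc m" for l
    proof -
      have "?b (V l) (V1 0) = (\<Sum>j<Suc m. U 0 j * ?b (V j) (V l))"
        unfolding bsym[of "V l"] V1_def by (rule bil_sum_left)
      also have "\<dots> = (\<Sum>j<Suc m. ?b (V l) (V j) * cnj (x j))"
        by (intro sum.cong refl) (simp add: U(1) bsym[of "V l"] mult.commute)
      finally show ?thesis using x(3)[OF that] by simp
    qed
    then have "?b (V1 k) (V1 0) = (\<Sum>l<Suc m. U k l * (of_real lam0 * cnj (U 0 l)))"
      unfolding V1_def[of k] bil_sum_left using U(1) by (intro sum.cong refl) simp
    also have "\<dots> = of_real lam0 * (\<Sum>l<Suc m. U k l * cnj (U 0 l))"
      unfolding sum_distrib_left by (intro sum.cong refl) (simp add: mult_ac)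
    finally show ?thesis using U(2)[OF that] by simp
  qed
  have o1: "(\<Sum>k<Suc m. V1 k p * cnj (V1 k q)) = (\<Sum>l<Suc m. V l p * cnj (V l q))" for p q
  proof -
    have "(\<Sum>k<Suc m. V1 k p * cnj (V1 k q)) =
      (\<Sum>k<Suc m. \<Sum>l<Suc m. \<Sum>l'<Suc m. (V l p * cnj (V l' q)) * (U k l * cnj (U k l')))"
      unfolding V1_def cnj_sum sum_product by (simp add: mult_ac)
    also have "\<dots> = (\<Sum>l<Suc m. \<Sum>k<Suc m. \<Sum>l'<Suc m. (V l p * cnj (V l' q)) * (U k l * cnj (U k l')))"
      by (rule sum.swap)
    also have "\<dots> = (\<Sum>l<Suc m. \<Sum>l'<Suc m. \<Sum>k<Suc m. (V l p * cnj (V l' q)) * (U k l * cnj (U k l')))"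
      by (rule sum.cong[OF refl], rule sum.swap)
    also have "\<dots> = (\<Sum>l<Suc m. \<Sum>l'<Suc m. (V l p * cnj (V l' q)) * (\<Sum>k<Suc m. U k l * cnj (U k l')))"
      by (simp only: sum_distrib_left)
    also have "\<dots> = (\<Sum>l<Suc m. \<Sum>l'<Suc m. if l = l' then V l p * cnj (V l' q) else 0)"
      using U(3) by (intro sum.cong refl) simp
    finally show ?thesis by (simp add: sum.delta del: sum.lessThan_Suc)
  qed
  obtain V' lam where V': "\<And>p q. (\<Sum>k<m. V1 (Suc k) p * cnj (V1 (Suc k) q)) = (\<Sum>k<m. V' k p * cnj (V' k q))"
    "\<And>k. k < m \<Longrightarrow> lam k \<ge> (0::real)"
    "\<And>k l. k < m \<Longrightarrow> l < m \<Longrightarrow> ?b (V' k) (V' l) = (if k = l then of_real (lam k) else 0)"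
    using Suc[of "\<lambda>k. V1 (Suc k)"] by blast
  \<comment> \<open>The sum of all these squared moduli depends only on the outer sum, so it equals
    the corresponding sum for the \<open>V1 (Suc k)\<close>, where every term is zero.\<close>
  have orth: "?b (V1 0) (V' k) = 0" if "k < m" for k
  proof -
    have "(\<Sum>k<m. ?b (V1 0) (V' k) * cnj (?b (V1 0) (V' k))) =
       (\<Sum>k<m. ?b (V1 0) (V1 (Suc k)) * cnj (?b (V1 0) (V1 (Suc k))))"
      by (rule bil_norm_from_outer) (simp add: V'(1))
    also have "\<dots> = 0"
      using b1 by (intro sum.neutral) (simp add: bsym[of "V1 0"])
    finally have "complex_of_real (\<Sum>k<m. (cmod (?b (V1 0) (V' k)))\<^sup>2) = 0"
      by (simp add: complex_norm_square del: of_real_power)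
    then have "(\<Sum>k<m. (cmod (?b (V1 0) (V' k)))\<^sup>2) = 0" by (simp only: of_real_eq_0_iff)
    then show ?thesis using that by (subst (asm) sum_nonneg_eq_0_iff) auto
  qed
  define V2 where "V2 k = (case k of 0 \<Rightarrow> V1 0 | Suc j \<Rightarrow> V' j)" for k
  define lam2 where "lam2 k = (case k of 0 \<Rightarrow> lam0 | Suc j \<Rightarrow> lam j)" for k
  have "(\<Sum>k<Suc m. V k p * cnj (V k q)) = (\<Sum>k<Suc m. V2 k p * cnj (V2 k q))" for p q
  proof -
    have "(\<Sum>k<Suc m. V k p * cnj (V k q)) = (\<Sum>k<Suc m. V1 k p * cnj (V1 k q))" by (rule o1[symmetric])
    then show ?thesis unfolding sum.lessThan_Suc_shift V2_def by (simp add: V'(1))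
  qed
  moreover have "lam2 k \<ge> 0" if "k < Suc m" for k
    using that x(1) V'(2) by (cases k) (auto simp: lam2_def)
  moreover have "?b (V2 k) (V2 l) = (if k = l then of_real (lam2 k) else 0)" if "k < Suc m" "l < Suc m" for k l
    using that b1[of 0] orth V'(3) bsym[of "V' _" "V1 0"]
    by (cases k; cases l) (auto simp: V2_def lam2_def)
  ultimately show ?case by blast
qed simp

section \<open>Wootters concurrence and witnesses\<close>

text \<open>The block matrix with rows (x, A) and (B, 1) has determinant det (x - AB). Interchanging
  both its block rows and its block columns, with total sign 1, turns this into det (x -
  BA).\<close>

lemma char_poly_mult_commute:
  fixes A B :: "'a :: idom mat"
  assumes A: "A \<in> carrier_mat n n" and B: "B \<in> carrier_mat n n"
  shows "char_poly (A * B) = char_poly (B * A)"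
proof -
  define l where "l = map_mat (\<lambda>a :: 'a. [:a:])"
  define x where "x = [:0, 1 :: 'a:] \<cdot>\<^sub>m 1\<^sub>m n"
  have lA: "l A \<in> carrier_mat n n" and lB: "l B \<in> carrier_mat n n" using A B by (auto simp: l_def)
  have x: "x \<in> carrier_mat n n" by (simp add: x_def)
  have "(\<Sum>i\<in>I. [:f i:]) = [:\<Sum>i\<in>I. f i:]" for f :: "nat \<Rightarrow> 'a" and I
    by (induct I rule: infinite_finite_induct) auto
  then have l: "x - l C * l D = char_poly_matrix (C * D)"
    if "C \<in> carrier_mat n n" "D \<in> carrier_mat n n" for C D
    using that unfolding char_poly_matrix_def x_def l_def
    by (intro eq_matI) (auto simp: scalar_prod_def mult.commute)
  let ?M = "four_block_mat x (l A) (l B) (1\<^sub>m n)"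
  let ?N = "four_block_mat (1\<^sub>m n) (l B) (l A) x"
  let ?P = "four_block_mat (0\<^sub>m n n) (1\<^sub>m n) (1\<^sub>m n) (0\<^sub>m n n :: 'a poly mat)"
  have M: "det ?M = char_poly (A * B)"
    unfolding char_poly_def l[OF A B, symmetric]
    by (subst det_four_block_mat[OF x lA lB]) (use lA lB x in auto)
  have N: "det ?N = char_poly (B * A)"
    unfolding char_poly_def l[OF B A, symmetric]
    by (subst det_four_block_mat[OF _ lB lA x]) (use lA lB x in \<open>auto simp: x_def\<close>)
  have Pc: "?P \<in> carrier_mat (n + n) (n + n)" and Mc: "?M \<in> carrier_mat (n + n) (n + n)"
    using x by auto
  have z: "0\<^sub>m n n \<in> carrier_mat n n" and e: "(1\<^sub>m n :: 'a poly mat) \<in> carrier_mat n n" by auto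
  have "?P * ?M = four_block_mat (l B) (1\<^sub>m n) x (l A)"
    unfolding mult_four_block_mat[OF z e e z x lA lB e] using lA lB x by simp
  then have "?P * ?M * ?P = ?N"
    using mult_four_block_mat[OF lB e x lA z e e z] lA lB x by simp
  moreover have "?P * ?P = 1\<^sub>m (n + n)"
    unfolding mult_four_block_mat[OF z e e z z e e z] by simp
  then have pp: "det ?P * det ?P = 1" using det_mult[OF Pc Pc] by simp
  ultimately have "det ?N = det ?P * det ?M * det ?P"
    using det_mult[OF mult_carrier_mat[OF Pc Mc] Pc] det_mult[OF Pc Mc] by (simp only:)
  also have "\<dots> = (det ?P * det ?P) * det ?M" by (simp only: mult_ac)
  finally have "det ?N = det ?M" unfolding pp by simp
  then show ?thesis unfolding M N ..
qed

lemma proots_linear_factors: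
  fixes as :: "'a :: idom list"
  shows "proots (\<Prod>a\<leftarrow>as. [:- a, 1:]) = mset as"
proof (induct as)
  case (Cons a as)
  have "(\<Prod>a\<leftarrow>as. [:- a, 1:]) \<noteq> 0" unfolding prod_list_zero_iff by auto
  then have "proots ([:- a, 1:] * (\<Prod>a\<leftarrow>as. [:- a, 1:])) = proots [:- a, 1:] + proots (\<Prod>a\<leftarrow>as. [:- a, 1:])"
    by (intro proots_mult) auto
  also have "proots [:- a, 1:] = {#a#}"
    by simp
  finally show ?case using Cons by simp
qed simp

lemma sigma_yy_sym: "p < 4 \<Longrightarrow> q < 4 \<Longrightarrow> sigma_yy $$ (p, q) = sigma_yy $$ (q, p)"
  by (auto simp: sigma_yy_def)

abbreviation ybil :: "(nat \<Rightarrow> complex) \<Rightarrow> (nat \<Rightarrow> complex) \<Rightarrow> complex" where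
  "ybil \<equiv> bil (\<lambda>p q. sigma_yy $$ (p, q)) {..<4}"

text \<open>With the vectors as columns of \<open>\<Psi>\<close>, the matrix \<open>R\<close> equals
  \<open>\<Psi> * Lam * (T * sigma_yy)\<close>. Moving \<open>T * sigma_yy\<close> to the front
  keeps the characteristic polynomial and gives \<open>Lam * Lam\<close>, so the Wootters numbers
  are the \<open>lam k\<close>. The index \<open>m\<close> is that of the head of the sorted
  list.\<close>

lemma wootters_takagi:
  fixes v :: "nat \<Rightarrow> nat \<Rightarrow> complex" and lam :: "nat \<Rightarrow> real"
  assumes K: "\<And>p q. p < 4 \<Longrightarrow> q < 4 \<Longrightarrow> K p q = (\<Sum>k<4. v k p * cnj (v k q))"
    and lam: "\<And>k. k < 4 \<Longrightarrow> lam k \<ge> 0"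
    and v: "\<And>k l. k < 4 \<Longrightarrow> l < 4 \<Longrightarrow> ybil (v k) (v l) = (if k = l then of_real (lam k) else 0)"
  obtains m where "m < 4" "wootters (mat 4 4 (\<lambda>(p, q). K p q)) = max 0 (2 * lam m - (\<Sum>k<4. lam k))"
proof -
  define \<Psi> where "\<Psi> = mat 4 4 (\<lambda>(p, k). v k p)"
  define T where "T = mat 4 4 (\<lambda>(k, p). v k p)"
  define Lam where "Lam = mat 4 4 (\<lambda>(k, l). if k = l then complex_of_real (lam k) else 0)"
  define D where "D = map_mat cnj T"
  define \<omega> where "\<omega> = mat 4 4 (\<lambda>(p, q). K p q)"
  have c: "\<Psi> \<in> carrier_mat 4 4" "T \<in> carrier_mat 4 4" "Lam \<in> carrier_mat 4 4" "D \<in> carrier_mat 4 4"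
    "sigma_yy \<in> carrier_mat 4 4" "map_mat cnj \<Psi> \<in> carrier_mat 4 4" "\<omega> \<in> carrier_mat 4 4"
    by (auto simp: \<Psi>_def T_def Lam_def D_def sigma_yy_def \<omega>_def)
  have \<omega>: "\<omega> = \<Psi> * D"
    by (rule eq_matI) (auto simp: \<omega>_def \<Psi>_def D_def T_def scalar_prod_def K atLeast0LessThan)
  have cj\<omega>: "map_mat cnj \<omega> = map_mat cnj \<Psi> * T"
    unfolding \<omega> by (rule eq_matI) (auto simp: \<Psi>_def D_def T_def scalar_prod_def)
  have TY: "T * sigma_yy * \<Psi> = Lam"
  proof (rule eq_matI)
    fix k l assume kl: "k < dim_row Lam" "l < dim_col Lam"
    then have kl: "k < 4" "l < 4" by (auto simp: Lam_def)
    have "(T * sigma_yy * \<Psi>) $$ (k, l) = (\<Sum>q<4. (\<Sum>p<4. v k p * sigma_yy $$ (p, q)) * v l q)"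
      using kl c by (simp add: scalar_prod_def T_def \<Psi>_def atLeast0LessThan)
    also have "\<dots> = ybil (v k) (v l)"
      unfolding bil_def sum_distrib_right by (rule sum.swap)
    finally show "(T * sigma_yy * \<Psi>) $$ (k, l) = Lam $$ (k, l)"
      using v[OF kl] kl by (simp add: Lam_def)
  qed (auto simp: Lam_def T_def \<Psi>_def)
  have DY: "D * sigma_yy * map_mat cnj \<Psi> = Lam"
  proof -
    have "map_mat cnj sigma_yy = sigma_yy" by (rule eq_matI) (auto simp: sigma_yy_def)
    moreover have "map_mat cnj (T * sigma_yy * \<Psi>) = map_mat cnj T * map_mat cnj sigma_yy * map_mat cnj \<Psi>"
      using c by (intro eq_matI) (auto simp: scalar_prod_def)
    moreover have "map_mat cnj Lam = Lam" by (rule eq_matI) (auto simp: Lam_def)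
    ultimately show ?thesis unfolding TY D_def by simp
  qed
  define R where "R = \<omega> * sigma_yy * map_mat cnj \<omega> * sigma_yy"
  have "R = (\<Psi> * (D * sigma_yy * map_mat cnj \<Psi>)) * (T * sigma_yy)"
    unfolding R_def cj\<omega> unfolding \<omega> using c by (simp add: assoc_mult_mat[where n\<^sub>1 = 4 and n\<^sub>2 = 4 and n\<^sub>3 = 4 and n\<^sub>4 = 4])
  then have "char_poly R = char_poly ((T * sigma_yy) * (\<Psi> * Lam))"
    unfolding DY using c by (simp add: char_poly_mult_commute[where n = 4])
  also have "(T * sigma_yy) * (\<Psi> * Lam) = (T * sigma_yy * \<Psi>) * Lam"
    using c by (simp add: assoc_mult_mat[where n\<^sub>1 = 4 and n\<^sub>2 = 4 and n\<^sub>3 = 4 and n\<^sub>4 = 4])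
  also have "\<dots> = mat 4 4 (\<lambda>(k, l). if k = l then complex_of_real ((lam k)\<^sup>2) else 0)" (is "_ = ?L2")
    unfolding TY
  proof (rule eq_matI)
    fix k l assume "k < dim_row ?L2" "l < dim_col ?L2"
    then have kl: "k < 4" "l < 4" by auto
    have "(Lam * Lam) $$ (k, l) = (\<Sum>q<4. Lam $$ (k, q) * Lam $$ (q, l))"
      using kl c by (simp add: scalar_prod_def atLeast0LessThan)
    also have "\<dots> = (\<Sum>q<4. if q = k then (if k = l then complex_of_real ((lam k)\<^sup>2) else 0) else 0)"
      using kl by (intro sum.cong refl) (auto simp: Lam_def power2_eq_square)
    also have "\<dots> = ?L2 $$ (k, l)" using kl by simp
    finally show "(Lam * Lam) $$ (k, l) = ?L2 $$ (k, l)" .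
  qed (auto simp: Lam_def)
  also have "char_poly ?L2 = (\<Prod>a\<leftarrow>diag_mat ?L2. [:- a, 1:])"
    by (rule char_poly_upper_triangular[of _ 4]) auto
  also have "diag_mat ?L2 = map (\<lambda>k. complex_of_real ((lam k)\<^sup>2)) [0..<4]"
    by (auto simp: diag_mat_def)
  finally have "proots (char_poly R) = mset (map (\<lambda>k. complex_of_real ((lam k)\<^sup>2)) [0..<4])"
    by (simp only: proots_linear_factors)
  then have "image_mset (\<lambda>r. sqrt (Re r)) (proots (char_poly R)) = mset (map (\<lambda>k. sqrt (Re (complex_of_real ((lam k)\<^sup>2)))) [0..<4])"
    by (simp only: mset_map[symmetric] map_map o_def)
  also have "map (\<lambda>k. sqrt (Re (complex_of_real ((lam k)\<^sup>2)))) [0..<4] = map lam [0..<4]"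
    by (intro map_cong refl) (use lam in auto)
  finally have im: "image_mset (\<lambda>r. sqrt (Re r)) (proots (char_poly R)) = mset (map lam [0..<4])" .
  define L where "L = rev (sorted_list_of_multiset (image_mset (\<lambda>r. sqrt (Re r)) (proots (char_poly R))))"
  have mL: "mset L = mset (map lam [0..<4])" unfolding L_def im by simp
  then have len: "length L = 4" by (metis length_map length_upt mset_eq_length diff_zero)
  then obtain a b c' d where L: "L = [a, b, c', d]"
    by (auto simp: numeral_eq_Suc length_Suc_conv)
  have "sum_list L = sum_list (map lam [0..<4])" using mL by (metis sum_mset_sum_list)
  then have s: "a + b + c' + d = (\<Sum>k<4. lam k)"
    unfolding L by (simp add: sum_list_sum_nth atLeast0LessThan[symmetric])
  have "set L = lam ` {..<4}" using mL by (metis set_mset_mset set_map set_upt atLeast0LessThan)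
  then obtain m where m: "m < 4" "a = lam m" unfolding L by auto
  have "wootters \<omega> = max 0 (L ! 0 - L ! 1 - L ! 2 - L ! 3)"
    unfolding wootters_def Let_def R_def[symmetric] L_def ..
  also have "\<dots> = max 0 (2 * a - (a + b + c' + d))" unfolding L by (simp add: numeral_eq_Suc algebra_simps)
  finally show ?thesis using m unfolding s \<omega>_def by (intro that[of m]) auto
qed

section \<open>Simultaneous conjugation of traceless matrices\<close>

lemma adjug_mult: "adjug (A * B) = adjug B * adjug A"
  by (auto intro!: m2_eqI simp: algebra_simps)

lemma adjug_adjug [simp]: "adjug (adjug A) = A"
  by (auto intro!: m2_eqI)

lemma traceless_triangularize:
  assumes "tr2 n = 0"
  obtains Q where "det2 Q = 1" "e21 (Q * n * adjug Q) = 0"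
proof (cases "e12 n = 0")
  case True
  show ?thesis
    by (rule that[of "adjug (M2 0 (-1) 1 0)"]) (simp_all add: True det2_def)
next
  case False
  define h b c where "h = e11 n" and "b = e12 n" and "c = e21 n"
  define \<kappa> where "\<kappa> = csqrt (h * h + b * c)"
  have k: "\<kappa> * \<kappa> = h * h + b * c" unfolding \<kappa>_def by (metis power2_csqrt power2_eq_square)
  have n: "n = M2 h b c (- h)"
    using assms by (auto intro!: m2_eqI simp: h_def b_def c_def tr2_def add_eq_0_iff)
  have b: "b \<noteq> 0" using False by (simp add: b_def)
  \<comment> \<open>The first column is an eigenvector of \<open>n\<close> for the eigenvalue
    \<open>\<kappa>\<close>, a square root of minus the determinant; the second column makes the
    determinant 1.\<close>
  define P where "P = M2 b 0 (\<kappa> - h) (1 / b)"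
  have "e21 (adjug P * n * P) = b * (h * h + b * c - \<kappa> * \<kappa>)"
    unfolding P_def n by (simp add: algebra_simps)
  then have "e21 (adjug P * n * adjug (adjug P)) = 0" unfolding k by simp
  moreover have "det2 (adjug P) = 1" using b by (simp add: det2_def P_def)
  ultimately show ?thesis by (intro that[of "adjug P"])
qed

text \<open>Pairwise trace-orthogonal traceless matrices behave like multiples of Pauli matrices, except that
  some may be nilpotent, which only happens in a common triangular form.\<close>
lemma orthogonal_normal_form:
  fixes n :: "'k \<Rightarrow> m2"
  assumes tr: "\<And>k. k \<in> K \<Longrightarrow> tr2 (n k) = 0"
    and orth: "\<And>k l. k \<in> K \<Longrightarrow> l \<in> K \<Longrightarrow> k \<noteq> l \<Longrightarrow> tr2 (n k * n l) = 0"
  obtains Q where "det2 Q = 1"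
    "\<And>k. k \<in> K \<Longrightarrow> e11 (Q * n k * adjug Q) = 0 \<or> e12 (Q * n k * adjug Q) = 0 \<and> e21 (Q * n k * adjug Q) = 0"
    "\<And>k l. k \<in> K \<Longrightarrow> l \<in> K \<Longrightarrow> k \<noteq> l \<Longrightarrow>
      e12 (Q * n k * adjug Q) * e21 (Q * n l * adjug Q) + e21 (Q * n k * adjug Q) * e12 (Q * n l * adjug Q) = 0"
proof -
  define m where "m Q k = Q * n k * adjug Q" for Q k
  have inv: "adjug Q * Q = 1" if "det2 Q = 1" for Q using that by (simp add: mult_adjug)
  have trm: "e22 (m Q k) = - e11 (m Q k)" if "det2 Q = 1" "k \<in> K" for Q k
  proof -
    have "tr2 (m Q k) = tr2 (adjug Q * (Q * n k))" unfolding m_def by (rule tr2_mult_commute)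
    also have "\<dots> = 0" using inv[OF that(1)] tr[OF that(2)] by (simp add: mult.assoc[symmetric])
    finally show ?thesis by (simp add: tr2_def add_eq_0_iff)
  qed
  have orthm: "2 * e11 (m Q k) * e11 (m Q l) + e12 (m Q k) * e21 (m Q l) + e21 (m Q k) * e12 (m Q l) = 0"
    if "det2 Q = 1" "k \<in> K" "l \<in> K" "k \<noteq> l" for Q k l
  proof -
    have "m Q k * m Q l = Q * n k * (adjug Q * Q) * n l * adjug Q" unfolding m_def by (simp add: mult.assoc)
    then have "tr2 (m Q k * m Q l) = tr2 (adjug Q * (Q * (n k * n l)))"
      unfolding inv[OF that(1)] by (simp add: mult.assoc tr2_mult_commute[of "adjug Q"])
    also have "\<dots> = 0" using inv[OF that(1)] orth[OF that(2-4)] by (simp add: mult.assoc[symmetric])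
    finally show ?thesis unfolding tr2_def using trm[OF that(1)] that by (simp add: algebra_simps)
  qed
  have detm: "det2 (m Q k) = det2 (n k)" if "det2 Q = 1" for Q k
    unfolding m_def by (simp add: det2_mult that)
  have det_h: "det2 (m Q k) = - (e11 (m Q k) * e11 (m Q k)) - e12 (m Q k) * e21 (m Q k)"
    if "det2 Q = 1" "k \<in> K" for Q k
    unfolding det2_def trm[OF that] by simp
  have "\<exists>Q. det2 Q = 1 \<and> (\<forall>k\<in>K. e11 (m Q k) = 0 \<or> e12 (m Q k) = 0 \<and> e21 (m Q k) = 0)"
  proof (cases "\<exists>k\<in>K. det2 (n k) \<noteq> 0")
    case True
    then obtain k where k: "k \<in> K" "det2 (n k) \<noteq> 0" by blast
    obtain Q1 where Q1: "det2 Q1 = 1" "e21 (m Q1 k) = 0"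
      using traceless_triangularize[OF tr[OF k(1)]] unfolding m_def by blast
    define \<kappa> where "\<kappa> = e11 (m Q1 k)"
    have \<kappa>: "\<kappa> \<noteq> 0" using k(2) detm[OF Q1(1), of k] det_h[OF Q1(1) k(1)] Q1(2) by (auto simp: \<kappa>_def)
    \<comment> \<open>The shear removes the remaining upper right entry. Trace orthogonality to the
      resulting diagonal matrix kills the diagonals of all others.\<close>
    define S where "S = M2 1 (e12 (m Q1 k) / (2 * \<kappa>)) 0 1"
    define Q where "Q = S * Q1"
    have Q: "det2 Q = 1" by (simp add: Q_def det2_mult Q1(1)) (simp add: S_def det2_def)
    have mQ: "m Q k = S * m Q1 k * adjug S"
      by (simp add: Q_def m_def adjug_mult mult.assoc)
    have d: "e12 (m Q k) = 0" "e21 (m Q k) = 0" "e11 (m Q k) = \<kappa>"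
      using \<kappa> Q1(2) trm[OF Q1(1) k(1)] unfolding mQ by (simp_all add: S_def \<kappa>_def field_simps)
    have "e11 (m Q l) = 0" if "l \<in> K" "l \<noteq> k" for l
      using orthm[OF Q k(1) that(1)] that(2) d \<kappa> by auto
    then show ?thesis using Q d by metis
  next
    case False
    show ?thesis
    proof (cases "\<exists>k\<in>K. n k \<noteq> 0")
      \<comment> \<open>All matrices are nilpotent. Once a nonzero one is strictly upper triangular,
        orthogonality removes the lower left entries of the others, and their vanishing determinants
        remove the diagonals.\<close>
      case True
      then obtain k where k: "k \<in> K" "n k \<noteq> 0" by blast
      obtain Q where Q: "det2 Q = 1" "e21 (m Q k) = 0"
        using traceless_triangularize[OF tr[OF k(1)]] unfolding m_def by blast
      have "e11 (m Q k) * e11 (m Q k) = 0"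
        using False k detm[OF Q(1), of k] det_h[OF Q(1) k(1)] Q(2) by auto
      then have h: "e11 (m Q k) = 0" by simp
      have "m Q k \<noteq> 0"
      proof
        assume "m Q k = 0"
        then have "adjug Q * m Q k * Q = 0" by simp
        moreover have "adjug Q * m Q k * Q = (adjug Q * Q) * n k * (adjug Q * Q)" unfolding m_def by (simp add: mult.assoc)
        ultimately show False using inv[OF Q(1)] k(2) by simp
      qed
      then have b: "e12 (m Q k) \<noteq> 0" using h Q(2) trm[OF Q(1) k(1)] by (auto intro: m2_eqI)
      have "e11 (m Q l) = 0" if "l \<in> K" "l \<noteq> k" for l
      proof -
        have "e21 (m Q l) = 0" using orthm[OF Q(1) k(1) that(1)] that(2) h Q(2) b by auto
        then have "e11 (m Q l) * e11 (m Q l) = 0"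
          using False that(1) detm[OF Q(1), of l] det_h[OF Q(1) that(1)] by auto
        then show ?thesis by simp
      qed
      then show ?thesis using Q h by metis
    next
      case False
      then have "\<forall>k\<in>K. m 1 k = 0" by (simp add: m_def)
      then show ?thesis by (intro exI[of _ 1]) simp
    qed
  qed
  then obtain Q where Q: "det2 Q = 1" "\<And>k. k \<in> K \<Longrightarrow> e11 (m Q k) = 0 \<or> e12 (m Q k) = 0 \<and> e21 (m Q k) = 0"
    by blast
  have "e12 (m Q k) * e21 (m Q l) + e21 (m Q k) * e12 (m Q l) = 0" if "k \<in> K" "l \<in> K" "k \<noteq> l" for k l
    using Q(2)[OF that(1)] Q(2)[OF that(2)] orthm[OF Q(1) that] by auto
  then show ?thesis using Q unfolding m_def by (intro that[of Q]) blast+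
qed

text \<open>If some product \<open>b k * c k\<close> is nonzero, the relations force one common
  ratio of moduli, and scaling by it attains equality in the AM-GM inequality for all indices at
  once. Otherwise one of the two families vanishes identically; the infimum is only approached by
  scaling the other one down, which is what \<open>\<epsilon>\<close> allows.\<close>

lemma balancing_scale:
  fixes b c :: "'k \<Rightarrow> complex"
  assumes K: "finite K" and e: "\<epsilon> > 0"
    and rel: "\<And>k l. k \<in> K \<Longrightarrow> l \<in> K \<Longrightarrow> k \<noteq> l \<Longrightarrow> b k * c l + c k * b l = 0"
  obtains y :: real where "y > 0"
    "\<And>k. k \<in> K \<Longrightarrow> y * (cmod (b k))\<^sup>2 + (cmod (c k))\<^sup>2 / y \<le> 2 * (cmod (b k) * cmod (c k)) + \<epsilon>"
proof (cases "\<exists>k\<in>K. b k * c k \<noteq> 0")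
  case True
  then obtain k where k: "k \<in> K" "b k \<noteq> 0" "c k \<noteq> 0" by auto
  define y where "y = cmod (c k) / cmod (b k)"
  have y: "y > 0" using k by (simp add: y_def)
  have "cmod (c l) = y * cmod (b l)" if "l \<in> K" for l
  proof (cases "l = k")
    case False
    then have "b k * c l = - (c k * b l)" using rel[OF k(1) that] by (simp add: add_eq_0_iff2)
    then have "cmod (b k) * cmod (c l) = cmod (c k) * cmod (b l)" by (metis norm_minus_cancel norm_mult)
    then show ?thesis using k by (simp add: y_def field_simps)
  qed (use k in \<open>simp add: y_def\<close>)
  then have "y * (cmod (b l))\<^sup>2 + (cmod (c l))\<^sup>2 / y = 2 * (cmod (b l) * cmod (c l))" if "l \<in> K" for l
    using that y by (simp add: power2_eq_square)
  then show ?thesis using y e by (intro that[of y]) auto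
next
  case False
  have small: "\<exists>y>0. \<forall>k\<in>K. y * (cmod (f k))\<^sup>2 \<le> \<epsilon>" for f :: "'k \<Rightarrow> complex"
  proof (intro exI conjI ballI)
    define B where "B = (\<Sum>k\<in>K. (cmod (f k))\<^sup>2)"
    have B: "B \<ge> 0" by (simp add: B_def sum_nonneg)
    then show "\<epsilon> / (1 + B) > 0" using e by simp
    fix k assume "k \<in> K"
    then have "(cmod (f k))\<^sup>2 \<le> B" unfolding B_def using K by (intro member_le_sum) auto
    then have "\<epsilon> * (cmod (f k))\<^sup>2 \<le> \<epsilon> * (1 + B)" using e by (intro mult_left_mono) linarith+
    then show "\<epsilon> / (1 + B) * (cmod (f k))\<^sup>2 \<le> \<epsilon>" using B by (simp add: field_simps)
  qed
  show ?thesis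
  proof (cases "\<exists>k\<in>K. b k \<noteq> 0")
    case True
    then obtain k where k: "k \<in> K" "b k \<noteq> 0" by blast
    have "c l = 0" if "l \<in> K" for l
      using rel[OF k(1) that] False k that by (cases "l = k") auto
    moreover obtain y where "y > 0" "\<And>k. k \<in> K \<Longrightarrow> y * (cmod (b k))\<^sup>2 \<le> \<epsilon>" using small[of b] by blast
    ultimately show ?thesis by (intro that[of y]) auto
  next
    case nb: False
    obtain y where y: "y > 0" "\<And>k. k \<in> K \<Longrightarrow> y * (cmod (c k))\<^sup>2 \<le> \<epsilon>" using small[of c] by blast
    show ?thesis
    proof (rule that[of "1 / y"])
      show "1 / y * (cmod (b k))\<^sup>2 + (cmod (c k))\<^sup>2 / (1 / y) \<le> 2 * (cmod (b k) * cmod (c k)) + \<epsilon>" if "k \<in> K" for k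
        using nb y(2)[OF that] that by (simp add: mult.commute)
    qed (use y in simp)
  qed
qed

definition frobenius_sq :: "m2 \<Rightarrow> real" where
  "frobenius_sq A = (cmod (e11 A))\<^sup>2 + (cmod (e12 A))\<^sup>2 + (cmod (e21 A))\<^sup>2 + (cmod (e22 A))\<^sup>2"

text \<open>The modulus \<open>2 * cmod (det2 (n k))\<close> is a lower bound on the whole
  conjugation orbit; the normal form followed by a diagonal scaling comes within
  \<open>\<epsilon>\<close> of it for all \<open>k\<close> simultaneously.\<close>

lemma near_minimal_conjugation:
  fixes n :: "'k \<Rightarrow> m2"
  assumes K: "finite K" and e: "\<epsilon> > 0"
    and tr: "\<And>k. k \<in> K \<Longrightarrow> tr2 (n k) = 0"
    and orth: "\<And>k l. k \<in> K \<Longrightarrow> l \<in> K \<Longrightarrow> k \<noteq> l \<Longrightarrow> tr2 (n k * n l) = 0"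
  obtains L where "det2 L = 1" "\<And>k. k \<in> K \<Longrightarrow> frobenius_sq (L * n k * adjug L) \<le> 2 * cmod (det2 (n k)) + \<epsilon>"
proof -
  obtain Q where Q: "det2 Q = 1"
    "\<And>k. k \<in> K \<Longrightarrow> e11 (Q * n k * adjug Q) = 0 \<or> e12 (Q * n k * adjug Q) = 0 \<and> e21 (Q * n k * adjug Q) = 0"
    "\<And>k l. k \<in> K \<Longrightarrow> l \<in> K \<Longrightarrow> k \<noteq> l \<Longrightarrow>
      e12 (Q * n k * adjug Q) * e21 (Q * n l * adjug Q) + e21 (Q * n k * adjug Q) * e12 (Q * n l * adjug Q) = 0"
    using orthogonal_normal_form[of K n, OF tr orth] by blast
  define m where "m k = Q * n k * adjug Q" for k
  obtain y :: real where y: "y > 0"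
    "\<And>k. k \<in> K \<Longrightarrow> y * (cmod (e12 (m k)))\<^sup>2 + (cmod (e21 (m k)))\<^sup>2 / y \<le> 2 * (cmod (e12 (m k)) * cmod (e21 (m k))) + \<epsilon>"
    using balancing_scale[of K \<epsilon> "\<lambda>k. e12 (m k)" "\<lambda>k. e21 (m k)", OF K e] Q(3) unfolding m_def by blast
  \<comment> \<open>Conjugation by \<open>D\<close> multiplies \<open>b\<close> by the square of
    \<open>l\<close> and divides \<open>c\<close> by it; squaring moduli gives the fourth power
    \<open>y\<close>.\<close>
  define l where "l = sqrt (sqrt y)"
  have l: "l > 0" "(l * l) * (l * l) = y" using y(1) by (simp_all add: l_def)
  define D where "D = M2 (of_real l) 0 0 (1 / of_real l)"
  have D: "det2 D = 1" using l by (simp add: D_def det2_def)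
  show ?thesis
  proof (rule that[of "D * Q"])
    show "det2 (D * Q) = 1" by (simp add: det2_mult D Q(1))
    fix k assume k: "k \<in> K"
    define h b c where "h = e11 (m k)" and "b = e12 (m k)" and "c = e21 (m k)"
    have "tr2 (m k) = tr2 (adjug Q * (Q * n k))" unfolding m_def by (rule tr2_mult_commute)
    also have "\<dots> = 0" using tr[OF k] mult_adjug(2)[of Q] Q(1) by (simp add: mult.assoc[symmetric])
    finally have m: "m k = M2 h b c (- h)"
      by (auto intro!: m2_eqI simp: h_def b_def c_def tr2_def add_eq_0_iff)
    have "det2 (m k) = det2 (n k)" unfolding m_def by (simp add: det2_mult Q(1))
    then have det: "det2 (n k) = - (h * h) - b * c" unfolding m by (simp add: det2_def)
    have "D * Q * n k * adjug (D * Q) = D * m k * adjug D" by (simp add: m_def adjug_mult mult.assoc)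
    also have "\<dots> = M2 h (of_real (l * l) * b) (c / of_real (l * l)) (- h)"
      using l(1) unfolding m D_def by (auto intro!: m2_eqI)
    finally have "frobenius_sq (D * Q * n k * adjug (D * Q)) = 2 * (cmod h)\<^sup>2 + (l * l * cmod b)\<^sup>2 + (cmod c / (l * l))\<^sup>2"
      using l(1) by (simp add: frobenius_sq_def norm_mult norm_divide del: of_real_mult)
    also have "\<dots> = 2 * (cmod h)\<^sup>2 + (y * (cmod b)\<^sup>2 + (cmod c)\<^sup>2 / y)"
      unfolding l(2)[symmetric] by (simp add: power2_eq_square mult_ac)
    also have "\<dots> \<le> 2 * (cmod h)\<^sup>2 + (2 * (cmod b * cmod c) + \<epsilon>)"
      using y(2)[OF k] by (simp add: b_def c_def)
    \<comment> \<open>In the normal form either \<open>h\<close> or both \<open>b\<close> and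
      \<open>c\<close> vanish, so no cancellation occurs in the determinant.\<close>
    also have "\<dots> = 2 * cmod (det2 (n k)) + \<epsilon>"
      using Q(2)[OF k] unfolding det m_def[symmetric] h_def[symmetric] b_def[symmetric] c_def[symmetric]
      by (auto simp: norm_mult power2_eq_square)
    finally show "frobenius_sq (D * Q * n k * adjug (D * Q)) \<le> 2 * cmod (det2 (n k)) + \<epsilon>" .
  qed
qed

section \<open>From Takagi vectors to witnesses\<close>

definition mat_entry :: "m2 \<Rightarrow> nat \<Rightarrow> nat \<Rightarrow> complex" where
  "mat_entry X a b = (if a = 0 then if b = 0 then e11 X else e12 X else if b = 0 then e21 X else e22 X)"

text \<open>The witness on a two-qubit operator; the index \<open>p = 2 a + b\<close> stands for \<open>|ab\<rangle>\<close> as in \<^const>\<open>two_qubit_red\<close>.\<close>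
definition witness_op :: "m2 \<Rightarrow> (nat \<Rightarrow> nat \<Rightarrow> complex) \<Rightarrow> real" where
  "witness_op X K = - Re (\<Sum>p<4. \<Sum>q<4. cnj (mat_entry X (p div 2) (q mod 2)) * mat_entry X (q div 2) (p mod 2) * K p q)"

definition vmat :: "(nat \<Rightarrow> complex) \<Rightarrow> m2" where
  "vmat v = M2 (v 0) (v 1) (v 2) (v 3)"

lemma sum_less_4: "(\<Sum>p<4. f p) = f 0 + f 1 + f 2 + (f (3::nat) :: 'a :: comm_monoid_add)"
  by (simp add: eval_nat_numeral)

lemma witness_op_rank_one: "witness_op X (\<lambda>p q. v p * cnj (v q)) = witness X (vmat v)"
  unfolding witness_op_def sum_less_4 witness_def vmat_def tr2_def mat_entry_def
  by (simp add: algebra_simps)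

lemma witness_op_cong:
  assumes "\<And>p q. p < 4 \<Longrightarrow> q < 4 \<Longrightarrow> K p q = K' p q"
  shows "witness_op X K = witness_op X K'"
  unfolding witness_op_def using assms by simp

lemma witness_op_sum: "witness_op X (\<lambda>p q. \<Sum>k\<in>I. K k p q) = (\<Sum>k\<in>I. witness_op X (K k))"
  unfolding witness_op_def sum_less_4 by (simp add: sum_distrib_left sum.distrib sum_negf sum_subtractf algebra_simps)

lemma witness_op_scale: "witness_op X (\<lambda>p q. of_real r * K p q) = r * witness_op X K"
  unfolding witness_op_def sum_less_4 by (simp add: algebra_simps)

text \<open>Takagi orthogonality becomes trace orthogonality against adjugates, and the diagonal
  value of a vector is minus twice the determinant of its matrix.\<close>

lemma ybil_vmat: "ybil v w = - tr2 (vmat v * adjug (vmat w))"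
  unfolding bil_def sum_less_4 sigma_yy_def vmat_def tr2_def by simp

text \<open>The determinant-1 matrix \<open>L\<^sup>* M\<^sup>T\<close> is chosen such that \<open>L V M\<close> is a multiple of \<open>J\<close>, the minimiser of
  \<open>Re tr (P P\<^sup>*)\<close>, and \<open>L (n V) M\<close> is that multiple of \<open>(L n L\<^sup>-\<^sup>1) J\<close>.\<close>
lemma witness_conjugated:
  assumes "det2 L = 1" "det2 V \<noteq> 0" "s * s = det2 V"
  defines "J \<equiv> M2 0 1 (-1) 0"
  defines "M \<equiv> adjug V * sc (1 / det2 V) * adjug L * J * sc s"
  shows "det2 (dg L * tp M) = 1"
    and "witness (dg L * tp M) V = 2 * cmod (det2 V)"
    and "tr2 n = 0 \<Longrightarrow> witness (dg L * tp M) (n * V) = - cmod (det2 V) * frobenius_sq (L * n * adjug L)"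
proof -
  have detJ: "det2 J = 1" by (simp add: J_def det2_def)
  have "det2 M = (s * s) / det2 V"
    unfolding M_def by (simp add: det2_mult detJ assms(1)) (simp add: power2_eq_square)
  then have "det2 M = 1" using assms(2,3) by simp
  then show "det2 (dg L * tp M) = 1" by (simp add: det2_mult assms(1))
  have L: "L * adjug L = 1" using assms(1) by (simp add: mult_adjug)
  have VM: "V * M = adjug L * J * sc s"
  proof -
    have "V * M = (V * adjug V * sc (1 / det2 V)) * adjug L * J * sc s" by (simp add: M_def mult.assoc)
    also have "V * adjug V * sc (1 / det2 V) = 1"
      using assms(2) by (auto simp: mult_adjug intro!: m2_eqI)
    finally show ?thesis by simp
  qed
  have w: "witness (dg L * tp M) A = - Re (tr2 ((L * A * M) * cj (L * A * M)))" for A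
  proof -
    have "dg (dg L * tp M) * A * tp (dg L * tp M) * cj A = cj M * (L * A * M * cj L * cj A)"
      by (simp add: dg_mult tp_mult mult.assoc)
    then have "tr2 (dg (dg L * tp M) * A * tp (dg L * tp M) * cj A) = tr2 ((L * A * M * cj L * cj A) * cj M)"
      by (simp add: tr2_mult_commute)
    then show ?thesis by (simp add: witness_def cj_mult mult.assoc)
  qed
  have ss: "s * cnj s = of_real (cmod (det2 V))"
    by (metis assms(3) complex_norm_square norm_mult power2_eq_square of_real_mult)
  show "witness (dg L * tp M) V = 2 * cmod (det2 V)"
  proof -
    have "L * V * M = J * sc s" using VM L by (metis mult.assoc mult_1)
    moreover have "tr2 ((J * sc s) * cj (J * sc s)) = - 2 * (s * cnj s)"
      by (simp add: J_def tr2_def)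
    ultimately show ?thesis unfolding w ss by simp
  qed
  assume tn: "tr2 n = 0"
  define m where "m = L * n * adjug L"
  have "tr2 m = tr2 (adjug L * (L * n))" unfolding m_def by (rule tr2_mult_commute)
  also have "\<dots> = 0" using tn assms(1) by (simp add: mult_adjug mult.assoc[symmetric])
  finally have m22: "e22 m = - e11 m" by (simp add: tr2_def add_eq_0_iff)
  have "L * (n * V) * M = m * J * sc s"
    using VM by (simp add: m_def mult.assoc)
  \<comment> \<open>Since \<open>m\<close> is traceless, \<open>m * J\<close> is symmetric, and the
    trace of its product with its conjugate is the Frobenius square.\<close>
  moreover have "tr2 ((m * J * sc s) * cj (m * J * sc s)) = (s * cnj s) * of_real (frobenius_sq m)"
    unfolding frobenius_sq_def of_real_add complex_norm_square by (simp add: J_def tr2_def m22 algebra_simps)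
  ultimately show "witness (dg L * tp M) (n * V) = - cmod (det2 V) * frobenius_sq (L * n * adjug L)"
    unfolding w ss m_def[symmetric] by simp
qed

text \<open>The dominant Takagi vector contributes \<open>lam r\<close> to the witness, each of the
  other three at least \<open>- lam k - \<epsilon> / 3\<close>; the total is the Wootters expression
  up to \<open>\<epsilon>\<close>.\<close>

theorem wootters_le_witness:
  assumes psd: "psd_on {..<4} K" and e: "\<epsilon> > 0"
  obtains X where "det2 X = 1" "wootters (mat 4 4 (\<lambda>(p, q). K p q)) \<le> max 0 (witness_op X K) + \<epsilon>"
proof -
  obtain \<phi> :: "nat \<Rightarrow> nat \<Rightarrow> complex" where \<phi>: "\<And>p q. p < 4 \<Longrightarrow> q < 4 \<Longrightarrow> K p q = (\<Sum>k<4. \<phi> k p * cnj (\<phi> k q))"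
    using psd_on_factor[OF _ psd] by auto
  have sym4: "sigma_yy $$ (p, q) = sigma_yy $$ (q, p)" if "p \<in> {..<4}" "q \<in> {..<4}" for p q
    using that by (intro sigma_yy_sym) auto
  obtain v and lam :: "nat \<Rightarrow> real" where v: "\<And>p q. (\<Sum>k<4. \<phi> k p * cnj (\<phi> k q)) = (\<Sum>k<4. v k p * cnj (v k q))"
    and lam: "\<And>k. k < 4 \<Longrightarrow> lam k \<ge> 0"
    and b: "\<And>k l. k < 4 \<Longrightarrow> l < 4 \<Longrightarrow> ybil (v k) (v l) = (if k = l then of_real (lam k) else 0)"
    using takagi_vectors[where P = "{..<4}" and Y = "\<lambda>p q. sigma_yy $$ (p, q)" and m = 4 and V = \<phi>, OF sym4]
    by blast
  have Kv: "K p q = (\<Sum>k<4. v k p * cnj (v k q))" if "p < 4" "q < 4" for p q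
    using \<phi>[OF that] v by simp
  obtain r where r: "r < 4" "wootters (mat 4 4 (\<lambda>(p, q). K p q)) = max 0 (2 * lam r - (\<Sum>k<4. lam k))"
    using wootters_takagi[OF Kv lam b] by blast
  show ?thesis
  proof (cases "2 * lam r - (\<Sum>k<4. lam k) \<le> 0")
    case True
    then show ?thesis using r(2) e by (intro that[of 1]) auto
  next
    case False
    have "lam r \<le> (\<Sum>k<4. lam k)" using r(1) lam by (intro member_le_sum) auto
    then have lr: "lam r > 0" using False by linarith
    define V where "V k = vmat (v k)" for k
    have bV: "tr2 (V k * adjug (V l)) = (if k = l then - of_real (lam k) else 0)" if "k < 4" "l < 4" for k l
      using b[OF that] unfolding ybil_vmat V_def by (auto simp: minus_equation_iff)
    have detV: "2 * det2 (V k) = - of_real (lam k)" if "k < 4" for k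
    proof -
      have "tr2 (V k * adjug (V k)) = 2 * det2 (V k)" by (simp add: mult_adjug tr2_def)
      then show ?thesis using bV[OF that that] by simp
    qed
    have cdV: "cmod (det2 (V k)) = lam k / 2" if "k < 4" for k
    proof -
      have "2 * cmod (det2 (V k)) = cmod (2 * det2 (V k))" by (simp add: norm_mult)
      also have "\<dots> = lam k" unfolding detV[OF that] using lam[OF that] by simp
      finally show ?thesis by simp
    qed
    have d0: "det2 (V r) \<noteq> 0" using cdV[OF r(1)] lr by auto
    \<comment> \<open>Division by the dominant vector: orthogonality to it makes \<open>n k\<close>
      traceless, and orthogonality of the others among themselves becomes trace orthogonality of the
      \<open>n k\<close>.\<close>
    define n where "n k = V k * adjug (V r) * sc (1 / det2 (V r))" for k
    have sc_comm: "sc c * A = A * sc c" for c A by (auto intro!: m2_eqI)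
    have inv: "adjug (V r) * sc (1 / det2 (V r)) * V r = 1"
    proof -
      have "adjug (V r) * sc (1 / det2 (V r)) * V r = adjug (V r) * V r * sc (1 / det2 (V r))"
        by (simp add: mult.assoc sc_comm)
      then show ?thesis using d0 by (auto simp: mult_adjug intro!: m2_eqI)
    qed
    have nV: "n k * V r = V k" for k
      unfolding n_def using inv by (simp add: mult.assoc)
    define I where "I = {..<4} - {r}"
    have I: "finite I" "\<And>k. k \<in> I \<Longrightarrow> k < 4 \<and> k \<noteq> r" "{..<4} = insert r I" "r \<notin> I"
      using r(1) by (auto simp: I_def)
    have tr: "tr2 (n k) = 0" if "k \<in> I" for k
    proof -
      have "tr2 (A * sc c) = tr2 A * c" for A c by (simp add: tr2_def algebra_simps)
      then show ?thesis unfolding n_def using bV[of k r] I(2)[OF that] r(1) by simp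
    qed
    have orth: "tr2 (n k * n l) = 0" if "k \<in> I" "l \<in> I" "k \<noteq> l" for k l
    proof -
      have "adjug (n l) = - n l"
        using tr[OF that(2)] by (auto intro!: m2_eqI simp: tr2_def uminus_m2_def add_eq_0_iff)
      moreover have "V k * adjug (V l) = n k * (V r * adjug (V r)) * adjug (n l)"
        unfolding nV[symmetric, of k] nV[symmetric, of l] adjug_mult by (simp add: mult.assoc)
      ultimately have "tr2 (V k * adjug (V l)) = - det2 (V r) * tr2 (n k * n l)"
        by (simp add: mult_adjug tr2_def uminus_m2_def algebra_simps)
      then show ?thesis using bV[of k l] I(2)[OF that(1)] I(2)[OF that(2)] that(3) d0 by simp
    qed
    \<comment> \<open>Chosen so that the factor \<open>lam r / 2\<close> turns it into an error
      \<open>\<epsilon> / 3\<close> for each of the three remaining vectors.\<close>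
    define \<epsilon>' where "\<epsilon>' = 2 * \<epsilon> / (3 * lam r)"
    have e': "\<epsilon>' > 0" using e lr by (simp add: \<epsilon>'_def)
    obtain L where L: "det2 L = 1" "\<And>k. k \<in> I \<Longrightarrow> frobenius_sq (L * n k * adjug L) \<le> 2 * cmod (det2 (n k)) + \<epsilon>'"
      using near_minimal_conjugation[of I \<epsilon>' n, OF I(1) e' tr orth] by blast
    define s where "s = csqrt (det2 (V r))"
    have s: "s * s = det2 (V r)" unfolding s_def by (metis power2_csqrt power2_eq_square)
    define X where "X = dg L * tp (adjug (V r) * sc (1 / det2 (V r)) * adjug L * M2 0 1 (-1) 0 * sc s)"
    note wc = witness_conjugated[OF L(1) d0 s, folded X_def]
    have "witness_op X K = (\<Sum>k<4. witness X (V k))"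
      unfolding V_def witness_op_rank_one[symmetric] witness_op_sum[symmetric] by (rule witness_op_cong) (rule Kv)
    also have "\<dots> = witness X (V r) + (\<Sum>k\<in>I. witness X (V k))"
      using I by simp
    also have "witness X (V r) = lam r" using wc(2) cdV[OF r(1)] by simp
    finally have "witness_op X K = lam r + (\<Sum>k\<in>I. witness X (V k))" .
    moreover have "(\<Sum>k\<in>I. witness X (V k)) \<ge> (\<Sum>k\<in>I. - lam k - \<epsilon> / 3)"
    proof (rule sum_mono)
      fix k assume k: "k \<in> I"
      have "det2 (n k) * det2 (V r) = det2 (V k)" unfolding nV[symmetric, of k] det2_mult ..
      then have "cmod (det2 (n k)) * (lam r / 2) = lam k / 2"
        using cdV[of k] cdV[OF r(1)] I(2)[OF k] by (metis norm_mult)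
      then have dn: "cmod (det2 (n k)) = lam k / lam r" using lr by (simp add: field_simps)
      have "witness X (V k) = - (lam r / 2) * frobenius_sq (L * n k * adjug L)"
        using wc(3)[OF tr[OF k]] unfolding nV cdV[OF r(1)] .
      also have "\<dots> \<ge> - (lam r / 2) * (2 * (lam k / lam r) + \<epsilon>')"
        using L(2)[OF k] lr unfolding dn by (intro mult_left_mono_neg) auto
      also have "- (lam r / 2) * (2 * (lam k / lam r) + \<epsilon>') = - lam k - \<epsilon> / 3"
        using lr by (simp add: \<epsilon>'_def field_simps)
      finally show "- lam k - \<epsilon> / 3 \<le> witness X (V k)" .
    qed
    moreover have "lam r + (\<Sum>k\<in>I. - lam k - \<epsilon> / 3) = 2 * lam r - (\<Sum>k<4. lam k) - \<epsilon>"
    proof -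
      have "card I = 3" unfolding I_def using r(1) by simp
      moreover have "(\<Sum>k<4. lam k) = lam r + (\<Sum>k\<in>I. lam k)" using I by simp
      ultimately show ?thesis by (simp add: sum_subtractf sum_negf)
    qed
    ultimately have "2 * lam r - (\<Sum>k<4. lam k) - \<epsilon> \<le> witness_op X K" by linarith
    then show ?thesis using r(2) wc(1) False by (intro that[of X]) auto
  qed
qed

section \<open>Ensembles\<close>

lemma psd_on_outer_sum:
  "psd_on X (\<lambda>p q. \<Sum>k\<in>I. of_real (r k) * (v k p * cnj (v k q)))" if "\<And>k. k \<in> I \<Longrightarrow> r k \<ge> 0"
proof -
  have q: "(\<Sum>x\<in>X. \<Sum>y\<in>X. cnj (u x) * (\<Sum>k\<in>I. of_real (r k) * (v k x * cnj (v k y))) * u y)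
    = of_real (\<Sum>k\<in>I. r k * (cmod (\<Sum>x\<in>X. cnj (u x) * v k x))\<^sup>2)" (is "?L = _") for u
  proof -
    have "?L = (\<Sum>x\<in>X. \<Sum>y\<in>X. \<Sum>k\<in>I. of_real (r k) * ((cnj (u x) * v k x) * cnj (cnj (u y) * v k y)))"
      by (intro sum.cong refl) (simp add: sum_distrib_left sum_distrib_right mult_ac)
    also have "\<dots> = (\<Sum>x\<in>X. \<Sum>k\<in>I. \<Sum>y\<in>X. of_real (r k) * ((cnj (u x) * v k x) * cnj (cnj (u y) * v k y)))"
      by (rule sum.cong[OF refl], rule sum.swap)
    also have "\<dots> = (\<Sum>k\<in>I. \<Sum>x\<in>X. \<Sum>y\<in>X. of_real (r k) * ((cnj (u x) * v k x) * cnj (cnj (u y) * v k y)))"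
      by (rule sum.swap)
    also have "\<dots> = (\<Sum>k\<in>I. of_real (r k) * ((\<Sum>x\<in>X. cnj (u x) * v k x) * cnj (\<Sum>y\<in>X. cnj (u y) * v k y)))"
      unfolding cnj_sum sum_product by (simp only: sum_distrib_left)
    also have "\<dots> = of_real (\<Sum>k\<in>I. r k * (cmod (\<Sum>x\<in>X. cnj (u x) * v k x))\<^sup>2)"
      unfolding of_real_sum of_real_mult complex_norm_square ..
    finally show ?thesis .
  qed
  show ?thesis
    by (rule psd_onI) (unfold q Re_complex_of_real Im_complex_of_real, use that in \<open>auto intro!: sum_nonneg\<close>)
qed

lemma emb_qconfigs:
  assumes "S \<in> substate_choices N d" "x \<in> qconfigs {..<N}"
  shows "emb N S x \<in> configs d {..<N}"
  using bij_betw_apply[OF bij_betw_emb[OF assms(1)] assms(2)] by simp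

definition pair_red :: "nat \<Rightarrow> qop \<Rightarrow> nat \<Rightarrow> nat \<Rightarrow> nat \<Rightarrow> nat \<Rightarrow> complex" where
  "pair_red N \<tau> i j p q = (\<Sum>z\<in>qconfigs ({..<N} - {i, j}).
     \<tau> (z(i := p div 2, j := p mod 2)) (z(i := q div 2, j := q mod 2)))"

lemma two_qubit_red_eq:
  assumes "i \<noteq> j"
  shows "two_qubit_red N \<tau> i j = mat 4 4 (\<lambda>(p, q). pair_red N \<tau> i j p q)"
proof -
  have "merge {i, j} (\<lambda>k. if k = i then q div 2 else if k = j then q mod 2 else 0) z
      = z(i := q div 2, j := q mod 2)" for q z
    using assms by (auto simp: merge_def)
  then show ?thesis unfolding two_qubit_red_def Let_def ptrace_def pair_red_def by simp
qed

definition ensemble :: "nat \<Rightarrow> (nat \<Rightarrow> nat) \<Rightarrow> qop \<Rightarrow> nat \<Rightarrow> (nat \<Rightarrow> real) \<Rightarrow> (nat \<Rightarrow> (nat \<Rightarrow> nat) \<Rightarrow> complex) \<Rightarrow> bool" where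
  "ensemble N d \<rho> n p \<phi> \<longleftrightarrow> (\<forall>k<n. p k \<ge> 0) \<and> (\<Sum>k<n. p k) = 1 \<and> (\<forall>k<n. normalized_vec N d (\<phi> k)) \<and>
       (\<forall>x\<in>configs d {..<N}. \<forall>y\<in>configs d {..<N}.
            \<rho> x y = (\<Sum>k<n. complex_of_real (p k) * proj (\<phi> k) x y))"

lemma pair_witness_vmat: "pair_witness U X i j \<psi> = (\<Sum>z\<in>qconfigs (U - {i, j}). witness X (vmat (\<lambda>p. \<psi> (z(i := p div 2, j := p mod 2)))))"
  unfolding pair_witness_def vmat_def by (simp add: numeral_3_eq_3)

text \<open>Each ensemble member together with each configuration of the traced-out qubits
  contributes a weighted rank-one operator.\<close>

lemma pair_red_ensemble:
  assumes E: "ensemble N d \<rho> n p \<phi>" and S: "S \<in> substate_choices N d" and ij: "i < N" "j < N" "i \<noteq> j"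
  shows "psd_on {..<4} (pair_red N (substate N S \<rho>) i j)"
    and "witness_op X (pair_red N (substate N S \<rho>) i j) = (\<Sum>k<n. p k * pair_witness {..<N} X i j (\<phi> k \<circ> emb N S))"
proof -
  let ?Z = "qconfigs ({..<N} - {i, j})"
  define v where "v k z q = (\<phi> k \<circ> emb N S) (z(i := q div 2, j := q mod 2))" for k z and q :: nat
  have K: "pair_red N (substate N S \<rho>) i j a b =
      (\<Sum>z\<in>?Z. \<Sum>k<n. of_real (p k) * (v k z a * cnj (v k z b)))" if "a < 4" "b < 4" for a b
    unfolding pair_red_def
  proof (rule sum.cong[OF refl])
    fix z assume z: "z \<in> ?Z"
    have "z(i := q div 2, j := q mod 2) \<in> qconfigs {..<N}" if "q < 4" for q
      using z ij that by (auto simp: configs_def)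
    then show "substate N S \<rho> (z(i := a div 2, j := a mod 2)) (z(i := b div 2, j := b mod 2)) =
      (\<Sum>k<n. of_real (p k) * (v k z a * cnj (v k z b)))"
      using E emb_qconfigs[OF S] that unfolding ensemble_def substate_def v_def proj_def by simp
  qed
  have "psd_on {..<4} (\<lambda>a b. \<Sum>zk\<in>?Z \<times> {..<n}. of_real (p (snd zk)) * (v (snd zk) (fst zk) a * cnj (v (snd zk) (fst zk) b)))"
    using E by (intro psd_on_outer_sum) (auto simp: ensemble_def)
  then have "psd_on {..<4} (\<lambda>a b. \<Sum>z\<in>?Z. \<Sum>k<n. of_real (p k) * (v k z a * cnj (v k z b)))"
    by (simp add: sum.cartesian_product case_prod_unfold)
  then show "psd_on {..<4} (pair_red N (substate N S \<rho>) i j)"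
    unfolding psd_on_def using K by simp
  have "witness_op X (pair_red N (substate N S \<rho>) i j) =
     witness_op X (\<lambda>a b. \<Sum>z\<in>?Z. \<Sum>k<n. of_real (p k) * (v k z a * cnj (v k z b)))"
    by (rule witness_op_cong) (rule K)
  also have "\<dots> = (\<Sum>z\<in>?Z. \<Sum>k<n. p k * witness X (vmat (v k z)))"
    by (simp only: witness_op_sum witness_op_scale witness_op_rank_one)
  also have "\<dots> = (\<Sum>k<n. p k * pair_witness {..<N} X i j (\<phi> k \<circ> emb N S))"
    unfolding pair_witness_vmat v_def sum_distrib_left by (rule sum.swap)
  finally show "witness_op X (pair_red N (substate N S \<rho>) i j) = (\<Sum>k<n. p k * pair_witness {..<N} X i j (\<phi> k \<circ> emb N S))" .
qed

lemma wootters_nonneg: "wootters \<omega> \<ge> 0"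
  unfolding wootters_def Let_def by simp

lemma L2_set_sum_le:
  assumes "\<And>k. k \<in> I \<Longrightarrow> p k \<ge> 0"
  shows "L2_set (\<lambda>x. \<Sum>k\<in>I. p k * f k x) T \<le> (\<Sum>k\<in>I. p k * L2_set (f k) T)"
  using assms
proof (induct I rule: infinite_finite_induct)
  case (insert k I)
  have "L2_set (\<lambda>x. \<Sum>k\<in>insert k I. p k * f k x) T = L2_set (\<lambda>x. p k * f k x + (\<Sum>k\<in>I. p k * f k x)) T"
    using insert.hyps by simp
  also have "\<dots> \<le> L2_set (\<lambda>x. p k * f k x) T + L2_set (\<lambda>x. \<Sum>k\<in>I. p k * f k x) T"
    by (rule L2_set_triangle_ineq)
  also have "L2_set (\<lambda>x. p k * f k x) T = p k * L2_set (f k) T"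
    using insert.prems by (intro L2_set_right_distrib[symmetric]) auto
  finally show ?case using insert by fastforce
qed (auto simp: L2_set_def)

definition pair_index :: "nat \<Rightarrow> (nat \<Rightarrow> nat) \<Rightarrow> ((nat \<Rightarrow> nat set) \<times> nat \<times> nat) set" where
  "pair_index N d = (SIGMA S:substate_choices N d. SIGMA i:{..<N}. {i<..<N})"

lemma sum_pair_index:
  "(\<Sum>S\<in>substate_choices N d. \<Sum>i<N. \<Sum>j\<in>{i<..<N}. f S i j) =
    (\<Sum>(S, i, j)\<in>pair_index N d. f S i j)"
  unfolding pair_index_def
  by (simp add: sum.Sigma finite_substate_choices)

lemma finite_pair_index: "finite (pair_index N d)"
  unfolding pair_index_def by (intro finite_SigmaI finite_substate_choices) auto

lemma ensemble_bound:
  assumes N: "N \<ge> 5" and d: "\<forall>i<N. d i \<ge> 2" and E: "ensemble N d \<rho> n p \<phi>"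
  shows "sqrt (real N / (2 ^ (N - 2) * (\<Prod>i<N. real (d i) - 1)) *
           (\<Sum>S\<in>substate_choices N d. \<Sum>i<N. \<Sum>j\<in>{i<..<N}. (Cij N (substate N S \<rho>) i j)\<^sup>2))
     \<le> (\<Sum>k<n. p k * CN_pure N d (\<phi> k))"
proof -
  define c where "c = real N / (2 ^ (N - 2) * (\<Prod>i<N. real (d i) - 1))"
  define T where "T = pair_index N d"
  define C where "C = (\<lambda>(S, i, j). Cij N (substate N S \<rho>) i j)"
  have c: "c > 0" unfolding c_def using N d by (intro divide_pos_pos mult_pos_pos prod_pos) force+
  have T: "finite T" unfolding T_def by (rule finite_pair_index)
  have p: "p k \<ge> 0" if "k < n" for k using E that by (simp add: ensemble_def)
  have approx: "sqrt c * L2_set C T \<le> (\<Sum>k<n. p k * CN_pure N d (\<phi> k)) + \<epsilon> * (sqrt c * sqrt (card T))"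
    if e: "\<epsilon> > 0" for \<epsilon>
  proof -
    have "\<exists>X. det2 X = 1 \<and> ((S, i, j) \<in> T \<longrightarrow>
       Cij N (substate N S \<rho>) i j \<le> max 0 (witness_op X (pair_red N (substate N S \<rho>) i j)) + \<epsilon>)" for S i j
    proof (cases "(S, i, j) \<in> T")
      case True
      then have S: "S \<in> substate_choices N d" and ij: "i < N" "j < N" "i \<noteq> j"
        by (auto simp: T_def pair_index_def)
      obtain X where "det2 X = 1" "wootters (mat 4 4 (\<lambda>(p, q). pair_red N (substate N S \<rho>) i j p q))
          \<le> max 0 (witness_op X (pair_red N (substate N S \<rho>) i j)) + \<epsilon>"
        using wootters_le_witness[OF pair_red_ensemble(1)[OF E S ij] e] by blast
      then show ?thesis unfolding Cij_def two_qubit_red_eq[OF ij(3)] by blast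
    qed (use det2_one in blast)
    \<comment> \<open>These witnesses are fitted to \<open>\<rho>\<close> and shared by all ensemble
      members, which makes the next bound linear in the weights \<open>p k\<close>.\<close>
    then obtain Y where Y: "\<And>S i j. det2 (Y S i j) = 1"
      "\<And>S i j. (S, i, j) \<in> T \<Longrightarrow>
         Cij N (substate N S \<rho>) i j \<le> max 0 (witness_op (Y S i j) (pair_red N (substate N S \<rho>) i j)) + \<epsilon>"
      by metis
    define w where "w k = (\<lambda>(S, i, j). max 0 (pair_witness {..<N} (Y S i j) i j (\<phi> k \<circ> emb N S)))" for k
    have "L2_set C T \<le> L2_set (\<lambda>x. (\<Sum>k<n. p k * w k x) + \<epsilon>) T"
    proof (rule L2_set_mono)
      fix x assume x: "x \<in> T"
      obtain S i j where [simp]: "x = (S, i, j)" by (cases x) auto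
      have S: "S \<in> substate_choices N d" and ij: "i < N" "j < N" "i \<noteq> j"
        using x by (auto simp: T_def pair_index_def)
      have "witness_op (Y S i j) (pair_red N (substate N S \<rho>) i j) \<le> (\<Sum>k<n. p k * w k x)"
        unfolding pair_red_ensemble(2)[OF E S ij] using p
        by (intro sum_mono mult_left_mono) (auto simp: w_def)
      moreover have "0 \<le> (\<Sum>k<n. p k * w k x)"
        using p by (intro sum_nonneg mult_nonneg_nonneg) (auto simp: w_def)
      ultimately show "C x \<le> (\<Sum>k<n. p k * w k x) + \<epsilon>"
        using Y(2)[of S i j] x by (simp add: C_def)
    qed (auto simp: C_def Cij_def wootters_nonneg)
    also have "\<dots> \<le> L2_set (\<lambda>x. \<Sum>k<n. p k * w k x) T + L2_set (\<lambda>x. \<epsilon>) T"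
      by (rule L2_set_triangle_ineq)
    also have "L2_set (\<lambda>x. \<epsilon>) T = \<epsilon> * sqrt (card T)"
      using e by (simp add: L2_set_def real_sqrt_mult)
    also have "L2_set (\<lambda>x. \<Sum>k<n. p k * w k x) T \<le> (\<Sum>k<n. p k * L2_set (w k) T)"
      using p by (intro L2_set_sum_le) auto
    finally have "sqrt c * L2_set C T \<le> sqrt c * ((\<Sum>k<n. p k * L2_set (w k) T) + \<epsilon> * sqrt (card T))"
      using c by (intro mult_left_mono) auto
    also have "\<dots> = (\<Sum>k<n. p k * (sqrt c * L2_set (w k) T)) + \<epsilon> * (sqrt c * sqrt (card T))"
      by (simp add: sum_distrib_left algebra_simps)
    also have "(\<Sum>k<n. p k * (sqrt c * L2_set (w k) T)) \<le> (\<Sum>k<n. p k * CN_pure N d (\<phi> k))"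
    proof (intro sum_mono mult_left_mono)
      fix k assume "k \<in> {..<n}"
      have "c * (\<Sum>x\<in>T. (w k x)\<^sup>2) \<le> (CN_pure N d (\<phi> k))\<^sup>2"
        using pure_substate_bound[OF N d, of Y "\<phi> k"] Y(1)
        unfolding c_def[symmetric] sum_pair_index T_def[symmetric] w_def by (simp add: case_prod_unfold)
      then have "sqrt (c * (\<Sum>x\<in>T. (w k x)\<^sup>2)) \<le> CN_pure N d (\<phi> k)"
        using CN_pure_sq(2)[of N d "\<phi> k"] N by (intro real_le_lsqrt) (auto intro!: mult_nonneg_nonneg sum_nonneg simp: c less_imp_le)
      then show "sqrt c * L2_set (w k) T \<le> CN_pure N d (\<phi> k)"
        unfolding L2_set_def real_sqrt_mult .
    qed (use p in auto)
    finally show ?thesis by simp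
  qed
  have "sqrt c * L2_set C T \<le> (\<Sum>k<n. p k * CN_pure N d (\<phi> k))"
  proof (rule field_le_epsilon)
    fix \<delta> :: real assume \<delta>: "\<delta> > 0"
    \<comment> \<open>Division by \<open>M + 1\<close> also covers the case
      \<open>M = 0\<close>.\<close>
    define M where "M = sqrt c * sqrt (card T)"
    have M: "M \<ge> 0" using c by (simp add: M_def)
    have "sqrt c * L2_set C T \<le> (\<Sum>k<n. p k * CN_pure N d (\<phi> k)) + \<delta> / (M + 1) * M"
      unfolding M_def by (rule approx) (use \<delta> M in \<open>simp add: M_def\<close>)
    also have "\<delta> / (M + 1) * M \<le> \<delta>" using \<delta> M by (simp add: field_simps)
    finally show "sqrt c * L2_set C T \<le> (\<Sum>k<n. p k * CN_pure N d (\<phi> k)) + \<delta>" by simp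
  qed
  then show ?thesis
    unfolding c_def[symmetric] sum_pair_index T_def[symmetric] real_sqrt_mult L2_set_def C_def
    by (simp add: case_prod_unfold)
qed

text \<open>Nonemptiness is what allows a lower bound on all ensembles to pass to their
  infimum.\<close>

lemma ensemble_exists:
  assumes d: "\<forall>i<N. d i \<ge> 2" and \<rho>: "density_op N d \<rho>"
  shows "\<exists>n p \<phi>. ensemble N d \<rho> n p \<phi>"
proof -
  let ?C = "configs d {..<N}"
  have fin: "finite ?C" by simp
  have "psd_on ?C \<rho>" using \<rho> unfolding density_op_def psd_on_def by blast
  then obtain \<phi> where \<phi>: "\<And>x y. x \<in> ?C \<Longrightarrow> y \<in> ?C \<Longrightarrow> \<rho> x y = (\<Sum>k<card ?C. \<phi> k x * cnj (\<phi> k y))"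
    using psd_on_factor[OF fin] by blast
  define p where "p k = mass d {..<N} (\<phi> k)" for k
  define \<delta> :: "(nat \<Rightarrow> nat) \<Rightarrow> complex" where "\<delta> x = (if x = (\<lambda>_. 0) then 1 else 0)" for x
  \<comment> \<open>Every ensemble member must be normalised, so a vector of weight zero is replaced
    by a basis vector.\<close>
  define \<phi>' where "\<phi>' k = (if p k = 0 then \<delta> else (\<lambda>x. \<phi> k x / of_real (sqrt (p k))))" for k
  have p0: "p k \<ge> 0" for k by (simp add: p_def mass_def sum_nonneg)
  have nv: "normalized_vec N d (\<phi>' k)" for k
  proof (cases "p k = 0")
    case True
    have "(\<lambda>_. 0) \<in> ?C" using d by (force simp: configs_def)
    then have "(\<Sum>x\<in>?C. (cmod (\<delta> x))\<^sup>2) = 1"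
      using fin by (simp add: \<delta>_def if_distrib[of cmod] if_distrib[of "\<lambda>x. x\<^sup>2"] sum.delta cong: if_cong)
    then show ?thesis using True by (simp add: normalized_vec_def \<phi>'_def)
  next
    case False
    have "(\<Sum>x\<in>?C. (cmod (\<phi>' k x))\<^sup>2) = (\<Sum>x\<in>?C. (cmod (\<phi> k x))\<^sup>2) / p k"
      using False p0[of k] by (simp add: \<phi>'_def norm_divide power_divide sum_divide_distrib)
    then show ?thesis using False by (simp add: normalized_vec_def p_def mass_def)
  qed
  have pr: "of_real (p k) * proj (\<phi>' k) x y = \<phi> k x * cnj (\<phi> k y)" if "x \<in> ?C" for k x y
  proof (cases "p k = 0")
    case True
    then have "\<phi> k x = 0" using that fin unfolding p_def mass_def by (subst (asm) sum_nonneg_eq_0_iff) auto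
    then show ?thesis using True by simp
  next
    case False
    have "complex_of_real (sqrt (p k)) * of_real (sqrt (p k)) = of_real (p k)"
      using p0[of k] by (simp add: of_real_mult[symmetric] del: of_real_mult)
    then show ?thesis using False by (simp add: \<phi>'_def proj_def)
  qed
  have "of_real (\<Sum>k<card ?C. p k) = (\<Sum>x\<in>?C. \<rho> x x)"
    unfolding p_def of_real_sum tr_proj[symmetric] tr_def proj_def
    by (subst sum.swap) (use \<phi> in simp)
  also have "\<dots> = 1" using \<rho> by (simp add: density_op_def tr_def)
  finally have "(\<Sum>k<card ?C. p k) = 1" using of_real_eq_1_iff by blast
  then have "ensemble N d \<rho> (card ?C) p \<phi>'"
    unfolding ensemble_def using p0 nv pr \<phi> by simp
  then show ?thesis by blast
qed

theorem theorem3: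
  fixes N :: nat and d :: "nat \<Rightarrow> nat" and \<rho> :: qop
  assumes "N \<ge> 5"
    and "\<forall>i<N. d i \<ge> 2"
    and "density_op N d \<rho>"
  shows "(CN_mixed N d \<rho>)\<^sup>2 \<ge>
           real N / (2 ^ (N - 2) * (\<Prod>i<N. real (d i) - 1)) *
           (\<Sum>S\<in>substate_choices N d. \<Sum>i<N. \<Sum>j\<in>{i<..<N}.
               (Cij N (substate N S \<rho>) i j)\<^sup>2)"
proof -
  define r where "r = real N / (2 ^ (N - 2) * (\<Prod>i<N. real (d i) - 1)) *
           (\<Sum>S\<in>substate_choices N d. \<Sum>i<N. \<Sum>j\<in>{i<..<N}. (Cij N (substate N S \<rho>) i j)\<^sup>2)"
  have r: "r \<ge> 0" unfolding r_def using assms(2)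
    by (intro mult_nonneg_nonneg divide_nonneg_nonneg prod_nonneg sum_nonneg) force+
  have CN: "CN_mixed N d \<rho> = Inf {(\<Sum>k<n. p k * CN_pure N d (\<phi> k)) | n p \<phi>. ensemble N d \<rho> n p \<phi>}"
    unfolding CN_mixed_def ensemble_def ..
  \<comment> \<open>Minkowski's inequality bounds each ensemble average itself rather than its
    square, so the infimum is taken before squaring.\<close>
  have "sqrt r \<le> CN_mixed N d \<rho>"
    unfolding CN
  proof (rule cInf_greatest)
    show "{(\<Sum>k<n. p k * CN_pure N d (\<phi> k)) | n p \<phi>. ensemble N d \<rho> n p \<phi>} \<noteq> {}"
      using ensemble_exists[OF assms(2,3)] by blast
    show "sqrt r \<le> x" if "x \<in> {(\<Sum>k<n. p k * CN_pure N d (\<phi> k)) | n p \<phi>. ensemble N d \<rho> n p \<phi>}" for x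
      using that ensemble_bound[OF assms(1,2)] unfolding r_def by blast
  qed
  then have "(sqrt r)\<^sup>2 \<le> (CN_mixed N d \<rho>)\<^sup>2"
    using r by (intro power_mono) auto
  then show ?thesis unfolding r_def[symmetric] using r by simp
qed

end
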